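(* Let $e>0$ be an integer and let $\pi:\mathbb{F}_{e,r}\to\mathbb{F}_e$ be the blow up of $\mathbb{F}_e$ at $r$ distinct points $p_1,\dots,p_r$ such that $p_i\notin C_e$ for each $i$, and such that for $i\ne j$ the points $p_i$ and $p_j$ do not lie on the same fiber of $\phi:\mathbb{F}_e\to\mathbb{P}^1$. Let $L=aH_e+bF_e-m_1E_1-\dots-m_rE_r$ be a line bundle on $\mathbb{F}_{e,r}$ (with $a,b,m_1,\dots,m_r\in\mathbb{Z}$) such that: (1) $a+2>m_i+1>0$ for $1\le i\le r$; (2) $b+e+2>(a+2)e$; (3) $b+e+2>\sum_{i=1}^r(m_i+1)$. Then $L$ is globally generated.
   Context: We work over $\mathbb{C}$. For an integer $e\ge 0$, $\mathbb{F}_e=\mathbb{P}(\mathcal{O}_{\mathbb{P}^1}\oplus\mathcal{O}_{\mathbb{P}^1}(-e))$ is the Hirzebruch surface with invariant $e$, with projection $\phi:\mathbb{F}_e\to\mathbb{P}^1$. $C_e$ is the image of a section of $\phi$ whose divisor is associated to $\mathcal{O}_{\mathbb{F}_e}(1)$, and $f$ is a fiber of $\phi$. Then $\mathrm{Pic}\,\mathbb{F}_e=\mathbb{Z}C_e\oplus\mathbb{Z}f$ with $C_e^2=-e$, $f^2=0$, $C_e\cdot f=1$. On the blow up $\pi:\mathbb{F}_{e,r}\to\mathbb{F}_e$ at $p_1,\dots,p_r$, put $H_e=\pi^*C_e$, $F_e=\pi^*f$, and let $E_i=\pi^{-1}(p_i)$ be the exceptional divisors; $\mathrm{Pic}\,\mathbb{F}_{e,r}$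 is freely generated by $H_e,F_e,E_1,\dots,E_r$. Line bundles are written additively. *)

theory Defs
  imports Complex_Main "HOL-Computational_Algebra.Polynomial" "HOL-Analysis.Abstract_Topology"
begin

section \<open>Surfaces over the complex numbers\<close>

text \<open>Varieties are classical ones: sets of closed points with a Zariski topology and a sheaf of
  complex-valued regular functions. All surfaces needed here are covered by Zariski open subsets of
  the affine plane.\<close>

text \<open>A polynomial in two variables is a polynomial in the second coordinate whose coefficients
  are polynomials in the first.\<close>

definition poly2 :: "complex poly poly \<Rightarrow> complex \<times> complex \<Rightarrow> complex" where
  "poly2 Q a = poly (poly Q [:snd a:]) (fst a)"

definition plane_open :: "(complex \<times> complex) set \<Rightarrow> bool" where
  "plane_open W \<longleftrightarrow> (\<forall>a\<in>W. \<exists>Q. poly2 Q a \<noteq> 0 \<and> {b. poly2 Q b \<noteq> 0} \<subseteq> W)"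

definition plane_regular :: "(complex \<times> complex) set \<Rightarrow> (complex \<times> complex \<Rightarrow> complex) \<Rightarrow> bool" where
  "plane_regular W g \<longleftrightarrow>
     (\<forall>a\<in>W. \<exists>P Q. poly2 Q a \<noteq> 0 \<and> (\<forall>b\<in>W. poly2 Q b \<noteq> 0 \<longrightarrow> g b = poly2 P b / poly2 Q b))"

text \<open>A surface is given by an atlas of parametrisations: a chart \<open>(D, \<rho>)\<close> is a Zariski open subset
  \<open>D\<close> of the plane with an injective map \<open>\<rho>\<close> from \<open>D\<close> onto an open subset of the surface.\<close>

type_synonym 'a chart = "(complex \<times> complex) set \<times> (complex \<times> complex \<Rightarrow> 'a)"
type_synonym 'a atlas = "'a chart set"

definition points :: "'a atlas \<Rightarrow> 'a set" where
  "points A = (\<Union>(D, \<rho>)\<in>A. \<rho> ` D)"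

definition zariski :: "'a atlas \<Rightarrow> 'a topology" where
  "zariski A = topology (\<lambda>V. V \<subseteq> points A \<and> (\<forall>(D, \<rho>)\<in>A. plane_open (D \<inter> \<rho> -` V)))"

definition regular :: "'a atlas \<Rightarrow> 'a set \<Rightarrow> ('a \<Rightarrow> complex) \<Rightarrow> bool" where
  "regular A V f \<longleftrightarrow> (\<forall>(D, \<rho>)\<in>A. plane_regular (D \<inter> \<rho> -` V) (f \<circ> \<rho>))"

lemma pointsI: "(D,\<rho>)\<in>A \<Longrightarrow> v\<in>D \<Longrightarrow> \<rho> v \<in> points A" unfolding points_def by auto

lemma poly2_mult: "poly2 (P * Q) a = poly2 P a * poly2 Q a"
  by (simp add: poly2_def)

lemma plane_open_Int:
  assumes "plane_open V" "plane_open W"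
  shows "plane_open (V \<inter> W)"
  unfolding plane_open_def
proof
  fix a assume "a \<in> V \<inter> W"
  then obtain P Q where "poly2 P a \<noteq> 0" "{b. poly2 P b \<noteq> 0} \<subseteq> V"
      and "poly2 Q a \<noteq> 0" "{b. poly2 Q b \<noteq> 0} \<subseteq> W"
    using assms unfolding plane_open_def by (metis IntD1 IntD2)
  then show "\<exists>R. poly2 R a \<noteq> 0 \<and> {b. poly2 R b \<noteq> 0} \<subseteq> V \<inter> W"
    by (intro exI[of _ "P * Q"]) (auto simp: poly2_mult)
qed

lemma plane_open_Union:
  assumes "\<And>V. V \<in> K \<Longrightarrow> plane_open V"
  shows "plane_open (\<Union>K)"
  unfolding plane_open_def
proof
  fix a assume "a \<in> \<Union>K"
  then obtain V where "V \<in> K" "a \<in> V" by blast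
  then obtain Q where "poly2 Q a \<noteq> 0" "{b. poly2 Q b \<noteq> 0} \<subseteq> V"
    using assms unfolding plane_open_def by meson
  with \<open>V \<in> K\<close> show "\<exists>Q. poly2 Q a \<noteq> 0 \<and> {b. poly2 Q b \<noteq> 0} \<subseteq> \<Union>K" by blast
qed

lemma openin_zariski:
  "openin (zariski A) V \<longleftrightarrow> V \<subseteq> points A \<and> (\<forall>(D, \<rho>)\<in>A. plane_open (D \<inter> \<rho> -` V))"
proof -
  have "istopology (\<lambda>V. V \<subseteq> points A \<and> (\<forall>(D, \<rho>)\<in>A. plane_open (D \<inter> \<rho> -` V)))"
    unfolding istopology_def
  proof (intro conjI allI impI)
    fix S T
    assume S: "S \<subseteq> points A \<and> (\<forall>(D, \<rho>)\<in>A. plane_open (D \<inter> \<rho> -` S))"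
      and T: "T \<subseteq> points A \<and> (\<forall>(D, \<rho>)\<in>A. plane_open (D \<inter> \<rho> -` T))"
    show "S \<inter> T \<subseteq> points A" using S by blast
    show "\<forall>(D, \<rho>)\<in>A. plane_open (D \<inter> \<rho> -` (S \<inter> T))"
    proof clarify
      fix D \<rho> assume "(D, \<rho>) \<in> A"
      then have "plane_open ((D \<inter> \<rho> -` S) \<inter> (D \<inter> \<rho> -` T))"
        using S T by (blast intro: plane_open_Int)
      moreover have "(D \<inter> \<rho> -` S) \<inter> (D \<inter> \<rho> -` T) = D \<inter> \<rho> -` (S \<inter> T)" by blast
      ultimately show "plane_open (D \<inter> \<rho> -` (S \<inter> T))" by simp
    qed
  next
    fix K
    assume K: "\<forall>V\<in>K. V \<subseteq> points A \<and> (\<forall>(D, \<rho>)\<in>A. plane_open (D \<inter> \<rho> -` V))"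
    show "\<Union>K \<subseteq> points A" using K by blast
    show "\<forall>(D, \<rho>)\<in>A. plane_open (D \<inter> \<rho> -` \<Union>K)"
    proof clarify
      fix D \<rho> assume "(D, \<rho>) \<in> A"
      then have "plane_open (\<Union>((\<lambda>V. D \<inter> \<rho> -` V) ` K))"
        using K by (intro plane_open_Union) blast
      moreover have "\<Union>((\<lambda>V. D \<inter> \<rho> -` V) ` K) = D \<inter> \<rho> -` \<Union>K" by blast
      ultimately show "plane_open (D \<inter> \<rho> -` \<Union>K)" by simp
    qed
  qed
  then show ?thesis unfolding zariski_def by (simp add: topology_inverse')
qed

section \<open>Line bundles\<close>

text \<open>A line bundle is given by trivialising open sets and transition functions. The trivialising
  cover is indexed by the points of the surface, with \<open>x \<in> nbhd L x\<close>; every line bundle can be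
  presented in this way, and all operations can then be performed index by index. A vector with
  coordinate \<open>c\<close> over \<open>z\<close> in the trivialisation \<open>y\<close> has coordinate \<open>trans L x y z * c\<close> in the
  trivialisation \<open>x\<close>.\<close>

record 'a lbundle =
  nbhd :: "'a \<Rightarrow> 'a set"
  trans :: "'a \<Rightarrow> 'a \<Rightarrow> 'a \<Rightarrow> complex"

definition line_bundle :: "'a atlas \<Rightarrow> 'a lbundle \<Rightarrow> bool" where
  "line_bundle A L \<longleftrightarrow>
     (\<forall>x\<in>points A. openin (zariski A) (nbhd L x) \<and> x \<in> nbhd L x) \<and>
     (\<forall>x\<in>points A. \<forall>y\<in>points A. regular A (nbhd L x \<inter> nbhd L y) (trans L x y)) \<and>
     (\<forall>x\<in>points A. \<forall>z\<in>nbhd L x. trans L x x z = 1) \<and>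
     (\<forall>x\<in>points A. \<forall>y\<in>points A. \<forall>w\<in>points A. \<forall>z\<in>nbhd L x \<inter> nbhd L y \<inter> nbhd L w.
        trans L x y z * trans L y w z = trans L x w z)"

definition lb_iso :: "'a atlas \<Rightarrow> 'a lbundle \<Rightarrow> 'a lbundle \<Rightarrow> bool" where
  "lb_iso A L M \<longleftrightarrow> (\<exists>u.
     (\<forall>x\<in>points A. regular A (nbhd L x \<inter> nbhd M x) (u x) \<and>
        (\<forall>z\<in>nbhd L x \<inter> nbhd M x. u x z \<noteq> 0)) \<and>
     (\<forall>x\<in>points A. \<forall>y\<in>points A. \<forall>z\<in>nbhd L x \<inter> nbhd M x \<inter> nbhd L y \<inter> nbhd M y.
        u x z * trans M x y z = trans L x y z * u y z))"

definition lb_add :: "'a lbundle \<Rightarrow> 'a lbundle \<Rightarrow> 'a lbundle" where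
  "lb_add L M = \<lparr>nbhd = \<lambda>x. nbhd L x \<inter> nbhd M x,
                 trans = \<lambda>x y z. trans L x y z * trans M x y z\<rparr>"

definition lb_scale :: "int \<Rightarrow> 'a lbundle \<Rightarrow> 'a lbundle" where
  "lb_scale n L = \<lparr>nbhd = nbhd L, trans = \<lambda>x y z. trans L x y z powi n\<rparr>"

definition lb_sum :: "'a atlas \<Rightarrow> 'i set \<Rightarrow> ('i \<Rightarrow> 'a lbundle) \<Rightarrow> 'a lbundle" where
  "lb_sum A I L = \<lparr>nbhd = \<lambda>x. points A \<inter> (\<Inter>i\<in>I. nbhd (L i) x),
                   trans = \<lambda>x y z. \<Prod>i\<in>I. trans (L i) x y z\<rparr>"

definition lb_pullback :: "'b atlas \<Rightarrow> ('b \<Rightarrow> 'a) \<Rightarrow> 'a lbundle \<Rightarrow> 'b lbundle" where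
  "lb_pullback X \<pi> L = \<lparr>nbhd = \<lambda>x. points X \<inter> \<pi> -` nbhd L (\<pi> x),
                        trans = \<lambda>x y z. trans L (\<pi> x) (\<pi> y) (\<pi> z)\<rparr>"

text \<open>\<open>s x\<close> is the coordinate of the section in the trivialisation \<open>x\<close>.\<close>

definition global_section :: "'a atlas \<Rightarrow> 'a lbundle \<Rightarrow> ('a \<Rightarrow> 'a \<Rightarrow> complex) \<Rightarrow> bool" where
  "global_section A L s \<longleftrightarrow>
     (\<forall>x\<in>points A. regular A (nbhd L x) (s x)) \<and>
     (\<forall>x\<in>points A. \<forall>y\<in>points A. \<forall>z\<in>nbhd L x \<inter> nbhd L y. s x z = trans L x y z * s y z)"

text \<open>At every point \<open>x\<close> the stalk of the sheaf of sections, which the trivialisation \<open>x\<close> identifies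
  with the germs of regular functions at \<open>x\<close>, is generated by global sections as a module over the
  local ring.\<close>

definition globally_generated :: "'a atlas \<Rightarrow> 'a lbundle \<Rightarrow> bool" where
  "globally_generated A L \<longleftrightarrow>
     (\<forall>x\<in>points A. \<forall>V h. openin (zariski A) V \<and> x \<in> V \<and> V \<subseteq> nbhd L x \<and> regular A V h \<longrightarrow>
        (\<exists>(n::nat) s c W. openin (zariski A) W \<and> x \<in> W \<and> W \<subseteq> V \<and>
           (\<forall>j<n. global_section A L (s j) \<and> regular A W (c j)) \<and>
           (\<forall>z\<in>W. h z = (\<Sum>j<n. c j z * s j x z))))"

text \<open>\<open>L\<close> is the line bundle of the reduced curve \<open>Z\<close>: it has a section whose coordinates
  generate the ideal of \<open>Z\<close> at every point.\<close>

definition associated_to_curve :: "'a atlas \<Rightarrow> 'a set \<Rightarrow> 'a lbundle \<Rightarrow> bool" where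
  "associated_to_curve A Z L \<longleftrightarrow> line_bundle A L \<and> (\<exists>s. global_section A L s \<and>
     (\<forall>x\<in>points A. (\<forall>z\<in>nbhd L x \<inter> Z. s x z = 0) \<and>
        (\<forall>V h. openin (zariski A) V \<and> x \<in> V \<and> V \<subseteq> nbhd L x \<and> regular A V h \<and>
               (\<forall>z\<in>V \<inter> Z. h z = 0) \<longrightarrow>
           (\<exists>W k. openin (zariski A) W \<and> x \<in> W \<and> W \<subseteq> V \<and> regular A W k \<and>
              (\<forall>z\<in>W. h z = k z * s x z)))))"

section \<open>Hirzebruch surfaces\<close>

definition pclass :: "complex \<Rightarrow> complex \<Rightarrow> (complex \<times> complex) set" where
  "pclass s t = {(l * s, l * t) | l. l \<noteq> 0}"

definition P1 :: "(complex \<times> complex) set set" where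
  "P1 = {pclass s t | s t. (s, t) \<noteq> (0, 0)}"

type_synonym hpoint = "(complex \<times> complex \<times> complex \<times> complex) set"

text \<open>The total space of \<open>\<O>(e)\<close> over the projective line is the quotient of the triples \<open>(s, t, y)\<close>
  with \<open>(s, t) \<noteq> 0\<close> by the action \<open>l \<cdot> (s, t, y) = (l s, l t, l\<^sup>e y)\<close>. The projective bundle of
  \<open>\<O> \<oplus> \<O>(-e)\<close> (one-dimensional quotients of its fibres) is the space of lines in the fibres of the
  dual bundle \<open>\<O> \<oplus> \<O>(e)\<close>; \<open>x\<close> and \<open>y\<close> below are the two fibre coordinates of the latter.\<close>

definition hclass :: "nat \<Rightarrow> complex \<Rightarrow> complex \<Rightarrow> complex \<Rightarrow> complex \<Rightarrow> hpoint" where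
  "hclass e s t x y = {(l * s, l * t, k * x, k * l ^ e * y) | l k. l \<noteq> 0 \<and> k \<noteq> 0}"

definition hirzebruch :: "nat \<Rightarrow> hpoint atlas" where
  "hirzebruch e =
     {(UNIV, \<lambda>(z, w). hclass e 1 z 1 w), (UNIV, \<lambda>(z, w). hclass e 1 z w 1),
      (UNIV, \<lambda>(z, w). hclass e z 1 1 w), (UNIV, \<lambda>(z, w). hclass e z 1 w 1)}"

definition hproj :: "hpoint \<Rightarrow> (complex \<times> complex) set" where
  "hproj q = (\<lambda>(s, t, x, y). (s, t)) ` q"

lemma hclass_sub: assumes "l \<noteq> 0" "k \<noteq> 0"
  shows "hclass e (l*s) (l*t) (k*x) (k*l^e*y) \<subseteq> hclass e s t x y"
proof
  fix v assume "v \<in> hclass e (l*s) (l*t) (k*x) (k*l^e*y)"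
  then obtain l1 k1 where v: "v = (l1*(l*s), l1*(l*t), k1*(k*x), k1*l1^e*(k*l^e*y))" "l1\<noteq>0" "k1\<noteq>0"
    unfolding hclass_def by blast
  have "v = ((l1*l)*s, (l1*l)*t, (k1*k)*x, (k1*k)*(l1*l)^e*y)"
    unfolding v(1) by (simp add: power_mult_distrib)
  moreover have "l1*l \<noteq> 0" "k1*k \<noteq> 0" using v assms by auto
  ultimately show "v \<in> hclass e s t x y" unfolding hclass_def by blast
qed

lemma hclass_scale: assumes "l \<noteq> 0" "k \<noteq> 0"
  shows "hclass e (l*s) (l*t) (k*x) (k*l^e*y) = hclass e s t x y"
proof
  have "(1/k)*(1/l)^e*(k*l^e*y) = y" "(1/l)*(l*s)=s" "(1/l)*(l*t) = t" "(1/k)*(k*x)=x" using assms by (simp_all add: power_divide)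
  then have "hclass e s t x y = hclass e (1/l*(l*s)) (1/l*(l*t)) (1/k*(k*x)) (1/k*(1/l)^e*(k*l^e*y))"
    by (simp only:)
  also have "\<dots> \<subseteq> hclass e (l*s) (l*t) (k*x) (k*l^e*y)"
    using assms by (intro hclass_sub) auto
  finally show "hclass e s t x y \<subseteq> hclass e (l*s) (l*t) (k*x) (k*l^e*y)" .
qed (use assms in \<open>rule hclass_sub\<close>)

lemma hclass_self: "(s,t,x,y) \<in> hclass e s t x y"
  unfolding hclass_def by (rule CollectI, rule exI[of _ 1], rule exI[of _ 1]) simp

lemma points_hirzebruch:
  "points (hirzebruch e) = {hclass e s t x y | s t x y. (s, t) \<noteq> (0, 0) \<and> (x, y) \<noteq> (0, 0)}"
proof
  have A: "hclass e s t x y \<in> {hclass e s t x y | s t x y. (s, t) \<noteq> (0, 0) \<and> (x, y) \<noteq> (0, 0)}" 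
    if "(s, t) \<noteq> (0, 0)" "(x, y) \<noteq> (0, 0)" for s t x y using that by blast
  show "points (hirzebruch e) \<subseteq> {hclass e s t x y | s t x y. (s, t) \<noteq> (0, 0) \<and> (x, y) \<noteq> (0, 0)}"
    unfolding points_def hirzebruch_def proof clarify
    fix D \<rho> z w assume "(D,\<rho>) \<in> {(UNIV, \<lambda>(z, w). hclass e 1 z 1 w), (UNIV, \<lambda>(z, w). hclass e 1 z w 1),
      (UNIV, \<lambda>(z, w). hclass e z 1 1 w), (UNIV, \<lambda>(z, w). hclass e z 1 w 1)}"
    then have "\<rho> (z,w) \<in> {hclass e 1 z 1 w, hclass e 1 z w 1, hclass e z 1 1 w, hclass e z 1 w 1}" by auto
    moreover have "hclass e 1 z 1 w \<in> {hclass e s t x y | s t x y. (s, t) \<noteq> (0, 0) \<and> (x, y) \<noteq> (0, 0)}" by (rule A) auto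
    moreover have "hclass e 1 z w 1 \<in> {hclass e s t x y | s t x y. (s, t) \<noteq> (0, 0) \<and> (x, y) \<noteq> (0, 0)}" by (rule A) auto
    moreover have "hclass e z 1 1 w \<in> {hclass e s t x y | s t x y. (s, t) \<noteq> (0, 0) \<and> (x, y) \<noteq> (0, 0)}" by (rule A) auto
    moreover have "hclass e z 1 w 1 \<in> {hclass e s t x y | s t x y. (s, t) \<noteq> (0, 0) \<and> (x, y) \<noteq> (0, 0)}" by (rule A) auto
    ultimately show "\<exists>s t x y. \<rho> (z,w) = hclass e s t x y \<and> (s, t) \<noteq> (0, 0) \<and> (x, y) \<noteq> (0, 0)" by (elim insertE emptyE) auto
  qed
  have "hclass e s t x y \<in> points (hirzebruch e)" if nz: "(s, t) \<noteq> (0, 0)" "(x, y) \<noteq> (0, 0)" for s t x y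
  proof -
    have *: "hclass e s t x y = hclass e (1/c*s) (1/c*t) (1/d*x) (1/d*(1/c)^e*y)" if "c\<noteq>0" "d\<noteq>0" for c d
      using that by (subst hclass_scale) auto
    consider "s\<noteq>0" "x\<noteq>0" | "s\<noteq>0" "y\<noteq>0" | "t\<noteq>0" "x\<noteq>0" | "t\<noteq>0" "y\<noteq>0" using nz by auto
    then show ?thesis
    proof cases
      case 1
      have "s \<noteq> 0" "x \<noteq> 0" using 1 by auto
      note * = *[OF this]
      have "hclass e s t x y = (\<lambda>(z, w). hclass e 1 z 1 w) (t/s, 1/x*(1/s)^e*y)"
        by (rule trans[OF *]) (use 1(1) 1(2) in \<open>simp add: power_divide\<close>)
      moreover have "(\<lambda>(z, w). hclass e 1 z 1 w) (t/s, 1/x*(1/s)^e*y) \<in> points (hirzebruch e)"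
        by (rule pointsI[where D=UNIV]) (simp_all add: hirzebruch_def)
      ultimately show ?thesis by (simp only:)
    next
      case 2
      have "s \<noteq> 0" "y/s^e \<noteq> 0" using 2 by auto
      note * = *[OF this]
      have "hclass e s t x y = (\<lambda>(z, w). hclass e 1 z w 1) (t/s, s^e/y*x)"
        by (rule trans[OF *]) (use 2(1) 2(2) in \<open>simp add: power_divide\<close>)
      moreover have "(\<lambda>(z, w). hclass e 1 z w 1) (t/s, s^e/y*x) \<in> points (hirzebruch e)"
        by (rule pointsI[where D=UNIV]) (simp_all add: hirzebruch_def)
      ultimately show ?thesis by (simp only:)
    next
      case 3
      have "t \<noteq> 0" "x \<noteq> 0" using 3 by auto
      note * = *[OF this]
      have "hclass e s t x y = (\<lambda>(z, w). hclass e z 1 1 w) (s/t, 1/x*(1/t)^e*y)"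
        by (rule trans[OF *]) (use 3(1) 3(2) in \<open>simp add: power_divide\<close>)
      moreover have "(\<lambda>(z, w). hclass e z 1 1 w) (s/t, 1/x*(1/t)^e*y) \<in> points (hirzebruch e)"
        by (rule pointsI[where D=UNIV]) (simp_all add: hirzebruch_def)
      ultimately show ?thesis by (simp only:)
    next
      case 4
      have "t \<noteq> 0" "y/t^e \<noteq> 0" using 4 by auto
      note * = *[OF this]
      have "hclass e s t x y = (\<lambda>(z, w). hclass e z 1 w 1) (s/t, t^e/y*x)"
        by (rule trans[OF *]) (use 4(1) 4(2) in \<open>simp add: power_divide\<close>)
      moreover have "(\<lambda>(z, w). hclass e z 1 w 1) (s/t, t^e/y*x) \<in> points (hirzebruch e)"
        by (rule pointsI[where D=UNIV]) (simp_all add: hirzebruch_def)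
      ultimately show ?thesis by (simp only:)
    qed
  qed
  then show "{hclass e s t x y | s t x y. (s, t) \<noteq> (0, 0) \<and> (x, y) \<noteq> (0, 0)} \<subseteq> points (hirzebruch e)" by blast
qed

lemma hproj_hclass: "hproj (hclass e s t x y) = pclass s t"
proof
  show "hproj (hclass e s t x y) \<subseteq> pclass s t" unfolding hproj_def hclass_def pclass_def by auto
  show "pclass s t \<subseteq> hproj (hclass e s t x y)"
  proof
    fix v assume "v \<in> pclass s t"
    then obtain l where l: "v = (l*s,l*t)" "l\<noteq>0" unfolding pclass_def by blast
    have "(l*s,l*t,1*x,1*l^e*y) \<in> hclass e s t x y" unfolding hclass_def by (rule CollectI, rule exI[of _ l], rule exI[of _ 1]) (simp add: l)
    then have "(\<lambda>(s,t,x,y). (s,t)) (l*s,l*t,1*x,1*l^e*y) \<in> hproj (hclass e s t x y)" unfolding hproj_def by (rule imageI)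
    then show "v \<in> hproj (hclass e s t x y)" using l by simp
  qed
qed

lemma inj_on_hirzebruch_chart: "(D,\<rho>) \<in> hirzebruch e \<Longrightarrow> inj_on \<rho> D"
proof -
  have H: "\<exists>l k. l \<noteq> 0 \<and> k \<noteq> 0 \<and> s = l*s' \<and> t = l*t' \<and> x = k*x' \<and> y = k*l^e*y'" if "hclass e s t x y = hclass e s' t' x' y'" for s t x y s' t' x' y'
    using hclass_self[of s t x y e] unfolding that unfolding hclass_def by blast
  have "inj (\<lambda>(z, w). hclass e 1 z 1 w)" by (auto simp: inj_def dest!: H)
  moreover have "inj (\<lambda>(z, w). hclass e 1 z w 1)" by (auto simp: inj_def dest!: H)
  moreover have "inj (\<lambda>(z, w). hclass e z 1 1 w)" by (auto simp: inj_def dest!: H)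
  moreover have "inj (\<lambda>(z, w). hclass e z 1 w 1)" by (auto simp: inj_def dest!: H)
  ultimately show "(D,\<rho>) \<in> hirzebruch e \<Longrightarrow> inj_on \<rho> D" unfolding hirzebruch_def by auto
qed

text \<open>The coordinate \<open>x\<close> is the section of the tautological quotient \<open>\<O>(1)\<close> given by the summand \<open>\<O>\<close>
  of \<open>\<O> \<oplus> \<O>(-e)\<close>; for \<open>e > 0\<close> it is the only one up to scalars. Its divisor is the section of the
  projection with self-intersection \<open>-e\<close>.\<close>

definition neg_section :: "nat \<Rightarrow> hpoint set" where
  "neg_section e = {hclass e s t 0 y | s t y. (s, t) \<noteq> (0, 0) \<and> y \<noteq> 0}"

definition hfiber :: "nat \<Rightarrow> (complex \<times> complex) set \<Rightarrow> hpoint set" where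
  "hfiber e c = {q \<in> points (hirzebruch e). hproj q = c}"

section \<open>Blowing up points\<close>

datatype 'a bpoint = Away 'a | Exc 'a "(complex \<times> complex) set"

fun blowdown :: "'a bpoint \<Rightarrow> 'a" where
  "blowdown (Away q) = q"
| "blowdown (Exc p l) = p"

text \<open>In a chart \<open>(D, \<rho>)\<close> with \<open>\<rho> (a, b) = p\<close>, the blow-up at \<open>p\<close> is the surface
  \<open>{((z, w), [\<alpha> : \<beta>]). (z - a) * \<beta> = (w - b) * \<alpha>}\<close>, covered by the affine pieces \<open>\<alpha> = 1\<close> with
  coordinates \<open>(z - a, \<beta>)\<close> and \<open>\<beta> = 1\<close> with coordinates \<open>(\<alpha>, w - b)\<close>. The other points of \<open>S\<close>
  are removed from these pieces.\<close>

definition blowup_charts :: "'a set \<Rightarrow> 'a chart \<Rightarrow> complex \<times> complex \<Rightarrow> 'a bpoint atlas" where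
  "blowup_charts S = (\<lambda>(D, \<rho>) (a, b).
     {({(u, \<beta>). (a + u, b + u * \<beta>) \<in> D - \<rho> -` (S - {\<rho> (a, b)})},
       \<lambda>(u, \<beta>). if u = 0 then Exc (\<rho> (a, b)) (pclass 1 \<beta>) else Away (\<rho> (a + u, b + u * \<beta>))),
      ({(\<alpha>, v). (a + v * \<alpha>, b + v) \<in> D - \<rho> -` (S - {\<rho> (a, b)})},
       \<lambda>(\<alpha>, v). if v = 0 then Exc (\<rho> (a, b)) (pclass \<alpha> 1) else Away (\<rho> (a + v * \<alpha>, b + v)))})"

text \<open>One chart is chosen around each point of \<open>S\<close>; the choice affects the result only through the
  labelling of the points of the exceptional curves, which the differential of a change of charts
  transforms linearly.\<close>

definition centred_chart :: "'a atlas \<Rightarrow> 'a \<Rightarrow> 'a chart \<times> (complex \<times> complex)" where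
  "centred_chart A p = (SOME (c, a). c \<in> A \<and> a \<in> fst c \<and> snd c a = p)"

definition blowup :: "'a atlas \<Rightarrow> 'a set \<Rightarrow> 'a bpoint atlas" where
  "blowup A S = {(D - \<rho> -` S, Away \<circ> \<rho>) | D \<rho>. (D, \<rho>) \<in> A} \<union>
     (\<Union>p\<in>S. case centred_chart A p of (c, a) \<Rightarrow> blowup_charts S c a)"

definition exceptional :: "'a atlas \<Rightarrow> 'a set \<Rightarrow> 'a \<Rightarrow> 'a bpoint set" where
  "exceptional A S p = {q \<in> points (blowup A S). blowdown q = p}"

end

theory Submission
  imports Defs
begin

text \<open>In the Cox coordinates \<open>s, t, x, y\<close>, where \<open>C\<^sub>e\<close> is \<open>x = 0\<close>, a section of \<open>L\<close> is a form of
  bidegree \<open>(b, a)\<close> vanishing to order \<open>m\<^sub>i\<close> at \<open>p\<^sub>i\<close>. The hypotheses give \<open>0 \<le> m\<^sub>i \<le> a\<close>, \<open>a e \<le> b\<close> and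
  \<open>\<Sum> m\<^sub>i \<le> b\<close>, and then \<open>L\<close> splits into \<open>a\<close> classes \<open>C\<^sub>e + k f - \<Sum>\<^sub>T E\<^sub>i\<close> with \<open>k \<ge> max e |T|\<close> and some
  fibres: at each step \<open>T\<close> contains all points of maximal multiplicity \<open>a\<close> and no point of
  multiplicity \<open>0\<close>, and \<open>|T|\<close> is as close to \<open>e\<close> as possible. Each such class is
  free of base points: it contains \<open>C\<^sub>e\<close> plus the fibres through \<open>T\<close> plus \<open>k - |T|\<close> arbitrary fibres, and the
  graphs \<open>y \<mu>\<^sup>k\<^sup>-\<^sup>e + x h = 0\<close> with \<open>h\<close> an interpolating form in \<open>s, t\<close>; near a point of \<open>T\<close> these are
  smooth and transversal. Products of such forms give, for every point, a
  section of \<open>L\<close> that does not vanish there.\<close>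

section \<open>Polynomial and regular functions on the plane\<close>

text \<open>\<open>L\<close> is given only up to isomorphism, and the bundles of \<open>C_e\<close>,
  of a fibre and of the exceptional curves are known only through some section generating the ideal
  of the curve, so no trivialisation is explicit and a form cannot simply be read as a section of
  \<open>L\<close>. The defining sections give a rational section, the product of
  \<open>sC^a\<close>, \<open>sf^b\<close> and all \<open>sE_i^(-m_i)\<close>, which is multiplied
  by the rational function \<open>G / (x^a f^b)\<close> with \<open>f\<close> the linear form of the
  chosen fibre. Near each point every defining section is a unit times an explicit coordinate, so
  zeros and poles cancel and the product is regular there, with a value that can be controlled. The
  local pieces agree off a proper closed set, hence everywhere, and glue. This needs density
  arguments, supplied by the irreducibility of the plane, and a proof that the comparison factors
  are units, supplied by restriction to lines. Lines also replace derivatives on the exceptional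
  curves: the value of a section there is the slope of the form along the corresponding
  line.\<close>

lemma poly2_add: "poly2 (P + Q) a = poly2 P a + poly2 Q a"
  by (simp add: poly2_def)

lemma poly2_pCons: "poly2 (pCons c Q) v = poly c (fst v) + snd v * poly2 Q v"
  by (simp add: poly2_def)

lemma poly2_closure:
  assumes const: "\<And>c. K (\<lambda>_. c)"
    and add: "\<And>f g. K f \<Longrightarrow> K g \<Longrightarrow> K (\<lambda>x. f x + g x)"
    and mult: "\<And>f g. K f \<Longrightarrow> K g \<Longrightarrow> K (\<lambda>x. f x * g x)"
    and f: "K f1" "K f2"
  shows "K (\<lambda>x. poly2 Q (f1 x, f2 x))"
proof (induction Q)
  case 0
  show ?case by (simp add: poly2_def const)
next
  case (pCons c Q)
  have "K (\<lambda>x. poly c (f1 x))"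
    by (induction c) (auto intro!: const add mult f)
  then show ?case
    unfolding poly2_pCons fst_conv snd_conv by (intro add mult f pCons.IH)
qed

text \<open>Regard \<open>Q\<close> as a polynomial over the domain of polynomials in one variable:
  every constant \<open>[:w:]\<close> is a root, and there are infinitely many of them.\<close>

lemma poly2_eq_0:
  assumes "\<And>v. poly2 Q v = 0"
  shows "Q = 0"
proof (rule ccontr)
  assume "Q \<noteq> 0"
  then have fin: "finite {x. poly Q x = 0}" by (rule poly_roots_finite)
  have "poly Q [:w:] = 0" for w
  proof -
    have "poly (poly Q [:w:]) z = 0" for z
      using assms[of "(z, w)"] by (simp add: poly2_def)
    then show ?thesis using poly_all_0_iff_0 by blast
  qed
  then have "range (\<lambda>w. [:w:]) \<subseteq> {x. poly Q x = 0}" by auto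
  then have "finite (range (\<lambda>w::complex. [:w:]))" using fin by (rule finite_subset)
  moreover have "inj (\<lambda>w::complex. [:w:])" by (auto simp: inj_def)
  ultimately show False using finite_imageD infinite_UNIV_char_0 by blast
qed

text \<open>The plane is irreducible: over an integral domain \<open>P * Q\<close> vanishes only if
  a factor does. The density arguments rest on this.\<close>

lemma poly2_common_nonzero:
  assumes "poly2 P v \<noteq> 0" "poly2 Q w \<noteq> 0"
  shows "\<exists>u. poly2 P u \<noteq> 0 \<and> poly2 Q u \<noteq> 0"
proof (rule ccontr)
  assume "\<not> ?thesis"
  then have "P * Q = 0" by (intro poly2_eq_0) (auto simp: poly2_mult)
  then have "P = 0 \<or> Q = 0" by simp
  then show False using assms by (auto simp: poly2_def)
qed

definition plane_poly :: "(complex \<times> complex \<Rightarrow> complex) \<Rightarrow> bool" where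
  "plane_poly g \<longleftrightarrow> (\<exists>Q. \<forall>v. poly2 Q v = g v)"

named_theorems plane_poly_intros

lemma plane_poly_poly2 [plane_poly_intros]: "plane_poly (poly2 Q)"
  unfolding plane_poly_def by blast

lemma plane_poly_const [plane_poly_intros]: "plane_poly (\<lambda>_. c)"
  unfolding plane_poly_def by (rule exI[of _ "[:[:c:]:]"]) (simp add: poly2_def)

lemma plane_poly_fst [plane_poly_intros]: "plane_poly fst"
  unfolding plane_poly_def by (rule exI[of _ "[:[:0, 1:]:]"]) (simp add: poly2_def)

lemma plane_poly_snd [plane_poly_intros]: "plane_poly snd"
  unfolding plane_poly_def by (rule exI[of _ "[:0, 1:]"]) (simp add: poly2_def)

lemma plane_poly_add [plane_poly_intros]:
  "plane_poly f \<Longrightarrow> plane_poly g \<Longrightarrow> plane_poly (\<lambda>v. f v + g v)"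
  unfolding plane_poly_def by (metis poly2_add)

lemma plane_poly_mult [plane_poly_intros]:
  "plane_poly f \<Longrightarrow> plane_poly g \<Longrightarrow> plane_poly (\<lambda>v. f v * g v)"
  unfolding plane_poly_def by (metis poly2_mult)

lemma plane_poly_diff [plane_poly_intros]:
  assumes "plane_poly f" "plane_poly g"
  shows "plane_poly (\<lambda>v. f v - g v)"
  using plane_poly_add[OF assms(1) plane_poly_mult[OF plane_poly_const[of "- 1"] assms(2)]] by simp

lemma plane_poly_power [plane_poly_intros]: "plane_poly f \<Longrightarrow> plane_poly (\<lambda>v. f v ^ n)"
  by (induction n) (auto intro!: plane_poly_intros)

lemma plane_poly_prod [plane_poly_intros]:
  "(\<And>i. i \<in> I \<Longrightarrow> plane_poly (f i)) \<Longrightarrow> plane_poly (\<lambda>v. \<Prod>i\<in>I. f i v)"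
  by (induction I rule: infinite_finite_induct) (auto intro!: plane_poly_intros)

lemma plane_poly_compose:
  assumes "plane_poly g" "plane_poly f1" "plane_poly f2"
  shows "plane_poly (\<lambda>v. g (f1 v, f2 v))"
proof -
  obtain Q where Q: "\<And>v. g v = poly2 Q v" using assms(1) unfolding plane_poly_def by metis
  show ?thesis
    unfolding Q by (rule poly2_closure[where K = plane_poly]) (intro plane_poly_intros assms(2,3); assumption)+
qed

lemma plane_poly_common_nonzero:
  assumes "plane_poly f" "plane_poly g" "f v \<noteq> 0" "g w \<noteq> 0"
  shows "\<exists>u. f u \<noteq> 0 \<and> g u \<noteq> 0"
  using assms poly2_common_nonzero unfolding plane_poly_def by metis

lemma plane_poly_prod_nonzero:
  assumes "finite I" "\<And>i. i \<in> I \<Longrightarrow> plane_poly (f i)" "\<And>i. i \<in> I \<Longrightarrow> \<exists>v. f i v \<noteq> 0"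
  shows "\<exists>v. (\<Prod>i\<in>I. f i v) \<noteq> 0"
  using assms
proof (induction I rule: finite_induct)
  case (insert i I)
  then obtain v where "(\<Prod>i\<in>I. f i v) \<noteq> 0" by (metis insertCI)
  moreover obtain w where "f i w \<noteq> 0" using insert.prems(2)[of i] by auto
  moreover have "plane_poly (f i)" "plane_poly (\<lambda>v. \<Prod>i\<in>I. f i v)"
    using insert.prems(1) by (auto intro!: plane_poly_intros)
  ultimately obtain u where "f i u \<noteq> 0 \<and> (\<Prod>i\<in>I. f i u) \<noteq> 0"
    using plane_poly_common_nonzero[of "f i" "\<lambda>v. \<Prod>i\<in>I. f i v"] by blast
  then show ?case using insert.hyps by (intro exI[of _ u]) simp
qed simp

lemma plane_poly_line:
  assumes "plane_poly g"
  shows "\<exists>p. \<forall>t. g (a + t * c, b + t * d) = poly p t"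
proof -
  obtain Q where "\<And>v. g v = poly2 Q v" using assms unfolding plane_poly_def by metis
  moreover have "\<exists>p. (\<lambda>t. poly2 Q (a + t * c, b + t * d)) = poly p"
  proof (rule poly2_closure[where K = "\<lambda>f. \<exists>p. f = poly p"])
    show "\<exists>p. (\<lambda>_. k) = poly p" for k :: complex by (rule exI[of _ "[:k:]"]) auto
    show "\<exists>p. (\<lambda>t. a + t * c) = poly p" by (rule exI[of _ "[:a, c:]"]) auto
    show "\<exists>p. (\<lambda>t. b + t * d) = poly p" by (rule exI[of _ "[:b, d:]"]) auto
    show "\<exists>p. (\<lambda>t. f t + h t) = poly p" if "\<exists>p. f = poly p" "\<exists>p. h = poly p" for f h :: "complex \<Rightarrow> complex"
    proof -
      from that obtain p q where "f = poly p" "h = poly q" by blast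
      then have "(\<lambda>t. f t + h t) = poly (p + q)" by auto
      then show ?thesis by blast
    qed
    show "\<exists>p. (\<lambda>t. f t * h t) = poly p" if "\<exists>p. f = poly p" "\<exists>p. h = poly p" for f h :: "complex \<Rightarrow> complex"
    proof -
      from that obtain p q where "f = poly p" "h = poly q" by blast
      then have "(\<lambda>t. f t * h t) = poly (p * q)" by auto
      then show ?thesis by blast
    qed
  qed
  ultimately show ?thesis by metis
qed

lemma plane_poly_vanishing_decomp:
  assumes "plane_poly g" "g (a, b) = 0"
  shows "\<exists>g1 g2. plane_poly g1 \<and> plane_poly g2 \<and>
    (\<forall>z w. g (z, w) = (z - a) * g1 (z, w) + (w - b) * g2 (z, w))"
proof -
  \<comment> \<open>The value \<open>f (a, b)\<close> is kept arbitrary because the induction runs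
    through functions that do not vanish at the base point.\<close>
  define K :: "(complex \<times> complex \<Rightarrow> complex) \<Rightarrow> bool" where
    "K f \<longleftrightarrow> plane_poly f \<and> (\<exists>g1 g2. plane_poly g1 \<and> plane_poly g2 \<and>
      (\<forall>z w. f (z, w) = f (a, b) + (z - a) * g1 (z, w) + (w - b) * g2 (z, w)))" for f
  have KI: "K f" if "plane_poly f" "plane_poly g1" "plane_poly g2"
    "\<And>z w. f (z, w) = f (a, b) + (z - a) * g1 (z, w) + (w - b) * g2 (z, w)" for f g1 g2
    using that unfolding K_def by blast
  obtain Q where Q: "\<And>v. g v = poly2 Q v" using assms(1) unfolding plane_poly_def by metis
  have "K (\<lambda>v. poly2 Q (fst v, snd v))"
  proof (rule poly2_closure[where K = K])
    show "K (\<lambda>_. c)" for c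
      by (rule KI[of _ "\<lambda>_. 0" "\<lambda>_. 0"]) (auto intro: plane_poly_intros)
    show "K fst"
      by (rule KI[of _ "\<lambda>_. 1" "\<lambda>_. 0"]) (auto intro: plane_poly_intros)
    show "K snd"
      by (rule KI[of _ "\<lambda>_. 0" "\<lambda>_. 1"]) (auto intro: plane_poly_intros)
  next
    fix f h assume "K f" "K h"
    then obtain f1 f2 h1 h2 where p [plane_poly_intros]: "plane_poly f" "plane_poly h" "plane_poly f1" "plane_poly f2"
        "plane_poly h1" "plane_poly h2"
      and f: "\<And>z w. f (z, w) = f (a, b) + (z - a) * f1 (z, w) + (w - b) * f2 (z, w)"
      and h: "\<And>z w. h (z, w) = h (a, b) + (z - a) * h1 (z, w) + (w - b) * h2 (z, w)"
      unfolding K_def by blast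
    show "K (\<lambda>x. f x + h x)"
    proof (rule KI[of _ "\<lambda>v. f1 v + h1 v" "\<lambda>v. f2 v + h2 v"])
      fix z w show "f (z, w) + h (z, w) = f (a, b) + h (a, b) + (z - a) * (f1 (z, w) + h1 (z, w)) + (w - b) * (f2 (z, w) + h2 (z, w))"
        unfolding f[of z w] h[of z w] by (simp add: algebra_simps)
    qed (intro plane_poly_intros)+
    \<comment> \<open>Product rule: expand \<open>f\<close> first, and then \<open>h\<close> only in
      the term \<open>f (a, b) * h\<close>.\<close>
    show "K (\<lambda>x. f x * h x)"
    proof (rule KI[of _ "\<lambda>v. f1 v * h v + f (a, b) * h1 v" "\<lambda>v. f2 v * h v + f (a, b) * h2 v"])
      fix z w
      have "f (z, w) * h (z, w) = (f (a, b) + (z - a) * f1 (z, w) + (w - b) * f2 (z, w)) * h (z, w)"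
        unfolding f[of z w] by simp
      also have "\<dots> = f (a, b) * (h (a, b) + (z - a) * h1 (z, w) + (w - b) * h2 (z, w)) + ((z - a) * f1 (z, w) + (w - b) * f2 (z, w)) * h (z, w)"
        unfolding h[of z w, symmetric] by (simp add: algebra_simps)
      finally show "f (z, w) * h (z, w) = f (a, b) * h (a, b) + (z - a) * (f1 (z, w) * h (z, w) + f (a, b) * h1 (z, w)) + (w - b) * (f2 (z, w) * h (z, w) + f (a, b) * h2 (z, w))"
        by (simp add: algebra_simps)
    qed (intro plane_poly_intros)+
  qed
  then show ?thesis using assms(2) Q unfolding K_def by auto
qed

section \<open>Open sets and regular functions of the plane\<close>

lemma plane_open_poly:
  assumes "plane_poly g" shows "plane_open {v. g v \<noteq> 0}"
proof -
  obtain Q where "\<And>v. g v = poly2 Q v" using assms unfolding plane_poly_def by metis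
  then show ?thesis unfolding plane_open_def by (auto intro!: exI[of _ Q])
qed

lemma plane_open_UNIV: "plane_open UNIV"
  using plane_open_poly[OF plane_poly_const[of 1]] by simp

lemma plane_open_vimage:
  assumes "plane_open W" "plane_poly f1" "plane_poly f2"
  shows "plane_open {v. (f1 v, f2 v) \<in> W}"
  unfolding plane_open_def
proof clarify
  fix u v assume "(f1 (u, v), f2 (u, v)) \<in> W"
  then obtain Q where Q: "poly2 Q (f1 (u, v), f2 (u, v)) \<noteq> 0" "{b. poly2 Q b \<noteq> 0} \<subseteq> W"
    using assms(1) unfolding plane_open_def by blast
  obtain R where "\<And>v. poly2 R v = poly2 Q (f1 v, f2 v)"
    using plane_poly_compose[OF plane_poly_poly2[of Q] assms(2,3)] unfolding plane_poly_def by metis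
  then show "\<exists>R. poly2 R (u, v) \<noteq> 0 \<and> {b. poly2 R b \<noteq> 0} \<subseteq> {v. (f1 v, f2 v) \<in> W}"
    using Q by (intro exI[of _ R]) auto
qed

lemma plane_regular_subset: "plane_regular W g \<Longrightarrow> V \<subseteq> W \<Longrightarrow> plane_regular V g"
  unfolding plane_regular_def by (meson subsetD)

lemma plane_regular_cong:
  "(\<And>v. v \<in> W \<Longrightarrow> f v = g v) \<Longrightarrow> plane_regular W f \<longleftrightarrow> plane_regular W g"
  unfolding plane_regular_def by simp

lemma plane_regular_witness:
  assumes "poly2 Q a \<noteq> 0" "\<And>b. b \<in> W \<Longrightarrow> poly2 Q b \<noteq> 0 \<Longrightarrow> g b = poly2 P b / poly2 Q b"
  shows "\<exists>P Q. poly2 Q a \<noteq> 0 \<and> (\<forall>b\<in>W. poly2 Q b \<noteq> 0 \<longrightarrow> g b = poly2 P b / poly2 Q b)"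
  using assms by blast

lemma plane_regular_poly:
  assumes "plane_poly g" shows "plane_regular W g"
proof -
  obtain P where "\<And>v. g v = poly2 P v" using assms unfolding plane_poly_def by metis
  then show ?thesis unfolding plane_regular_def
    by (intro ballI plane_regular_witness[where P = P and Q = "[:[:1:]:]"]) (auto simp: poly2_def)
qed

lemma plane_regularE:
  assumes "plane_regular W g" "a \<in> W"
  obtains P Q where "poly2 Q a \<noteq> 0" "\<And>b. b \<in> W \<Longrightarrow> poly2 Q b \<noteq> 0 \<Longrightarrow> g b = poly2 P b / poly2 Q b"
  using assms unfolding plane_regular_def by blast

lemma plane_regular_add:
  assumes "plane_regular W f" "plane_regular W g"
  shows "plane_regular W (\<lambda>v. f v + g v)"
  unfolding plane_regular_def
proof
  fix a assume "a \<in> W"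
  obtain P Q where 1: "poly2 Q a \<noteq> 0" "\<And>b. b \<in> W \<Longrightarrow> poly2 Q b \<noteq> 0 \<Longrightarrow> f b = poly2 P b / poly2 Q b"
    using plane_regularE[OF assms(1) \<open>a \<in> W\<close>] by metis
  obtain P' Q' where 2: "poly2 Q' a \<noteq> 0" "\<And>b. b \<in> W \<Longrightarrow> poly2 Q' b \<noteq> 0 \<Longrightarrow> g b = poly2 P' b / poly2 Q' b"
    using plane_regularE[OF assms(2) \<open>a \<in> W\<close>] by metis
  show "\<exists>R T. poly2 T a \<noteq> 0 \<and> (\<forall>b\<in>W. poly2 T b \<noteq> 0 \<longrightarrow> f b + g b = poly2 R b / poly2 T b)"
    using 1 2 by (intro plane_regular_witness[where P = "P * Q' + P' * Q" and Q = "Q * Q'"])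
      (auto simp: poly2_mult poly2_add add_frac_eq)
qed

lemma plane_regular_mult:
  assumes "plane_regular W f" "plane_regular W g"
  shows "plane_regular W (\<lambda>v. f v * g v)"
  unfolding plane_regular_def
proof
  fix a assume "a \<in> W"
  obtain P Q where 1: "poly2 Q a \<noteq> 0" "\<And>b. b \<in> W \<Longrightarrow> poly2 Q b \<noteq> 0 \<Longrightarrow> f b = poly2 P b / poly2 Q b"
    using plane_regularE[OF assms(1) \<open>a \<in> W\<close>] by metis
  obtain P' Q' where 2: "poly2 Q' a \<noteq> 0" "\<And>b. b \<in> W \<Longrightarrow> poly2 Q' b \<noteq> 0 \<Longrightarrow> g b = poly2 P' b / poly2 Q' b"
    using plane_regularE[OF assms(2) \<open>a \<in> W\<close>] by metis
  show "\<exists>R T. poly2 T a \<noteq> 0 \<and> (\<forall>b\<in>W. poly2 T b \<noteq> 0 \<longrightarrow> f b * g b = poly2 R b / poly2 T b)"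
    using 1 2 by (intro plane_regular_witness[where P = "P * P'" and Q = "Q * Q'"]) (auto simp: poly2_mult)
qed

lemma plane_regular_inverse:
  assumes "plane_regular W f" "\<And>v. v \<in> W \<Longrightarrow> f v \<noteq> 0"
  shows "plane_regular W (\<lambda>v. inverse (f v))"
  unfolding plane_regular_def
proof
  fix a assume a: "a \<in> W"
  obtain P Q where 1: "poly2 Q a \<noteq> 0" "\<And>b. b \<in> W \<Longrightarrow> poly2 Q b \<noteq> 0 \<Longrightarrow> f b = poly2 P b / poly2 Q b"
    using plane_regularE[OF assms(1) a] by metis
  have "poly2 P a \<noteq> 0" using 1(1) 1(2)[of a] assms(2)[of a] a by auto
  then show "\<exists>R T. poly2 T a \<noteq> 0 \<and> (\<forall>b\<in>W. poly2 T b \<noteq> 0 \<longrightarrow> inverse (f b) = poly2 R b / poly2 T b)"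
    \<comment> \<open>The extra factor \<open>Q\<close> makes a nonzero denominator force
      \<open>poly2 Q b \<noteq> 0\<close>, where the given fraction is valid.\<close>
    using 1 by (intro plane_regular_witness[where P = "Q * Q" and Q = "P * Q"]) (auto simp: poly2_mult)
qed

lemma plane_regular_compose:
  assumes "plane_regular W g" "plane_poly f1" "plane_poly f2"
  shows "plane_regular {v. (f1 v, f2 v) \<in> W} (\<lambda>v. g (f1 v, f2 v))"
  unfolding plane_regular_def
proof
  fix a assume "a \<in> {v. (f1 v, f2 v) \<in> W}"
  then obtain P Q where 1: "poly2 Q (f1 a, f2 a) \<noteq> 0" "\<And>b. b \<in> W \<Longrightarrow> poly2 Q b \<noteq> 0 \<Longrightarrow> g b = poly2 P b / poly2 Q b"
    using plane_regularE[OF assms(1), of "(f1 a, f2 a)"] by blast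
  obtain P' Q' where "\<And>v. poly2 P' v = poly2 P (f1 v, f2 v)" "\<And>v. poly2 Q' v = poly2 Q (f1 v, f2 v)"
    using plane_poly_compose[OF plane_poly_poly2[of Q] assms(2,3)]
      plane_poly_compose[OF plane_poly_poly2[of P] assms(2,3)] unfolding plane_poly_def by metis
  then show "\<exists>P Q. poly2 Q a \<noteq> 0 \<and> (\<forall>b\<in>{v. (f1 v, f2 v) \<in> W}. poly2 Q b \<noteq> 0 \<longrightarrow> g (f1 b, f2 b) = poly2 P b / poly2 Q b)"
    using 1 by (intro plane_regular_witness[where P = P' and Q = Q']) auto
qed

lemma plane_regular_local:
  assumes "\<And>a. a \<in> W \<Longrightarrow> \<exists>V. plane_open V \<and> a \<in> V \<and> plane_regular (W \<inter> V) g"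
  shows "plane_regular W g"
  unfolding plane_regular_def
proof
  fix a assume a: "a \<in> W"
  then obtain V where V: "plane_open V" "a \<in> V" "plane_regular (W \<inter> V) g" using assms by blast
  obtain T where T: "poly2 T a \<noteq> 0" "{b. poly2 T b \<noteq> 0} \<subseteq> V"
    using V unfolding plane_open_def by blast
  obtain P Q where "poly2 Q a \<noteq> 0" "\<And>b. b \<in> W \<inter> V \<Longrightarrow> poly2 Q b \<noteq> 0 \<Longrightarrow> g b = poly2 P b / poly2 Q b"
    using plane_regularE[OF V(3)] a V(2) by blast
  then show "\<exists>P Q. poly2 Q a \<noteq> 0 \<and> (\<forall>b\<in>W. poly2 Q b \<noteq> 0 \<longrightarrow> g b = poly2 P b / poly2 Q b)"
    \<comment> \<open>Multiplying by \<open>T\<close> confines the condition to points of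
      \<open>V\<close>.\<close>
    using T by (intro plane_regular_witness[where P = "P * T" and Q = "Q * T"]) (auto simp: poly2_mult)
qed

lemma plane_open_nonzero:
  assumes "plane_open W" "plane_regular W g"
  shows "plane_open {v \<in> W. g v \<noteq> 0}"
  unfolding plane_open_def
proof
  fix a assume a: "a \<in> {v \<in> W. g v \<noteq> 0}"
  obtain T where T: "poly2 T a \<noteq> 0" "{b. poly2 T b \<noteq> 0} \<subseteq> W"
    using assms(1) a unfolding plane_open_def by blast
  obtain P Q where PQ: "poly2 Q a \<noteq> 0" "\<And>b. b \<in> W \<Longrightarrow> poly2 Q b \<noteq> 0 \<Longrightarrow> g b = poly2 P b / poly2 Q b"
    using plane_regularE[OF assms(2), of a] a by (metis (lifting) mem_Collect_eq)
  have "poly2 P a \<noteq> 0" using a PQ(2)[of a] PQ(1) by auto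
  then show "\<exists>Q. poly2 Q a \<noteq> 0 \<and> {b. poly2 Q b \<noteq> 0} \<subseteq> {v \<in> W. g v \<noteq> 0}"
    using T PQ by (intro exI[of _ "P * Q * T"]) (auto simp: poly2_mult)
qed

text \<open>The locus \<open>g \<noteq> 0\<close> is open; if it contained \<open>a\<close>, it
  would contain a nonempty basic open set and therefore meet \<open>d \<noteq> 0\<close>.\<close>

lemma plane_regular_dense:
  assumes "plane_open W" "plane_regular W g" "a \<in> W" "plane_poly d" "d v \<noteq> 0"
    and zero: "\<And>b. b \<in> W \<Longrightarrow> d b \<noteq> 0 \<Longrightarrow> g b = 0"
  shows "g a = 0"
proof (rule ccontr)
  assume "g a \<noteq> 0"
  then have "\<exists>Q. poly2 Q a \<noteq> 0 \<and> {b. poly2 Q b \<noteq> 0} \<subseteq> {v \<in> W. g v \<noteq> 0}"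
    using plane_open_nonzero[OF assms(1,2)] assms(3) unfolding plane_open_def by blast
  then obtain Q where Q: "poly2 Q a \<noteq> 0" "{b. poly2 Q b \<noteq> 0} \<subseteq> {v \<in> W. g v \<noteq> 0}" by blast
  then show False
    using plane_poly_common_nonzero[OF plane_poly_poly2[of Q] assms(4) Q(1) assms(5)] zero by blast
qed

text \<open>Restricted to the line, a product of two functions vanishing at the base point vanishes
  doubly there, so it cannot be a nonzero multiple of the parameter.\<close>

lemma plane_regular_simple_zero:
  assumes W: "plane_open W" "(a, b) \<in> W" and k: "plane_regular W k" and s: "plane_regular W s"
    and line: "\<And>t. (a + t * c, b + t * d) \<in> W \<Longrightarrow>
      k (a + t * c, b + t * d) * s (a + t * c, b + t * d) = l * t"
    and "l \<noteq> 0" and s0: "s (a, b) = 0"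
  shows "k (a, b) \<noteq> 0"
proof
  assume k0: "k (a, b) = 0"
  obtain T where T: "poly2 T (a, b) \<noteq> 0" "{b. poly2 T b \<noteq> 0} \<subseteq> W"
    using W unfolding plane_open_def by blast
  obtain P Q where PQ: "poly2 Q (a, b) \<noteq> 0" "\<And>b. b \<in> W \<Longrightarrow> poly2 Q b \<noteq> 0 \<Longrightarrow> k b = poly2 P b / poly2 Q b"
    using plane_regularE[OF k W(2)] by metis
  obtain P' Q' where PQ': "poly2 Q' (a, b) \<noteq> 0" "\<And>b. b \<in> W \<Longrightarrow> poly2 Q' b \<noteq> 0 \<Longrightarrow> s b = poly2 P' b / poly2 Q' b"
    using plane_regularE[OF s W(2)] by metis
  have "\<exists>p. \<forall>t. poly2 R (a + t * c, b + t * d) = poly p t" for R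
    using plane_poly_line[OF plane_poly_poly2] .
  then obtain \<Phi> where \<Phi>: "\<And>R t. poly2 R (a + t * c, b + t * d) = poly (\<Phi> R) t" by metis
  have at0: "poly (\<Phi> R) 0 = poly2 R (a, b)" for R using \<Phi>[of R 0] by simp
  \<comment> \<open>Where a fraction is undefined or the line leaves the basic open set, one of the
    extra factors vanishes, so the identity holds for every \<open>t\<close>.\<close>
  have "poly (([:0, l:] * \<Phi> Q * \<Phi> Q' - \<Phi> P * \<Phi> P') * \<Phi> Q * \<Phi> Q' * \<Phi> T) t = 0" for t
  proof (cases "poly (\<Phi> Q) t = 0 \<or> poly (\<Phi> Q') t = 0 \<or> poly (\<Phi> T) t = 0")
    case False
    let ?v = "(a + t * c, b + t * d)"
    have nz: "poly2 Q ?v \<noteq> 0" "poly2 Q' ?v \<noteq> 0" "?v \<in> W" using False T(2) by (auto simp: \<Phi>[symmetric])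
    have "poly2 P ?v / poly2 Q ?v * (poly2 P' ?v / poly2 Q' ?v) = l * t"
      using line[OF nz(3)] PQ(2)[OF nz(3,1)] PQ'(2)[OF nz(3,2)] by simp
    then have "poly2 P ?v * poly2 P' ?v = l * t * poly2 Q ?v * poly2 Q' ?v"
      using nz by (simp add: field_simps)
    then show ?thesis by (simp only: \<Phi>) (simp add: ac_simps)
  qed auto
  then have "([:0, l:] * \<Phi> Q * \<Phi> Q' - \<Phi> P * \<Phi> P') * \<Phi> Q * \<Phi> Q' * \<Phi> T = 0"
    by (simp only: poly_all_0_iff_0[symmetric]) blast
  moreover have "\<Phi> Q \<noteq> 0" "\<Phi> Q' \<noteq> 0" "\<Phi> T \<noteq> 0"
    using PQ(1) PQ'(1) T(1) by (auto simp: at0[symmetric])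
  ultimately have eq: "[:0, l:] * \<Phi> Q * \<Phi> Q' = \<Phi> P * \<Phi> P'" by simp
  have "poly (\<Phi> P) 0 = 0" "poly (\<Phi> P') 0 = 0"
    using k0 s0 PQ PQ' W(2) by (auto simp: at0)
  \<comment> \<open>Both numerators are divisible by the parameter; after cancelling it once, the
    right side still vanishes at 0 while the denominators and \<open>l\<close> do not.\<close>
  then obtain U U' where U: "\<Phi> P = [:0, 1:] * U" "\<Phi> P' = [:0, 1:] * U'"
    by (metis poly_eq_0_iff_dvd dvd_def minus_zero)
  have "[:0, 1:] * (smult l (\<Phi> Q * \<Phi> Q')) = [:0, 1:] * ([:0, 1:] * U * U')"
    using eq unfolding U by (simp add: mult_ac)
  then have "smult l (\<Phi> Q * \<Phi> Q') = [:0, 1:] * U * U'"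
    by (subst (asm) mult_left_cancel) auto
  then have "poly (smult l (\<Phi> Q * \<Phi> Q')) 0 = 0" by simp
  then show False using \<open>l \<noteq> 0\<close> PQ(1) PQ'(1) by (simp add: at0)
qed

section \<open>Regular functions and line bundles on an atlas\<close>

lemma openin_zariskiD: "openin (zariski A) V \<Longrightarrow> (D, \<rho>) \<in> A \<Longrightarrow> plane_open (D \<inter> \<rho> -` V)"
  unfolding openin_zariski by blast

lemma openin_zariski_subset: "openin (zariski A) V \<Longrightarrow> V \<subseteq> points A"
  unfolding openin_zariski by blast

lemma openin_zariskiI:
  "V \<subseteq> points A \<Longrightarrow> (\<And>D \<rho>. (D, \<rho>) \<in> A \<Longrightarrow> plane_open (D \<inter> \<rho> -` V)) \<Longrightarrow> openin (zariski A) V"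
  unfolding openin_zariski by blast

lemma openin_zariski_INT:
  assumes "finite I" "openin (zariski A) V" "\<And>i. i \<in> I \<Longrightarrow> openin (zariski A) (W i)"
  shows "openin (zariski A) (V \<inter> (\<Inter>i\<in>I. W i))"
  using assms(1,3)
proof (induction I rule: finite_induct)
  case (insert i I)
  have "V \<inter> (\<Inter>i\<in>insert i I. W i) = (V \<inter> (\<Inter>i\<in>I. W i)) \<inter> W i" by auto
  then show ?case using insert by (simp add: openin_Int)
qed (simp add: assms(2))

lemma pointsE:
  assumes "q \<in> points A"
  obtains D \<rho> a b where "(D, \<rho>) \<in> A" "(a, b) \<in> D" "q = \<rho> (a, b)"
  using assms unfolding points_def by auto

lemma regularI: "(\<And>D \<rho>. (D, \<rho>) \<in> A \<Longrightarrow> plane_regular (D \<inter> \<rho> -` V) (\<lambda>v. f (\<rho> v))) \<Longrightarrow> regular A V f"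
  unfolding regular_def comp_def by blast

lemma regularD: "regular A V f \<Longrightarrow> (D, \<rho>) \<in> A \<Longrightarrow> plane_regular (D \<inter> \<rho> -` V) (\<lambda>v. f (\<rho> v))"
  unfolding regular_def comp_def by blast

lemma regular_subset: "regular A W f \<Longrightarrow> V \<subseteq> W \<Longrightarrow> regular A V f"
  by (rule regularI, rule plane_regular_subset, erule (1) regularD) auto

lemma regular_cong: "(\<And>q. q \<in> V \<Longrightarrow> f q = g q) \<Longrightarrow> regular A V f \<longleftrightarrow> regular A V g"
  unfolding regular_def by (intro ball_cong refl) (auto intro!: plane_regular_cong)

named_theorems regular_intros

lemma regular_const [regular_intros]: "regular A V (\<lambda>_. c)"
  by (rule regularI, rule plane_regular_poly, rule plane_poly_const)

lemma regular_add [regular_intros]: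
  "regular A V f \<Longrightarrow> regular A V g \<Longrightarrow> regular A V (\<lambda>q. f q + g q)"
  by (rule regularI, rule plane_regular_add; erule (1) regularD)

lemma regular_mult [regular_intros]:
  "regular A V f \<Longrightarrow> regular A V g \<Longrightarrow> regular A V (\<lambda>q. f q * g q)"
  by (rule regularI, rule plane_regular_mult; erule (1) regularD)

lemma regular_inverse:
  "regular A V f \<Longrightarrow> (\<And>q. q \<in> V \<Longrightarrow> f q \<noteq> 0) \<Longrightarrow> regular A V (\<lambda>q. inverse (f q))"
  by (rule regularI, rule plane_regular_inverse, erule (1) regularD) auto

lemma regular_divide:
  "regular A V f \<Longrightarrow> regular A V g \<Longrightarrow> (\<And>q. q \<in> V \<Longrightarrow> g q \<noteq> 0) \<Longrightarrow> regular A V (\<lambda>q. f q / g q)"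
  unfolding divide_inverse by (intro regular_mult regular_inverse)

lemma regular_diff [regular_intros]:
  assumes "regular A V f" "regular A V g" shows "regular A V (\<lambda>q. f q - g q)"
  using regular_add[OF assms(1) regular_mult[OF regular_const[of _ _ "- 1"] assms(2)]] by simp

lemma regular_power [regular_intros]: "regular A V f \<Longrightarrow> regular A V (\<lambda>q. f q ^ n)"
  by (induction n) (auto intro!: regular_intros)

lemma regular_prod [regular_intros]:
  "(\<And>i. i \<in> I \<Longrightarrow> regular A V (f i)) \<Longrightarrow> regular A V (\<lambda>q. \<Prod>i\<in>I. f i q)"
  by (induction I rule: infinite_finite_induct) (auto intro!: regular_intros)

lemma regular_powi:
  assumes "regular A V f" "\<And>q. q \<in> V \<Longrightarrow> f q \<noteq> 0"
  shows "regular A V (\<lambda>q. f q powi n)"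
proof (cases "n \<ge> 0")
  case True
  then show ?thesis using assms by (simp add: power_int_def regular_power)
next
  case False
  then show ?thesis using assms by (simp add: power_int_def regular_power regular_inverse)
qed

lemma regular_plane_poly:
  assumes "plane_poly g" "regular A V f1" "regular A V f2"
  shows "regular A V (\<lambda>q. g (f1 q, f2 q))"
proof -
  obtain Q where Q: "\<And>v. g v = poly2 Q v" using assms(1) unfolding plane_poly_def by metis
  show ?thesis
    unfolding Q by (rule poly2_closure[where K = "regular A V"]) (intro regular_intros assms(2,3); assumption)+
qed

lemma regular_local:
  assumes "\<And>q. q \<in> V \<Longrightarrow> \<exists>W. openin (zariski A) W \<and> q \<in> W \<and> regular A (V \<inter> W) f"
  shows "regular A V f"
proof (rule regularI, rule plane_regular_local)
  fix D \<rho> v assume D: "(D, \<rho>) \<in> A" and v: "v \<in> D \<inter> \<rho> -` V"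
  then obtain W where W: "openin (zariski A) W" "\<rho> v \<in> W" "regular A (V \<inter> W) f" using assms by blast
  have eq: "D \<inter> \<rho> -` V \<inter> (D \<inter> \<rho> -` W) = D \<inter> \<rho> -` (V \<inter> W)" by blast
  show "\<exists>U. plane_open U \<and> v \<in> U \<and> plane_regular (D \<inter> \<rho> -` V \<inter> U) (\<lambda>v. f (\<rho> v))"
    using openin_zariskiD[OF W(1) D] regularD[OF W(3) D] v W(2)
    by (intro exI[of _ "D \<inter> \<rho> -` W"]) (simp add: eq)
qed

lemma openin_nonzero:
  assumes "openin (zariski A) W" "regular A W f"
  shows "openin (zariski A) {q \<in> W. f q \<noteq> 0}"
proof (rule openin_zariskiI)
  show "{q \<in> W. f q \<noteq> 0} \<subseteq> points A" using openin_zariski_subset[OF assms(1)] by blast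
  fix D \<rho> assume D: "(D, \<rho>) \<in> A"
  have "D \<inter> \<rho> -` {q \<in> W. f q \<noteq> 0} = {v \<in> D \<inter> \<rho> -` W. f (\<rho> v) \<noteq> 0}" by blast
  then show "plane_open (D \<inter> \<rho> -` {q \<in> W. f q \<noteq> 0})"
    using plane_open_nonzero[OF openin_zariskiD[OF assms(1) D] regularD[OF assms(2) D]] by simp
qed

text \<open>Stronger than being a morphism: each source chart goes into a single target chart by
  polynomials. The blow-down qualifies because every chart of the blow-up is built over one chart of
  the surface; open sets and regular functions then pull back by substitution.\<close>

definition chartwise_polynomial :: "'b atlas \<Rightarrow> 'a atlas \<Rightarrow> ('b \<Rightarrow> 'a) \<Rightarrow> bool" where
  "chartwise_polynomial X A \<pi> \<longleftrightarrow> (\<forall>D \<rho>. (D, \<rho>) \<in> X \<longrightarrow> plane_open D \<and>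
     (\<exists>D' \<rho>' f1 f2. (D', \<rho>') \<in> A \<and> plane_poly f1 \<and> plane_poly f2 \<and>
        (\<forall>v\<in>D. (f1 v, f2 v) \<in> D' \<and> \<pi> (\<rho> v) = \<rho>' (f1 v, f2 v))))"

lemma openin_pullback:
  assumes \<pi>: "chartwise_polynomial X A \<pi>" and V: "openin (zariski A) V"
  shows "openin (zariski X) {q \<in> points X. \<pi> q \<in> V}"
proof (rule openin_zariskiI)
  fix D \<rho> assume D: "(D, \<rho>) \<in> X"
  then obtain D' \<rho>' f1 f2 where *: "plane_open D" "(D', \<rho>') \<in> A" "plane_poly f1" "plane_poly f2"
      "\<And>v. v \<in> D \<Longrightarrow> (f1 v, f2 v) \<in> D' \<and> \<pi> (\<rho> v) = \<rho>' (f1 v, f2 v)"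
    using \<pi> unfolding chartwise_polynomial_def by metis
  have "D \<inter> \<rho> -` {q \<in> points X. \<pi> q \<in> V} = D \<inter> {v. (f1 v, f2 v) \<in> D' \<inter> \<rho>' -` V}"
    using *(5) pointsI[OF D] by auto
  then show "plane_open (D \<inter> \<rho> -` {q \<in> points X. \<pi> q \<in> V})"
    using plane_open_Int[OF *(1) plane_open_vimage[OF openin_zariskiD[OF V *(2)] *(3,4)]] by simp
qed blast

lemma regular_pullback:
  assumes \<pi>: "chartwise_polynomial X A \<pi>" and f: "regular A V f"
  shows "regular X {q. \<pi> q \<in> V} (\<lambda>q. f (\<pi> q))"
proof (rule regularI)
  fix D \<rho> assume D: "(D, \<rho>) \<in> X"
  then obtain D' \<rho>' f1 f2 where *: "(D', \<rho>') \<in> A" "plane_poly f1" "plane_poly f2"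
      "\<And>v. v \<in> D \<Longrightarrow> (f1 v, f2 v) \<in> D' \<and> \<pi> (\<rho> v) = \<rho>' (f1 v, f2 v)"
    using \<pi> unfolding chartwise_polynomial_def by metis
  have "plane_regular (D \<inter> \<rho> -` {q. \<pi> q \<in> V}) (\<lambda>v. f (\<rho>' (f1 v, f2 v)))"
    by (rule plane_regular_subset[OF plane_regular_compose[OF regularD[OF f *(1)] *(2,3)]]) (use *(4) in auto)
  then show "plane_regular (D \<inter> \<rho> -` {q. \<pi> q \<in> V}) (\<lambda>v. f (\<pi> (\<rho> v)))"
    by (subst plane_regular_cong[where g = "\<lambda>v. f (\<rho>' (f1 v, f2 v))"]) (use *(4) in auto)
qed

section \<open>Sections cutting out curves, and their local equations\<close>

definition curve_section :: "'a atlas \<Rightarrow> 'a set \<Rightarrow> 'a lbundle \<Rightarrow> ('a \<Rightarrow> 'a \<Rightarrow> complex) \<Rightarrow> bool" where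
  "curve_section A Z L s \<longleftrightarrow> global_section A L s \<and>
     (\<forall>x\<in>points A. (\<forall>z\<in>nbhd L x \<inter> Z. s x z = 0) \<and>
        (\<forall>V h. openin (zariski A) V \<and> x \<in> V \<and> V \<subseteq> nbhd L x \<and> regular A V h \<and>
               (\<forall>z\<in>V \<inter> Z. h z = 0) \<longrightarrow>
           (\<exists>W k. openin (zariski A) W \<and> x \<in> W \<and> W \<subseteq> V \<and> regular A W k \<and>
              (\<forall>z\<in>W. h z = k z * s x z))))"

lemma associated_to_curveE:
  assumes "associated_to_curve A Z L"
  obtains s where "line_bundle A L" "curve_section A Z L s"
  using assms unfolding associated_to_curve_def curve_section_def by blast

lemma line_bundle_open: "line_bundle A L \<Longrightarrow> x \<in> points A \<Longrightarrow> openin (zariski A) (nbhd L x)"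
  and line_bundle_centre: "line_bundle A L \<Longrightarrow> x \<in> points A \<Longrightarrow> x \<in> nbhd L x"
  unfolding line_bundle_def by blast+

lemma curve_section_trans:
  assumes "curve_section A Z L s" "x \<in> points A" "y \<in> points A" "z \<in> nbhd L x" "z \<in> nbhd L y"
  shows "s x z = trans L x y z * s y z"
  using assms unfolding curve_section_def global_section_def by blast

lemma curve_section_generates:
  assumes "curve_section A Z L s" "x \<in> points A" "openin (zariski A) V" "x \<in> V" "V \<subseteq> nbhd L x"
    "regular A V h" "\<forall>z\<in>V \<inter> Z. h z = 0"
  shows "\<exists>W k. openin (zariski A) W \<and> x \<in> W \<and> W \<subseteq> V \<and> regular A W k \<and> (\<forall>z\<in>W. h z = k z * s x z)"
  using assms(1)[unfolded curve_section_def, THEN conjunct2, THEN bspec, OF assms(2), THEN conjunct2,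
    rule_format, of V h] assms(3-7) by blast

text \<open>A transversality test without derivatives: along some line in a chart, \<open>h\<close>
  is exactly a nonzero multiple of the parameter. The equations to be tested are affine coordinates
  or linear forms, so exact linearity is available.\<close>

definition simple_zero :: "'a atlas \<Rightarrow> 'a set \<Rightarrow> ('a \<Rightarrow> complex) \<Rightarrow> 'a \<Rightarrow> bool" where
  "simple_zero A V h x \<longleftrightarrow> (\<exists>D \<rho> a b c d l. (D, \<rho>) \<in> A \<and> (a, b) \<in> D \<and> \<rho> (a, b) = x \<and> l \<noteq> 0 \<and>
     (\<forall>t. (a + t * c, b + t * d) \<in> D \<and> \<rho> (a + t * c, b + t * d) \<in> V \<longrightarrow>
        h (\<rho> (a + t * c, b + t * d)) = l * t))"

lemma simple_zeroI:
  assumes "(D, \<rho>) \<in> A" "(a, b) \<in> D" "\<rho> (a, b) = x" "l \<noteq> 0"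
    "\<And>t. h (\<rho> (a + t * c, b + t * d)) = l * t"
  shows "simple_zero A V h x"
  unfolding simple_zero_def using assms by metis

text \<open>If the given equation has a simple zero along some line in a chart, it is a unit multiple of
  the defining section: in \<open>h = k * s\<close> the factor \<open>k\<close> cannot vanish as well.\<close>

lemma curve_section_local_equation:
  assumes L: "line_bundle A L" and s: "curve_section A Z L s" and x: "x \<in> points A"
    and V: "openin (zariski A) V" "x \<in> V" and h: "regular A V h" "\<And>z. z \<in> V \<inter> Z \<Longrightarrow> h z = 0"
    and simple: "h x \<noteq> 0 \<or> x \<in> Z \<and> simple_zero A V h x"
  shows "\<exists>W \<kappa>. openin (zariski A) W \<and> x \<in> W \<and> W \<subseteq> V \<inter> nbhd L x \<and> regular A W \<kappa> \<and>
    (\<forall>z\<in>W. \<kappa> z \<noteq> 0 \<and> s x z = \<kappa> z * h z)"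
proof -
  let ?V = "V \<inter> nbhd L x"
  have N: "openin (zariski A) (nbhd L x)" "x \<in> nbhd L x"
    using line_bundle_open[OF L x] line_bundle_centre[OF L x] .
  have "openin (zariski A) ?V" "x \<in> ?V" "?V \<subseteq> nbhd L x" "regular A ?V h" "\<forall>z\<in>?V \<inter> Z. h z = 0"
    using V h N by (auto intro: openin_Int regular_subset)
  then obtain W k where W: "openin (zariski A) W" "x \<in> W" "W \<subseteq> ?V" "regular A W k"
      "\<And>z. z \<in> W \<Longrightarrow> h z = k z * s x z"
    using curve_section_generates[OF s x] by metis
  have sr: "regular A W (s x)"
    using s x W(3) unfolding curve_section_def global_section_def by (meson regular_subset le_infE)
  have "k x \<noteq> 0"
  proof (cases "h x = 0")
    case False
    then show ?thesis using W(5)[OF W(2)] by auto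
  next
    case True
    then obtain D \<rho> a b c d l where *: "x \<in> Z" "(D, \<rho>) \<in> A" "(a, b) \<in> D" "\<rho> (a, b) = x" "l \<noteq> 0"
        "\<And>t. (a + t * c, b + t * d) \<in> D \<Longrightarrow> \<rho> (a + t * c, b + t * d) \<in> V \<Longrightarrow>
           h (\<rho> (a + t * c, b + t * d)) = l * t"
      using simple unfolding simple_zero_def by metis
    have "s x x = 0" using s x N(2) \<open>x \<in> Z\<close> unfolding curve_section_def by blast
    have "(\<lambda>v. k (\<rho> v)) (a, b) \<noteq> 0"
    proof (rule plane_regular_simple_zero[where W = "D \<inter> \<rho> -` W" and c = c and d = d and l = l])
      show "plane_open (D \<inter> \<rho> -` W)" using W(1) *(2) by (rule openin_zariskiD)
      show "(a, b) \<in> D \<inter> \<rho> -` W" using * W(2) by auto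
      show "plane_regular (D \<inter> \<rho> -` W) (\<lambda>v. k (\<rho> v))" using W(4) *(2) by (rule regularD)
      show "plane_regular (D \<inter> \<rho> -` W) (\<lambda>v. s x (\<rho> v))" using sr *(2) by (rule regularD)
      show "s x (\<rho> (a, b)) = 0" using *(4) \<open>s x x = 0\<close> by simp
      show "k (\<rho> (a + t * c, b + t * d)) * s x (\<rho> (a + t * c, b + t * d)) = l * t"
        if "(a + t * c, b + t * d) \<in> D \<inter> \<rho> -` W" for t
        using that *(6)[of t] W(3) W(5)[of "\<rho> (a + t * c, b + t * d)"] by auto
    qed (rule *(5))
    then show ?thesis using *(4) by simp
  qed
  let ?W = "{z \<in> W. k z \<noteq> 0}"
  have "openin (zariski A) ?W" using W(1,4) by (rule openin_nonzero)
  moreover have "regular A ?W (\<lambda>z. inverse (k z))"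
    by (rule regular_inverse) (auto intro: regular_subset[OF W(4)])
  moreover have "\<forall>z\<in>?W. inverse (k z) \<noteq> 0 \<and> s x z = inverse (k z) * h z"
    using W(5) by auto
  ultimately show ?thesis using W(2,3) \<open>k x \<noteq> 0\<close>
    by (intro exI[of _ ?W] exI[of _ "\<lambda>z. inverse (k z)"]) auto
qed

section \<open>Gluing local sections that agree off a thin set\<close>

definition sparse :: "'a atlas \<Rightarrow> 'a set \<Rightarrow> bool" where
  "sparse A N \<longleftrightarrow> (\<forall>D \<rho>. (D, \<rho>) \<in> A \<longrightarrow>
     (\<exists>d w. plane_poly d \<and> d w \<noteq> 0 \<and> (\<forall>v\<in>D. d v \<noteq> 0 \<longrightarrow> \<rho> v \<notin> N)))"

lemma regular_zero_off_sparse: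
  assumes "sparse A N" "openin (zariski A) W" "regular A W f" "x \<in> W"
    and "\<And>z. z \<in> W - N \<Longrightarrow> f z = 0"
  shows "f x = 0"
proof -
  obtain D \<rho> a b where D: "(D, \<rho>) \<in> A" "(a, b) \<in> D" "x = \<rho> (a, b)"
    using pointsE openin_zariski_subset[OF assms(2)] assms(4) by (metis subsetD)
  obtain d w where d: "plane_poly d" "d w \<noteq> 0" "\<And>v. v \<in> D \<Longrightarrow> d v \<noteq> 0 \<Longrightarrow> \<rho> v \<notin> N"
    using assms(1) D(1) unfolding sparse_def by blast
  have "(\<lambda>v. f (\<rho> v)) (a, b) = 0"
    by (rule plane_regular_dense[OF openin_zariskiD[OF assms(2) D(1)] regularD[OF assms(3) D(1)] _ d(1,2)])
      (use D assms(4,5) d(3) in auto)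
  then show ?thesis using D by simp
qed

text \<open>Agreement off \<open>N\<close> extends over \<open>N\<close> by density. Since the cover
  is indexed by points, the value at \<open>z\<close> can be taken from the local section with index
  \<open>z\<close> itself, so no choice of an index is involved.\<close>

lemma global_section_glue:
  assumes L: "line_bundle A L" and N: "sparse A N"
    and W: "\<And>q. q \<in> points A \<Longrightarrow> openin (zariski A) (W q) \<and> q \<in> W q \<and> W q \<subseteq> nbhd L q \<and> regular A (W q) (\<tau> q)"
    and compat: "\<And>q q' z. q \<in> points A \<Longrightarrow> q' \<in> points A \<Longrightarrow> z \<in> W q \<inter> W q' - N \<Longrightarrow>
      \<tau> q z = trans L q q' z * \<tau> q' z"
  shows "\<exists>\<sigma>. global_section A L \<sigma> \<and> (\<forall>q\<in>points A. \<sigma> q q = \<tau> q q)"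
proof -
  have treg: "regular A (nbhd L x \<inter> nbhd L y) (trans L x y)" if "x \<in> points A" "y \<in> points A" for x y
    using L that unfolding line_bundle_def by blast
  have tid: "trans L x x z = 1" if "x \<in> points A" "z \<in> nbhd L x" for x z
    using L that unfolding line_bundle_def by blast
  have tco: "trans L x y z * trans L y w z = trans L x w z"
    if "x \<in> points A" "y \<in> points A" "w \<in> points A" "z \<in> nbhd L x" "z \<in> nbhd L y" "z \<in> nbhd L w" for x y w z
    using L that unfolding line_bundle_def by blast
  have Wp: "W q \<subseteq> points A" if "q \<in> points A" for q
    using W[OF that] openin_zariski_subset by blast
  have Np: "nbhd L q \<subseteq> points A" if "q \<in> points A" for q
    using line_bundle_open[OF L that] openin_zariski_subset by blast
  \<comment> \<open>Compares the pieces of index \<open>y\<close> and of index \<open>z\<close> at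
    the point \<open>z\<close>, as members of the ring of functions on
    \<open>W y \<inter> W z\<close>.\<close>
  have comp: "\<tau> y z = trans L y z z * \<tau> z z" if y: "y \<in> points A" and z: "z \<in> W y" for y z
  proof -
    have zp: "z \<in> points A" using Wp y z by blast
    have "(\<lambda>w. \<tau> y w - trans L y z w * \<tau> z w) z = 0"
    proof (rule regular_zero_off_sparse[OF N, where W = "W y \<inter> W z" and f = "\<lambda>w. \<tau> y w - trans L y z w * \<tau> z w"])
      show "openin (zariski A) (W y \<inter> W z)" using W[OF y] W[OF zp] by (blast intro: openin_Int)
      show "regular A (W y \<inter> W z) (\<lambda>w. \<tau> y w - trans L y z w * \<tau> z w)"
        using W[OF y] W[OF zp]
        by (intro regular_intros regular_subset[OF treg[OF y zp]]) (auto intro: regular_subset)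
      show "z \<in> W y \<inter> W z" using z W[OF zp] by blast
    qed (use compat[OF y zp] in auto)
    then show ?thesis by simp
  qed
  define \<sigma> where "\<sigma> q z = trans L q z z * \<tau> z z" for q z
  have "global_section A L \<sigma>"
    unfolding global_section_def
  proof (intro conjI ballI)
    fix x assume x: "x \<in> points A"
    show "regular A (nbhd L x) (\<sigma> x)"
    proof (rule regular_local)
      fix y assume y: "y \<in> nbhd L x"
      then have yp: "y \<in> points A" using Np x by blast
      have r: "regular A (nbhd L x \<inter> W y) (\<lambda>z. trans L x y z * \<tau> y z)"
        using W[OF yp] by (intro regular_intros regular_subset[OF treg[OF x yp]]) (auto intro: regular_subset)
      have eq: "trans L x y z * \<tau> y z = \<sigma> x z" if z: "z \<in> nbhd L x \<inter> W y" for z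
      proof -
        have zp: "z \<in> points A" using z Np x by blast
        have "trans L x y z * \<tau> y z = (trans L x y z * trans L y z z) * \<tau> z z"
          using comp[OF yp, of z] z by simp
        also have "trans L x y z * trans L y z z = trans L x z z"
          using tco[OF x yp zp] z W[OF yp] line_bundle_centre[OF L zp] by blast
        finally show ?thesis unfolding \<sigma>_def .
      qed
      have "regular A (nbhd L x \<inter> W y) (\<sigma> x)"
        by (rule iffD1[OF regular_cong r]) (rule eq)
      then show "\<exists>V. openin (zariski A) V \<and> y \<in> V \<and> regular A (nbhd L x \<inter> V) (\<sigma> x)"
        using W[OF yp] by blast
    qed
  next
    fix x y z assume x: "x \<in> points A" and y: "y \<in> points A" and z: "z \<in> nbhd L x \<inter> nbhd L y"
    have zp: "z \<in> points A" using z Np x by blast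
    then have "trans L x y z * trans L y z z = trans L x z z"
      using tco[OF x y zp] z line_bundle_centre[OF L zp] by blast
    then show "\<sigma> x z = trans L x y z * \<sigma> y z" unfolding \<sigma>_def by (simp flip: mult.assoc)
  qed
  moreover have "\<sigma> q q = \<tau> q q" if "q \<in> points A" for q
    unfolding \<sigma>_def using tid[OF that line_bundle_centre[OF L that]] by simp
  ultimately show ?thesis by blast
qed

text \<open>A section with nonzero value at \<open>x\<close> is a unit in the local ring there, so a
  germ \<open>h\<close> is \<open>h / \<sigma> x\<close> times it and a single generator is
  enough.\<close>

lemma globally_generatedI:
  assumes L: "line_bundle A L"
    and "\<And>x. x \<in> points A \<Longrightarrow> \<exists>\<sigma>. global_section A L \<sigma> \<and> \<sigma> x x \<noteq> 0"
  shows "globally_generated A L"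
  unfolding globally_generated_def
proof (intro ballI allI impI)
  fix x V h assume x: "x \<in> points A"
    and V: "openin (zariski A) V \<and> x \<in> V \<and> V \<subseteq> nbhd L x \<and> regular A V h"
  obtain \<sigma> where \<sigma>: "global_section A L \<sigma>" "\<sigma> x x \<noteq> 0" using assms(2)[OF x] by blast
  have r: "regular A V (\<sigma> x)"
    using \<sigma>(1) x V unfolding global_section_def by (meson regular_subset)
  let ?W = "{z \<in> V. \<sigma> x z \<noteq> 0}"
  have "openin (zariski A) ?W" using V r openin_nonzero by blast
  moreover have "regular A ?W (\<lambda>z. h z / \<sigma> x z)"
    using V by (intro regular_divide regular_subset[OF r]) (auto intro: regular_subset)
  ultimately show "\<exists>(n::nat) s c W. openin (zariski A) W \<and> x \<in> W \<and> W \<subseteq> V \<and>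
           (\<forall>j<n. global_section A L (s j) \<and> regular A W (c j)) \<and>
           (\<forall>z\<in>W. h z = (\<Sum>j<n. c j z * s j x z))"
    using V \<sigma>
    by (intro exI[of _ 1] exI[of _ "\<lambda>_. \<sigma>"] exI[of _ "\<lambda>_ z. h z / \<sigma> x z"] exI[of _ ?W]) auto
qed

section \<open>Coordinates on the Hirzebruch surface\<close>

type_synonym c4 = "complex \<times> complex \<times> complex \<times> complex"

abbreviation cs :: "c4 \<Rightarrow> complex" where "cs v \<equiv> fst v"
abbreviation ct :: "c4 \<Rightarrow> complex" where "ct v \<equiv> fst (snd v)"
abbreviation cx :: "c4 \<Rightarrow> complex" where "cx v \<equiv> fst (snd (snd v))"
abbreviation cy :: "c4 \<Rightarrow> complex" where "cy v \<equiv> snd (snd (snd v))"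

definition torus_act :: "nat \<Rightarrow> complex \<Rightarrow> complex \<Rightarrow> c4 \<Rightarrow> c4" where
  "torus_act e l k v = (l * cs v, l * ct v, k * cx v, k * l ^ e * cy v)"

definition hcl :: "nat \<Rightarrow> c4 \<Rightarrow> hpoint" where
  "hcl e v = hclass e (cs v) (ct v) (cx v) (cy v)"

definition stable :: "c4 \<Rightarrow> bool" where
  "stable v \<longleftrightarrow> (cs v \<noteq> 0 \<or> ct v \<noteq> 0) \<and> (cx v \<noteq> 0 \<or> cy v \<noteq> 0)"

text \<open>An arbitrary representative; it is controlled by \<open>hrep_hcl\<close>, which says
  that it differs from any other one by the torus action.\<close>

definition hrep :: "hpoint \<Rightarrow> c4" where
  "hrep q = (SOME v. v \<in> q)"

lemma hcl_eq: "hcl e v = {torus_act e l k v | l k. l \<noteq> 0 \<and> k \<noteq> 0}"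
  unfolding hcl_def hclass_def torus_act_def by simp

lemma hcl_act: "l \<noteq> 0 \<Longrightarrow> k \<noteq> 0 \<Longrightarrow> hcl e (torus_act e l k v) = hcl e v"
  unfolding hcl_def torus_act_def by (simp add: hclass_scale)

lemma hrep_hcl: "\<exists>l k. l \<noteq> 0 \<and> k \<noteq> 0 \<and> hrep (hcl e v) = torus_act e l k v"
proof -
  have "torus_act e 1 1 v \<in> hcl e v" 
    unfolding hcl_eq by (rule CollectI, rule exI[of _ 1], rule exI[of _ 1]) simp
  then have "hrep (hcl e v) \<in> hcl e v" unfolding hrep_def by (metis someI)
  then show ?thesis unfolding hcl_eq by blast
qed

lemma points_hirzebruch_hcl: "points (hirzebruch e) = {hcl e v | v. stable v}"
  unfolding points_hirzebruch hcl_def stable_def by fastforce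

lemma stable_act: "l \<noteq> 0 \<Longrightarrow> k \<noteq> 0 \<Longrightarrow> stable (torus_act e l k v) \<longleftrightarrow> stable v"
  unfolding stable_def torus_act_def by auto

lemma hirzebruch_hrep:
  assumes "q \<in> points (hirzebruch e)"
  shows "hcl e (hrep q) = q" "stable (hrep q)"
proof -
  obtain v where v: "q = hcl e v" "stable v" using assms unfolding points_hirzebruch_hcl by blast
  obtain l k where "l \<noteq> 0" "k \<noteq> 0" "hrep q = torus_act e l k v" using hrep_hcl v(1) by metis
  then show "hcl e (hrep q) = q" "stable (hrep q)" using v by (simp_all add: hcl_act stable_act)
qed

text \<open>The index \<open>(True, _)\<close> stands for the normalisation \<open>s = 1\<close> and \<open>(False, _)\<close> for \<open>t = 1\<close>;
  likewise \<open>(_, True)\<close> for \<open>x = 1\<close> and \<open>(_, False)\<close> for \<open>y = 1\<close>.\<close>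

definition hlift :: "bool \<times> bool \<Rightarrow> complex \<times> complex \<Rightarrow> c4" where
  "hlift j v = (if fst j then 1 else fst v, if fst j then fst v else 1,
                if snd j then 1 else snd v, if snd j then snd v else 1)"

definition hbase :: "bool \<times> bool \<Rightarrow> c4 \<Rightarrow> complex" where
  "hbase j v = (if fst j then cs v else ct v)"

definition hfibre :: "bool \<times> bool \<Rightarrow> c4 \<Rightarrow> complex" where
  "hfibre j v = (if snd j then cx v else cy v)"

text \<open>The inverse of \<open>hlift\<close>. Both components have weight zero, since
  \<open>y\<close> has the same weight as \<open>x\<close> times the \<open>e\<close>-th power of a
  base coordinate.\<close>

definition haff :: "nat \<Rightarrow> bool \<times> bool \<Rightarrow> c4 \<Rightarrow> complex \<times> complex" where
  "haff e j v = ((if fst j then ct v else cs v) / hbase j v,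
     if snd j then cy v / (cx v * hbase j v ^ e) else cx v * hbase j v ^ e / cy v)"

definition hchart :: "nat \<Rightarrow> bool \<times> bool \<Rightarrow> hpoint \<Rightarrow> complex \<times> complex" where
  "hchart e j q = haff e j (hrep q)"

definition hdom :: "nat \<Rightarrow> bool \<times> bool \<Rightarrow> hpoint set" where
  "hdom e j = {q \<in> points (hirzebruch e). hbase j (hrep q) \<noteq> 0 \<and> hfibre j (hrep q) \<noteq> 0}"

lemma haff_act: "l \<noteq> 0 \<Longrightarrow> k \<noteq> 0 \<Longrightarrow> haff e j (torus_act e l k v) = haff e j v"
  unfolding haff_def hbase_def torus_act_def by (auto simp: power_mult_distrib)

lemma haff_hlift: "haff e j (hlift j v) = v"
  unfolding haff_def hlift_def hbase_def by (cases v) auto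

lemma stable_hlift: "stable (hlift j v)"
  unfolding stable_def hlift_def by auto

lemma hchart_hcl: "hchart e j (hcl e v) = haff e j v"
  unfolding hchart_def using hrep_hcl[of e v] haff_act by metis

lemma hchart_hlift: "hchart e j (hcl e (hlift j v)) = v"
  by (simp add: hchart_hcl haff_hlift)

lemma hlift_inj: "hcl e (hlift j v) = hcl e (hlift j w) \<longleftrightarrow> v = w"
  by (metis hchart_hlift)

lemma hcl_in_points: "stable v \<Longrightarrow> hcl e v \<in> points (hirzebruch e)"
  unfolding points_hirzebruch_hcl by blast

lemma hcl_in_hdom: "stable v \<Longrightarrow> hcl e v \<in> hdom e j \<longleftrightarrow> hbase j v \<noteq> 0 \<and> hfibre j v \<noteq> 0"
proof -
  assume v: "stable v"
  obtain l k where "l \<noteq> 0" "k \<noteq> 0" "hrep (hcl e v) = torus_act e l k v" using hrep_hcl by metis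
  then show ?thesis
    unfolding hdom_def using hcl_in_points[OF v]
    by (auto simp: hbase_def hfibre_def torus_act_def split: if_splits)
qed

lemma hlift_in_hdom: "hcl e (hlift j v) \<in> hdom e j"
  by (simp add: hcl_in_hdom stable_hlift) (simp add: hbase_def hfibre_def hlift_def)

lemma hlift_haff:
  assumes "hbase j v \<noteq> 0" "hfibre j v \<noteq> 0"
  shows "\<exists>l k. l \<noteq> 0 \<and> k \<noteq> 0 \<and> hlift j (haff e j v) = torus_act e l k v"
proof -
  \<comment> \<open>The torus element that brings first the base coordinate and then the fibre
    coordinate to 1.\<close>
  define l where "l = 1 / hbase j v"
  define k where "k = (if snd j then 1 / cx v else hbase j v ^ e / cy v)"
  have "l \<noteq> 0" "k \<noteq> 0" using assms unfolding l_def k_def hfibre_def by (auto split: if_splits)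
  moreover have "hlift j (haff e j v) = torus_act e l k v"
    using assms unfolding l_def k_def hfibre_def hbase_def hlift_def haff_def torus_act_def
    by (auto simp: field_simps split: if_splits)
  ultimately show ?thesis by blast
qed

lemma hlift_hchart:
  assumes "q \<in> hdom e j"
  shows "\<exists>l k. l \<noteq> 0 \<and> k \<noteq> 0 \<and> hlift j (hchart e j q) = torus_act e l k (hrep q)"
    and "hcl e (hlift j (hchart e j q)) = q"
proof -
  show 1: "\<exists>l k. l \<noteq> 0 \<and> k \<noteq> 0 \<and> hlift j (hchart e j q) = torus_act e l k (hrep q)"
    using assms hlift_haff unfolding hchart_def hdom_def by blast
  have "q \<in> points (hirzebruch e)" using assms unfolding hdom_def by blast
  then show "hcl e (hlift j (hchart e j q)) = q" using 1 hcl_act hirzebruch_hrep(1) by metis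
qed

lemma hdom_cover:
  assumes "q \<in> points (hirzebruch e)" shows "\<exists>j. q \<in> hdom e j"
proof -
  have "stable (hrep q)" using hirzebruch_hrep[OF assms] by blast
  then have "hbase (cs (hrep q) \<noteq> 0, k) (hrep q) \<noteq> 0" "hfibre (i, cx (hrep q) \<noteq> 0) (hrep q) \<noteq> 0" for i k
    unfolding stable_def hbase_def hfibre_def by auto
  then show ?thesis unfolding hdom_def using assms by blast
qed

lemma hirzebruch_eq: "hirzebruch e = range (\<lambda>j. (UNIV, \<lambda>v. hcl e (hlift j v)))"
proof -
  have eqs: "(\<lambda>(z, w). hclass e 1 z 1 w) = (\<lambda>v. hcl e (hlift (True, True) v))"
    "(\<lambda>(z, w). hclass e 1 z w 1) = (\<lambda>v. hcl e (hlift (True, False) v))"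
    "(\<lambda>(z, w). hclass e z 1 1 w) = (\<lambda>v. hcl e (hlift (False, True) v))"
    "(\<lambda>(z, w). hclass e z 1 w 1) = (\<lambda>v. hcl e (hlift (False, False) v))"
    by (auto simp: hcl_def hlift_def)
  have U: "(UNIV :: (bool \<times> bool) set) = {(True, True), (True, False), (False, True), (False, False)}"
    by auto
  show ?thesis unfolding hirzebruch_def eqs U image_insert image_empty ..
qed

lemma plane_poly_hlift [plane_poly_intros]:
  "plane_poly (\<lambda>v. cs (hlift j v))" "plane_poly (\<lambda>v. ct (hlift j v))"
  "plane_poly (\<lambda>v. cx (hlift j v))" "plane_poly (\<lambda>v. cy (hlift j v))"
  "plane_poly (\<lambda>v. hbase i (hlift j v))" "plane_poly (\<lambda>v. hfibre i (hlift j v))"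
  unfolding hlift_def hbase_def hfibre_def
  by (cases "fst j"; cases "snd j"; cases "fst i"; cases "snd i"; simp add: plane_poly_intros)+

lemma hirzebruch_chart_vimage_hdom:
  "(\<lambda>v. hcl e (hlift j v)) -` hdom e i = {v. hbase i (hlift j v) * hfibre i (hlift j v) \<noteq> 0}"
  by (auto simp: hcl_in_hdom stable_hlift)

lemma hdom_open: "openin (zariski (hirzebruch e)) (hdom e i)"
proof (rule openin_zariskiI)
  fix D \<rho> assume "(D, \<rho>) \<in> hirzebruch e"
  then obtain j where "D = UNIV" "\<rho> = (\<lambda>v. hcl e (hlift j v))" unfolding hirzebruch_eq by auto
  then show "plane_open (D \<inter> \<rho> -` hdom e i)"
    unfolding \<open>D = _\<close> \<open>\<rho> = _\<close> hirzebruch_chart_vimage_hdom Int_UNIV_left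
    by (intro plane_open_poly plane_poly_intros)
qed (auto simp: hdom_def)

lemma hchart_regular:
  "regular (hirzebruch e) (hdom e i) (\<lambda>q. fst (hchart e i q))"
  "regular (hirzebruch e) (hdom e i) (\<lambda>q. snd (hchart e i q))"
proof -
  have *: "plane_regular {v. hbase i (hlift j v) * hfibre i (hlift j v) \<noteq> 0} (\<lambda>v. fst (haff e i (hlift j v)))"
    "plane_regular {v. hbase i (hlift j v) * hfibre i (hlift j v) \<noteq> 0} (\<lambda>v. snd (haff e i (hlift j v)))" for j
    unfolding haff_def divide_inverse
    by (cases "fst i"; cases "snd i"; simp;
        intro plane_regular_mult plane_regular_inverse plane_regular_poly plane_poly_intros;
        simp add: hfibre_def hbase_def)+
  show "regular (hirzebruch e) (hdom e i) (\<lambda>q. fst (hchart e i q))"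
    by (rule regularI) (use * in \<open>auto simp: hirzebruch_eq hirzebruch_chart_vimage_hdom hchart_hcl\<close>)
  show "regular (hirzebruch e) (hdom e i) (\<lambda>q. snd (hchart e i q))"
    by (rule regularI) (use * in \<open>auto simp: hirzebruch_eq hirzebruch_chart_vimage_hdom hchart_hcl\<close>)
qed

lemma plane_open_avoid:
  assumes "finite S"
  shows "plane_open {v. hcl e (hlift j v) \<notin> S}"
  using assms
proof (induction S rule: finite_induct)
  case empty
  then show ?case by (simp add: plane_open_UNIV)
next
  case (insert p S)
  have "plane_open {v. hcl e (hlift j v) \<noteq> p}"
  proof (cases "\<exists>w. hcl e (hlift j w) = p")
    case True
    then obtain a b where "hcl e (hlift j (a, b)) = p" by auto
    then have "{v. hcl e (hlift j v) \<noteq> p} = \<Union>{{v. fst v - a \<noteq> 0}, {v. snd v - b \<noteq> 0}}"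
      using hlift_inj[of e j _ "(a, b)"] by (auto simp: prod_eq_iff)
    moreover have "plane_open {v. fst v - a \<noteq> 0}" "plane_open {v. snd v - b \<noteq> 0}"
      by (rule plane_open_poly; intro plane_poly_intros)+
    ultimately show ?thesis using plane_open_Union[of "{{v. fst v - a \<noteq> 0}, {v. snd v - b \<noteq> 0}}"] by auto
  next
    case False
    then have "{v. hcl e (hlift j v) \<noteq> p} = UNIV" by auto
    then show ?thesis by (simp add: plane_open_UNIV)
  qed
  from plane_open_Int[OF this insert.IH] show ?case by (simp add: Collect_conj_eq)
qed

lemma openin_avoid:
  assumes "finite S" shows "openin (zariski (hirzebruch e)) (points (hirzebruch e) - S)"
proof (rule openin_zariskiI)
  fix D \<rho> assume "(D, \<rho>) \<in> hirzebruch e"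
  then obtain j where "D = UNIV" "\<rho> = (\<lambda>v. hcl e (hlift j v))" unfolding hirzebruch_eq by auto
  then have "D \<inter> \<rho> -` (points (hirzebruch e) - S) = {v. hcl e (hlift j v) \<notin> S}"
    by (auto simp: hcl_in_points stable_hlift)
  then show "plane_open (D \<inter> \<rho> -` (points (hirzebruch e) - S))"
    using plane_open_avoid[OF assms] by simp
qed blast

lemma pclass_1_inj: "pclass 1 \<beta> = pclass 1 \<beta>' \<longleftrightarrow> \<beta> = \<beta>'"
  and pclass_1_inj': "pclass \<beta> 1 = pclass \<beta>' 1 \<longleftrightarrow> \<beta> = \<beta>'"
  and pclass_1_1: "pclass 1 \<beta> = pclass \<beta>' 1 \<longleftrightarrow> \<beta> * \<beta>' = 1"
proof -
  have self: "(s, t) \<in> pclass s t" for s t unfolding pclass_def by (rule CollectI, rule exI[of _ 1]) simp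
  show "pclass 1 \<beta> = pclass 1 \<beta>' \<longleftrightarrow> \<beta> = \<beta>'"
  proof
    assume "pclass 1 \<beta> = pclass 1 \<beta>'"
    then have "(1, \<beta>) \<in> pclass 1 \<beta>'" using self[of 1 \<beta>] by simp
    then show "\<beta> = \<beta>'" unfolding pclass_def by auto
  qed simp
  show "pclass \<beta> 1 = pclass \<beta>' 1 \<longleftrightarrow> \<beta> = \<beta>'"
  proof
    assume "pclass \<beta> 1 = pclass \<beta>' 1"
    then have "(\<beta>, 1) \<in> pclass \<beta>' 1" using self[of \<beta> 1] by simp
    then show "\<beta> = \<beta>'" unfolding pclass_def by auto
  qed simp
  show "pclass 1 \<beta> = pclass \<beta>' 1 \<longleftrightarrow> \<beta> * \<beta>' = 1"
  proof
    assume "pclass 1 \<beta> = pclass \<beta>' 1"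
    then have "(1, \<beta>) \<in> pclass \<beta>' 1" using self[of 1 \<beta>] by simp
    then show "\<beta> * \<beta>' = 1" unfolding pclass_def by auto
  next
    assume *: "\<beta> * \<beta>' = 1"
    then have nz: "\<beta> \<noteq> 0" "\<beta>' \<noteq> 0" by auto
    show "pclass 1 \<beta> = pclass \<beta>' 1"
    proof
      show "pclass 1 \<beta> \<subseteq> pclass \<beta>' 1"
      proof
        fix u assume "u \<in> pclass 1 \<beta>"
        then obtain l where "u = (l * 1, l * \<beta>)" "l \<noteq> 0" unfolding pclass_def by blast
        then show "u \<in> pclass \<beta>' 1" unfolding pclass_def using * nz
          by (intro CollectI exI[of _ "l * \<beta>"]) (simp add: mult.assoc)
      qed
      show "pclass \<beta>' 1 \<subseteq> pclass 1 \<beta>"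
      proof
        fix u assume "u \<in> pclass \<beta>' 1"
        then obtain l where "u = (l * \<beta>', l * 1)" "l \<noteq> 0" unfolding pclass_def by blast
        then show "u \<in> pclass 1 \<beta>" unfolding pclass_def using * nz
          by (intro CollectI exI[of _ "l * \<beta>'"]) (simp add: mult.assoc mult.commute[of \<beta>])
      qed
    qed
  qed
qed

section \<open>Coordinates on the blow-up\<close>

definition exc_coord :: "bool \<Rightarrow> complex \<times> complex \<Rightarrow> complex" where
  "exc_coord d u = (if d then fst u else snd u)"

definition dir_coord :: "bool \<Rightarrow> complex \<times> complex \<Rightarrow> complex" where
  "dir_coord d u = (if d then snd u else fst u)"

text \<open>Also used as a tangent vector: \<open>bl_pair d 1 \<beta>\<close> spans the line
  \<open>direction d \<beta>\<close>.\<close>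

definition bl_pair :: "bool \<Rightarrow> complex \<Rightarrow> complex \<Rightarrow> complex \<times> complex" where
  "bl_pair d x y = (if d then (x, y) else (y, x))"

definition direction :: "bool \<Rightarrow> complex \<Rightarrow> (complex \<times> complex) set" where
  "direction d \<beta> = (if d then pclass 1 \<beta> else pclass \<beta> 1)"

text \<open>The flag \<open>d\<close> is \<open>True\<close> for the piece \<open>\<alpha> = 1\<close> of the blow-up, where the exceptional curve is
  the zero set of the first coordinate, and \<open>False\<close> for the piece \<open>\<beta> = 1\<close>.\<close>

definition bl_map :: "bool \<Rightarrow> complex \<times> complex \<Rightarrow> complex \<times> complex \<Rightarrow> complex \<times> complex" where
  "bl_map d c u = (fst c + (if d then fst u else snd u * fst u), snd c + (if d then fst u * snd u else snd u))"

lemma direction_inj: "direction d \<beta> = direction d \<beta>' \<longleftrightarrow> \<beta> = \<beta>'"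
  unfolding direction_def by (simp add: pclass_1_inj pclass_1_inj')

lemma direction_swap: "direction (\<not> d) \<beta> = direction d \<beta>' \<longleftrightarrow> \<beta> * \<beta>' = 1"
  unfolding direction_def using pclass_1_1[of \<beta> \<beta>'] pclass_1_1[of \<beta>' \<beta>] by (auto simp: mult.commute)

lemma bl_map_eq_centre: "bl_map d c u = c \<longleftrightarrow> exc_coord d u = 0"
  unfolding bl_map_def exc_coord_def by (cases c) auto

lemma bl_map_onto:
  assumes "z \<noteq> fst c" "w \<noteq> snd c" shows "\<exists>u. bl_map d c u = (z, w)"
proof (cases d)
  case True
  then show ?thesis using assms
    by (intro exI[of _ "(z - fst c, (w - snd c) / (z - fst c))"]) (simp add: bl_map_def)
next
  case False
  then show ?thesis using assms
    by (intro exI[of _ "((z - fst c) / (w - snd c), w - snd c)"]) (simp add: bl_map_def)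
qed

lemma plane_poly_bl_map: "plane_poly (\<lambda>u. fst (bl_map d c u))" "plane_poly (\<lambda>u. snd (bl_map d c u))"
  unfolding bl_map_def by (cases d; simp; intro plane_poly_intros)+

lemma plane_poly_coords: "plane_poly (exc_coord d)" "plane_poly (dir_coord d)"
proof -
  have "exc_coord d = (if d then fst else snd)" "dir_coord d = (if d then snd else fst)"
    unfolding exc_coord_def dir_coord_def by auto
  then show "plane_poly (exc_coord d)" "plane_poly (dir_coord d)" by (auto intro: plane_poly_intros)
qed

locale hirzebruch_blowup =
  fixes e :: nat and S :: "hpoint set"
  assumes fin: "finite S" and S_points: "S \<subseteq> points (hirzebruch e)"
begin

abbreviation X :: "hpoint bpoint atlas" where "X \<equiv> blowup (hirzebruch e) S"

text \<open>\<open>centred_chart\<close> is a Hilbert choice; \<open>cj p\<close> reads off which of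
  the four standard charts was selected, so that the blow-up can be described by
  \<open>hlift\<close> and \<open>bl_map\<close>.\<close>

definition cj :: "hpoint \<Rightarrow> bool \<times> bool" where
  "cj p = (SOME j. fst (centred_chart (hirzebruch e) p) = (UNIV, \<lambda>v. hcl e (hlift j v)))"

definition ctr :: "hpoint \<Rightarrow> complex \<times> complex" where
  "ctr p = hchart e (cj p) p"

definition bl_dom :: "hpoint \<Rightarrow> bool \<Rightarrow> (complex \<times> complex) set" where
  "bl_dom p d = {u. hcl e (hlift (cj p) (bl_map d (ctr p) u)) \<notin> S - {p}}"

definition bl_chart :: "hpoint \<Rightarrow> bool \<Rightarrow> complex \<times> complex \<Rightarrow> hpoint bpoint" where
  "bl_chart p d u = (if exc_coord d u = 0 then Exc p (direction d (dir_coord d u))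
     else Away (hcl e (hlift (cj p) (bl_map d (ctr p) u))))"

lemma centred:
  assumes "p \<in> S"
  shows "centred_chart (hirzebruch e) p = ((UNIV, \<lambda>v. hcl e (hlift (cj p) v)), ctr p)"
    and "hcl e (hlift (cj p) (ctr p)) = p" and "p \<in> hdom e (cj p)"
proof -
  let ?P = "\<lambda>(c, a). c \<in> hirzebruch e \<and> a \<in> fst c \<and> snd c a = p"
  obtain j where "p \<in> hdom e j" using hdom_cover S_points assms by blast
  then have "?P ((UNIV, \<lambda>v. hcl e (hlift j v)), hchart e j p)"
    using hlift_hchart(2) by (auto simp: hirzebruch_eq)
  then have "?P (centred_chart (hirzebruch e) p)"
    unfolding centred_chart_def by (rule someI)
  then obtain c a where ca: "centred_chart (hirzebruch e) p = (c, a)" "c \<in> hirzebruch e" "snd c a = p"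
    by (cases "centred_chart (hirzebruch e) p") auto
  then obtain i where "c = (UNIV, \<lambda>v. hcl e (hlift i v))" unfolding hirzebruch_eq by auto
  then have "fst (centred_chart (hirzebruch e) p) = (UNIV, \<lambda>v. hcl e (hlift i v))" using ca(1) by simp
  then have "fst (centred_chart (hirzebruch e) p) = (UNIV, \<lambda>v. hcl e (hlift (cj p) v))"
    unfolding cj_def
    by (rule someI[where P = "\<lambda>j. fst (centred_chart (hirzebruch e) p) = (UNIV, \<lambda>v. hcl e (hlift j v))"])
  then have c: "c = (UNIV, \<lambda>v. hcl e (hlift (cj p) v))" using ca(1) by simp
  then have p: "hcl e (hlift (cj p) a) = p" using ca(3) by simp
  then have "a = ctr p" unfolding ctr_def using hchart_hlift by metis
  then show "centred_chart (hirzebruch e) p = ((UNIV, \<lambda>v. hcl e (hlift (cj p) v)), ctr p)"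
    and "hcl e (hlift (cj p) (ctr p)) = p" and "p \<in> hdom e (cj p)"
    using ca(1) c p hlift_in_hdom by metis+
qed

lemma blowup_charts_centred:
  assumes "p \<in> S"
  shows "(case centred_chart (hirzebruch e) p of (c, a) \<Rightarrow> blowup_charts S c a) =
    range (\<lambda>d. (bl_dom p d, bl_chart p d))"
proof -
  obtain a b where ab: "ctr p = (a, b)" by (cases "ctr p")
  have p: "hcl e (hlift (cj p) (a, b)) = p" using centred(2)[OF assms] ab by simp
  have D: "bl_dom p True = {(u, \<beta>). (a + u, b + u * \<beta>) \<in> UNIV - (\<lambda>v. hcl e (hlift (cj p) v)) -` (S - {p})}"
    "bl_dom p False = {(\<alpha>, v). (a + v * \<alpha>, b + v) \<in> UNIV - (\<lambda>v. hcl e (hlift (cj p) v)) -` (S - {p})}"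
    unfolding bl_dom_def bl_map_def ab by (simp_all add: set_eq_iff split_beta)
  have C: "bl_chart p True = (\<lambda>(u, \<beta>). if u = 0 then Exc p (pclass 1 \<beta>) else Away (hcl e (hlift (cj p) (a + u, b + u * \<beta>))))"
    "bl_chart p False = (\<lambda>(\<alpha>, v). if v = 0 then Exc p (pclass \<alpha> 1) else Away (hcl e (hlift (cj p) (a + v * \<alpha>, b + v))))"
    unfolding bl_chart_def bl_map_def ab exc_coord_def dir_coord_def direction_def
    by (simp_all add: fun_eq_iff)
  have "range (\<lambda>d. (bl_dom p d, bl_chart p d)) = {(bl_dom p True, bl_chart p True), (bl_dom p False, bl_chart p False)}"
    unfolding UNIV_bool by auto
  then show ?thesis
    unfolding centred(1)[OF assms] ab blowup_charts_def prod.case p D C by simp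
qed

lemma blowup_eq:
  "X = range (\<lambda>j. ({v. hcl e (hlift j v) \<notin> S}, \<lambda>v. Away (hcl e (hlift j v)))) \<union>
     (\<Union>p\<in>S. range (\<lambda>d. (bl_dom p d, bl_chart p d)))"
proof -
  have "{(D - \<rho> -` S, Away \<circ> \<rho>) | D \<rho>. (D, \<rho>) \<in> hirzebruch e} =
      range (\<lambda>j. ({v. hcl e (hlift j v) \<notin> S}, \<lambda>v. Away (hcl e (hlift j v))))"
  proof -
    have "{(D - \<rho> -` S, Away \<circ> \<rho>) | D \<rho>. (D, \<rho>) \<in> hirzebruch e} =
        (\<lambda>(D, \<rho>). (D - \<rho> -` S, Away \<circ> \<rho>)) ` hirzebruch e"
      by force
    also have "\<dots> = range (\<lambda>j. ({v. hcl e (hlift j v) \<notin> S}, \<lambda>v. Away (hcl e (hlift j v))))"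
      unfolding hirzebruch_eq image_image by (simp add: comp_def vimage_def set_diff_eq)
    finally show ?thesis .
  qed
  then show ?thesis unfolding blowup_def using blowup_charts_centred by simp
qed

lemma blowup_chart_cases [consumes 1, case_names Away Exc]:
  assumes "(D, \<rho>) \<in> X"
  obtains j where "D = {v. hcl e (hlift j v) \<notin> S}" "\<rho> = (\<lambda>v. Away (hcl e (hlift j v)))"
  | p d where "p \<in> S" "D = bl_dom p d" "\<rho> = bl_chart p d"
  using assms unfolding blowup_eq by blast

lemma bl_chart_in_blowup: "p \<in> S \<Longrightarrow> (bl_dom p d, bl_chart p d) \<in> X"
  unfolding blowup_eq by blast

lemma blowdown_bl_chart:
  assumes "p \<in> S"
  shows "blowdown (bl_chart p d u) = hcl e (hlift (cj p) (bl_map d (ctr p) u))"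
  unfolding bl_chart_def using bl_map_eq_centre[of d "ctr p" u] centred(2)[OF assms]
  by (cases "exc_coord d u = 0") simp_all

lemma blowdown_bl_chart_eq:
  assumes "p \<in> S"
  shows "blowdown (bl_chart p d u) = p \<longleftrightarrow> exc_coord d u = 0"
proof -
  have "blowdown (bl_chart p d u) = p \<longleftrightarrow> hcl e (hlift (cj p) (bl_map d (ctr p) u)) = hcl e (hlift (cj p) (ctr p))"
    using blowdown_bl_chart[OF assms] centred(2)[OF assms] by simp
  then show ?thesis by (simp add: hlift_inj bl_map_eq_centre)
qed

text \<open>In coordinates the blow-down is the identity outside \<open>S\<close>, and on the two
  pieces at \<open>p\<close> it is \<open>bl_map\<close>, which sends the exceptional curve to the
  centre.\<close>

lemma blowdown_chartwise_polynomial: "chartwise_polynomial X (hirzebruch e) blowdown"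
  unfolding chartwise_polynomial_def
proof (intro allI impI)
  fix D \<rho> assume "(D, \<rho>) \<in> X"
  then show "plane_open D \<and> (\<exists>D' \<rho>' f1 f2. (D', \<rho>') \<in> hirzebruch e \<and> plane_poly f1 \<and> plane_poly f2 \<and>
        (\<forall>v\<in>D. (f1 v, f2 v) \<in> D' \<and> blowdown (\<rho> v) = \<rho>' (f1 v, f2 v)))"
  proof (cases rule: blowup_chart_cases)
    case (Away j)
    have "(UNIV, \<lambda>v. hcl e (hlift j v)) \<in> hirzebruch e" unfolding hirzebruch_eq by blast
    moreover have "\<exists>f1 f2. plane_poly f1 \<and> plane_poly f2 \<and> (\<forall>v\<in>D. (f1 v, f2 v) \<in> UNIV \<and>
        blowdown (\<rho> v) = hcl e (hlift j (f1 v, f2 v)))"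
      unfolding Away by (rule exI[of _ fst], rule exI[of _ snd]) (simp add: plane_poly_fst plane_poly_snd)
    ultimately show ?thesis using plane_open_avoid[OF fin, of e j] unfolding Away(1) by blast
  next
    case (Exc p d)
    have "(UNIV, \<lambda>v. hcl e (hlift (cj p) v)) \<in> hirzebruch e" unfolding hirzebruch_eq by blast
    moreover have "plane_open (bl_dom p d)"
      unfolding bl_dom_def
      using plane_open_vimage[OF plane_open_avoid[of "S - {p}" e "cj p"] plane_poly_bl_map(1)[of d "ctr p"] plane_poly_bl_map(2)[of d "ctr p"]] fin
      by simp
    moreover have "\<exists>f1 f2. plane_poly f1 \<and> plane_poly f2 \<and> (\<forall>v\<in>bl_dom p d. (f1 v, f2 v) \<in> UNIV \<and>
        blowdown (bl_chart p d v) = hcl e (hlift (cj p) (f1 v, f2 v)))"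
      by (rule exI[of _ "\<lambda>u. fst (bl_map d (ctr p) u)"], rule exI[of _ "\<lambda>u. snd (bl_map d (ctr p) u)"])
        (simp add: plane_poly_bl_map blowdown_bl_chart[OF Exc(1)])
    ultimately show ?thesis unfolding Exc(2,3) by blast
  qed
qed

lemma bl_pair_coords [simp]: "exc_coord d (bl_pair d x y) = x" "dir_coord d (bl_pair d x y) = y"
  unfolding exc_coord_def dir_coord_def bl_pair_def by auto

lemma bl_pair_in_dom:
  assumes "p \<in> S" shows "bl_pair d 0 \<beta> \<in> bl_dom p d" "bl_chart p d (bl_pair d 0 \<beta>) = Exc p (direction d \<beta>)"
proof -
  show "bl_chart p d (bl_pair d 0 \<beta>) = Exc p (direction d \<beta>)" unfolding bl_chart_def by simp
  have "bl_map d (ctr p) (bl_pair d 0 \<beta>) = ctr p" unfolding bl_map_eq_centre by simp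
  then show "bl_pair d 0 \<beta> \<in> bl_dom p d" unfolding bl_dom_def using centred(2)[OF assms] by simp
qed

lemma blowup_points:
  assumes "q \<in> points X"
  shows "(\<exists>q0\<in>points (hirzebruch e) - S. q = Away q0) \<or> (\<exists>p\<in>S. \<exists>d \<beta>. q = Exc p (direction d \<beta>))"
proof -
  obtain D \<rho> v where D: "(D, \<rho>) \<in> X" "v \<in> D" "q = \<rho> v" using assms unfolding points_def by auto
  from D(1) show ?thesis
  proof (cases rule: blowup_chart_cases)
    case (Away j)
    then show ?thesis using D(2,3) hcl_in_points[OF stable_hlift] by auto
  next
    case (Exc p d)
    show ?thesis
    proof (cases "exc_coord d v = 0")
      case True
      then show ?thesis using D(3) Exc unfolding bl_chart_def by auto
    next
      case False
      let ?q = "hcl e (hlift (cj p) (bl_map d (ctr p) v))"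
      have "?q \<noteq> p" using False blowdown_bl_chart_eq[OF Exc(1)] blowdown_bl_chart[OF Exc(1)] by metis
      moreover have "?q \<notin> S - {p}" using D(2) Exc(2) unfolding bl_dom_def by blast
      ultimately have "?q \<in> points (hirzebruch e) - S" using hcl_in_points[OF stable_hlift] by auto
      moreover have "q = Away ?q" using D(3) Exc(3) False unfolding bl_chart_def by simp
      ultimately show ?thesis by blast
    qed
  qed
qed

lemma blowdown_in_points: "q \<in> points X \<Longrightarrow> blowdown q \<in> points (hirzebruch e)"
  using blowup_points S_points by force

text \<open>A coordinate centred at \<open>p\<close>, pulled back to the blow-up. On the piece
  \<open>d\<close> the function \<open>ccoord p d\<close> is the equation of the exceptional curve,
  and \<open>ccoord p (\<not> d)\<close> is its product with the direction coordinate.\<close>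

definition ccoord :: "hpoint \<Rightarrow> bool \<Rightarrow> hpoint bpoint \<Rightarrow> complex" where
  "ccoord p d z = exc_coord d (hchart e (cj p) (blowdown z)) - exc_coord d (ctr p)"

lemma ccoord_bl_chart:
  assumes "p \<in> S"
  shows "ccoord p d (bl_chart p d u) = exc_coord d u"
    and "ccoord p (\<not> d) (bl_chart p d u) = exc_coord d u * dir_coord d u"
  unfolding ccoord_def blowdown_bl_chart[OF assms] hchart_hlift
  by (auto simp: exc_coord_def dir_coord_def bl_map_def)

lemma ccoord_centre: "blowdown z = p \<Longrightarrow> ccoord p d z = 0"
  unfolding ccoord_def ctr_def by simp

lemma hchart_blowdown_regular:
  "regular X {z. blowdown z \<in> hdom e j} (\<lambda>z. fst (hchart e j (blowdown z)))"
  "regular X {z. blowdown z \<in> hdom e j} (\<lambda>z. snd (hchart e j (blowdown z)))"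
  using regular_pullback[OF blowdown_chartwise_polynomial hchart_regular(1)]
    regular_pullback[OF blowdown_chartwise_polynomial hchart_regular(2)] .

lemma ccoord_regular: "regular X {z. blowdown z \<in> hdom e (cj p)} (ccoord p d)"
proof -
  have "regular X {z. blowdown z \<in> hdom e (cj p)} (\<lambda>z. exc_coord d (hchart e (cj p) (blowdown z)) - exc_coord d (ctr p))"
    unfolding exc_coord_def
    by (cases d; simp; intro regular_intros hchart_blowdown_regular)
  then show ?thesis unfolding ccoord_def .
qed

lemma blowdown_vimage_hdom_open: "openin (zariski X) {z \<in> points X. blowdown z \<in> hdom e j}"
  using openin_pullback[OF blowdown_chartwise_polynomial hdom_open] .

text \<open>\<open>ratio p d\<close> is the quotient of the two local coordinates at \<open>p\<close>, a regular function away from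
  the strict transform of the curve where the coordinate \<open>ccoord p d\<close> vanishes.\<close>

definition ratio_dom :: "hpoint \<Rightarrow> bool \<Rightarrow> hpoint bpoint set" where
  "ratio_dom p d = {z \<in> points X. blowdown z \<in> hdom e (cj p) \<and>
     (if blowdown z = p then \<exists>\<beta>. z = Exc p (direction d \<beta>) else ccoord p d z \<noteq> 0)}"

definition ratio :: "hpoint \<Rightarrow> bool \<Rightarrow> hpoint bpoint \<Rightarrow> complex" where
  "ratio p d z = (if blowdown z = p then THE \<beta>. z = Exc p (direction d \<beta>)
     else ccoord p (\<not> d) z / ccoord p d z)"

lemma ratio_Exc: "ratio p d (Exc p (direction d \<beta>)) = \<beta>"
  unfolding ratio_def by (simp add: direction_inj)

lemma ratio_mult:
  assumes "z \<in> ratio_dom p d" shows "ccoord p (\<not> d) z = ccoord p d z * ratio p d z"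
  using assms by (cases "blowdown z = p") (auto simp: ccoord_centre ratio_dom_def ratio_def)

lemma bl_chart_ratio_same:
  assumes "p \<in> S" "u \<in> bl_dom p d"
  shows "bl_chart p d u \<in> ratio_dom p d" "ratio p d (bl_chart p d u) = dir_coord d u"
proof -
  have 1: "bl_chart p d u \<in> points X" "blowdown (bl_chart p d u) \<in> hdom e (cj p)"
    using pointsI[OF bl_chart_in_blowup[OF assms(1)] assms(2)] hlift_in_hdom
    by (auto simp: blowdown_bl_chart[OF assms(1)])
  have "bl_chart p d u \<in> ratio_dom p d \<and> ratio p d (bl_chart p d u) = dir_coord d u"
  proof (cases "exc_coord d u = 0")
    case True
    then have "bl_chart p d u = Exc p (direction d (dir_coord d u))" unfolding bl_chart_def by simp
    then show ?thesis using 1 ratio_Exc unfolding ratio_dom_def by auto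
  next
    case False
    then have "blowdown (bl_chart p d u) \<noteq> p" using blowdown_bl_chart_eq[OF assms(1)] by simp
    then show ?thesis using 1 False unfolding ratio_dom_def ratio_def by (simp add: ccoord_bl_chart[OF assms(1)])
  qed
  then show "bl_chart p d u \<in> ratio_dom p d" "ratio p d (bl_chart p d u) = dir_coord d u" by auto
qed

lemma bl_chart_ratio_swap:
  assumes "p \<in> S" "u \<in> bl_dom p (\<not> d)"
  shows "bl_chart p (\<not> d) u \<in> ratio_dom p d \<longleftrightarrow> dir_coord (\<not> d) u \<noteq> 0"
    "dir_coord (\<not> d) u \<noteq> 0 \<Longrightarrow> ratio p d (bl_chart p (\<not> d) u) = inverse (dir_coord (\<not> d) u)"
proof -
  let ?z = "bl_chart p (\<not> d) u" and ?\<beta> = "dir_coord (\<not> d) u"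
  have 1: "?z \<in> points X" "blowdown ?z \<in> hdom e (cj p)"
    using pointsI[OF bl_chart_in_blowup[OF assms(1)] assms(2)] hlift_in_hdom
    by (auto simp: blowdown_bl_chart[OF assms(1)])
  have "(?z \<in> ratio_dom p d \<longleftrightarrow> ?\<beta> \<noteq> 0) \<and> (?\<beta> \<noteq> 0 \<longrightarrow> ratio p d ?z = inverse ?\<beta>)"
  proof (cases "exc_coord (\<not> d) u = 0")
    case True
    then have z: "?z = Exc p (direction (\<not> d) ?\<beta>)" unfolding bl_chart_def by simp
    have "direction (\<not> d) ?\<beta> = direction d (inverse ?\<beta>)" if "?\<beta> \<noteq> 0"
      using that unfolding direction_swap by simp
    moreover have "direction (\<not> d) ?\<beta> = direction d \<beta>' \<Longrightarrow> ?\<beta> \<noteq> 0" for \<beta>'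
      unfolding direction_swap by auto
    ultimately show ?thesis using 1 ratio_Exc unfolding ratio_dom_def z by auto
  next
    case False
    then have "blowdown ?z \<noteq> p" using blowdown_bl_chart_eq[OF assms(1)] by simp
    then show ?thesis
      using 1 False ccoord_bl_chart[OF assms(1), of "\<not> d" u] unfolding ratio_dom_def ratio_def
      by (simp add: field_simps)
  qed
  then show "?z \<in> ratio_dom p d \<longleftrightarrow> ?\<beta> \<noteq> 0" "?\<beta> \<noteq> 0 \<Longrightarrow> ratio p d ?z = inverse ?\<beta>" by auto
qed

text \<open>Checked chart by chart: away from \<open>p\<close> it is a quotient of regular
  functions, on the piece \<open>d\<close> it is the direction coordinate, and on the other piece it
  is the inverse of the direction coordinate there.\<close>

lemma ratio_regular:
  assumes "p \<in> S"
  shows "openin (zariski X) (ratio_dom p d)" "regular X (ratio_dom p d) (ratio p d)"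
proof -
  let ?V = "{z \<in> {z \<in> points X. blowdown z \<in> hdom e (cj p)}. ccoord p d z \<noteq> 0}"
  have Vo: "openin (zariski X) ?V"
    by (rule openin_nonzero[OF blowdown_vimage_hdom_open regular_subset[OF ccoord_regular]]) auto
  have Vr: "regular X ?V (\<lambda>z. ccoord p (\<not> d) z / ccoord p d z)"
    by (intro regular_divide regular_subset[OF ccoord_regular]) auto
  have *: "plane_open (D \<inter> \<rho> -` ratio_dom p d) \<and>
      plane_regular (D \<inter> \<rho> -` ratio_dom p d) (\<lambda>v. ratio p d (\<rho> v))" if D: "(D, \<rho>) \<in> X" for D \<rho>
  proof (cases "\<exists>v\<in>D. blowdown (\<rho> v) = p")
    case False
    then have eq: "D \<inter> \<rho> -` ratio_dom p d = D \<inter> \<rho> -` ?V" unfolding ratio_dom_def by auto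
    have "plane_regular (D \<inter> \<rho> -` ?V) (\<lambda>v. ratio p d (\<rho> v))"
      using regularD[OF Vr D] False
      by (subst plane_regular_cong[where g = "\<lambda>v. ccoord p (\<not> d) (\<rho> v) / ccoord p d (\<rho> v)"]) (auto simp: ratio_def)
    then show ?thesis using openin_zariskiD[OF Vo D] eq by simp
  next
    case True
    then obtain v where v: "v \<in> D" "blowdown (\<rho> v) = p" by blast
    from D obtain d' where d': "D = bl_dom p d'" "\<rho> = bl_chart p d'"
    proof (cases rule: blowup_chart_cases)
      case (Exc p' d')
      \<comment> \<open>The pieces at \<open>p'\<close> omit the points over
        \<open>S - {p'}\<close>, so a piece reaching \<open>p\<close> is a piece at
        \<open>p\<close>.\<close>
      have "p' = p"
        using v assms Exc(2) blowdown_bl_chart[OF Exc(1)] unfolding Exc(3) bl_dom_def by auto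
      then show ?thesis using that Exc by blast
    qed (use v assms in auto)
    have op: "plane_open D"
      using D blowdown_chartwise_polynomial unfolding chartwise_polynomial_def by blast
    show ?thesis
    proof (cases "d' = d")
      case True
      have eq: "D \<inter> \<rho> -` ratio_dom p d = D" using bl_chart_ratio_same(1)[OF assms] d' True by auto
      have "plane_regular D (\<lambda>v. ratio p d (\<rho> v))"
        using plane_regular_poly[OF plane_poly_coords(2), of D d] bl_chart_ratio_same(2)[OF assms] d' True
        by (subst plane_regular_cong[where g = "dir_coord d"]) auto
      then show ?thesis using op eq by simp
    next
      case False
      then have d'': "d' = (\<not> d)" by auto
      have eq: "D \<inter> \<rho> -` ratio_dom p d = D \<inter> {u. dir_coord (\<not> d) u \<noteq> 0}"
        using bl_chart_ratio_swap(1)[OF assms] unfolding d' d'' by auto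
      have "plane_open (D \<inter> {u. dir_coord (\<not> d) u \<noteq> 0})"
        by (intro plane_open_Int op plane_open_poly plane_poly_coords)
      moreover have "plane_regular (D \<inter> {u. dir_coord (\<not> d) u \<noteq> 0}) (\<lambda>u. inverse (dir_coord (\<not> d) u))"
        by (intro plane_regular_inverse plane_regular_poly plane_poly_coords) auto
      then have "plane_regular (D \<inter> {u. dir_coord (\<not> d) u \<noteq> 0}) (\<lambda>v. ratio p d (\<rho> v))"
        using bl_chart_ratio_swap(2)[OF assms]
        by (subst plane_regular_cong[where g = "\<lambda>u. inverse (dir_coord (\<not> d) u)"]) (auto simp: d' d'')
      ultimately show ?thesis using eq by simp
    qed
  qed
  show "openin (zariski X) (ratio_dom p d)"
    by (rule openin_zariskiI) (use * in \<open>auto simp: ratio_dom_def\<close>)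
  show "regular X (ratio_dom p d) (ratio p d)"
    by (rule regularI) (use * in auto)
qed

end

section \<open>Local equations of the divisors\<close>

text \<open>Only the restrictions to the four standard affine slices matter, so being a polynomial in the
  four coordinates is expressed through them.\<close>

definition poly4 :: "(c4 \<Rightarrow> complex) \<Rightarrow> bool" where
  "poly4 G \<longleftrightarrow> (\<forall>j. plane_poly (\<lambda>v. G (hlift j v)))"

text \<open>The weights are those of a section of \<open>\<O>(a C\<^sub>e + b f)\<close>.\<close>

definition bihom :: "nat \<Rightarrow> nat \<Rightarrow> nat \<Rightarrow> (c4 \<Rightarrow> complex) \<Rightarrow> bool" where
  "bihom e a b G \<longleftrightarrow> (\<forall>l k v. l \<noteq> 0 \<longrightarrow> k \<noteq> 0 \<longrightarrow> G (torus_act e l k v) = l ^ b * k ^ a * G v)"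

lemma poly4_intros:
  "poly4 (\<lambda>v. cs v)" "poly4 (\<lambda>v. ct v)" "poly4 (\<lambda>v. cx v)" "poly4 (\<lambda>v. cy v)" "poly4 (\<lambda>v. hbase i v)"
  "poly4 (\<lambda>v. c)"
  "poly4 F \<Longrightarrow> poly4 G \<Longrightarrow> poly4 (\<lambda>v. F v + G v)"
  "poly4 F \<Longrightarrow> poly4 G \<Longrightarrow> poly4 (\<lambda>v. F v - G v)"
  "poly4 F \<Longrightarrow> poly4 G \<Longrightarrow> poly4 (\<lambda>v. F v * G v)"
  "poly4 F \<Longrightarrow> poly4 (\<lambda>v. F v ^ n)"
  "(\<And>i. i \<in> I \<Longrightarrow> poly4 (K i)) \<Longrightarrow> poly4 (\<lambda>v. \<Prod>i\<in>I. K i v)"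
  unfolding poly4_def by (simp_all add: plane_poly_intros)

lemma poly4D: "poly4 G \<Longrightarrow> plane_poly (\<lambda>v. G (hlift j v))"
  unfolding poly4_def by blast

lemma bihomD: "bihom e a b G \<Longrightarrow> l \<noteq> 0 \<Longrightarrow> k \<noteq> 0 \<Longrightarrow> G (torus_act e l k v) = l ^ b * k ^ a * G v"
  unfolding bihom_def by blast

lemma bihom_mult:
  assumes "bihom e a b F" "bihom e a' b' G"
  shows "bihom e (a + a') (b + b') (\<lambda>v. F v * G v)"
  using assms unfolding bihom_def by (simp add: power_add)

lemma bihom_hchart:
  assumes "bihom e a b G" "q \<in> hdom e i"
  obtains l k where "l \<noteq> 0" "k \<noteq> 0" "hlift i (hchart e i q) = torus_act e l k (hrep q)"
    "G (hlift i (hchart e i q)) = l ^ b * k ^ a * G (hrep q)"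
  using hlift_hchart(1)[OF assms(2)] bihomD[OF assms(1)] by metis

lemma bihom_hchart_eq_0:
  assumes "bihom e a b G" "q \<in> hdom e i"
  shows "G (hlift i (hchart e i q)) = 0 \<longleftrightarrow> G (hrep q) = 0"
  using bihom_hchart[OF assms] by (metis mult_eq_0_iff power_not_zero)

lemma bihom_hrep_hcl:
  assumes "bihom e a b G"
  shows "G (hrep (hcl e v)) = 0 \<longleftrightarrow> G v = 0"
proof -
  obtain l k where "l \<noteq> 0" "k \<noteq> 0" "hrep (hcl e v) = torus_act e l k v" using hrep_hcl by metis
  then show ?thesis using bihomD[OF assms, of l k v] by simp
qed

lemma bihom_cx: "bihom e 1 0 (\<lambda>v. cx v)"
  unfolding bihom_def torus_act_def by simp

definition base_form :: "complex \<Rightarrow> complex \<Rightarrow> c4 \<Rightarrow> complex" where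
  "base_form s t v = t * cs v - s * ct v"

lemma bihom_base_form: "bihom e 0 1 (base_form s t)"
  unfolding bihom_def torus_act_def base_form_def by (simp add: algebra_simps)

lemma poly4_base_form: "poly4 (base_form s t)"
proof -
  have "poly4 (\<lambda>v. t * cs v - s * ct v)" by (intro poly4_intros)
  then show ?thesis unfolding base_form_def[abs_def] .
qed

lemma base_form_eq_0:
  assumes "(s, t) \<noteq> (0, 0)" "cs v \<noteq> 0 \<or> ct v \<noteq> 0" "base_form s t v = 0"
  obtains l where "l \<noteq> 0" "cs v = l * s" "ct v = l * t"
proof -
  have eq: "t * cs v = s * ct v" using assms(3) unfolding base_form_def by simp
  show ?thesis
  proof (cases "s = 0")
    case False
    then have "cs v = cs v / s * s" "ct v = cs v / s * t" using eq by (auto simp: field_simps)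
    moreover have "cs v \<noteq> 0" using assms(2) eq False by auto
    ultimately show ?thesis using that[of "cs v / s"] False by simp
  next
    case True
    then have "t \<noteq> 0" "cs v = 0" using assms(1) eq by auto
    then show ?thesis using that[of "ct v / t"] True assms(2) by simp
  qed
qed

lemma base_form_prop: "base_form s t v = 0" if "cs v = l * s" "ct v = l * t"
  using that unfolding base_form_def by simp

lemma pclass_eq_iff:
  assumes "(s, t) \<noteq> (0, 0)" "cs v \<noteq> 0 \<or> ct v \<noteq> 0"
  shows "pclass (cs v) (ct v) = pclass s t \<longleftrightarrow> base_form s t v = 0"
proof
  assume eq: "pclass (cs v) (ct v) = pclass s t"
  have "(cs v, ct v) \<in> pclass (cs v) (ct v)" unfolding pclass_def by (rule CollectI, rule exI[of _ 1]) simp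
  then have "(cs v, ct v) \<in> pclass s t" using eq by simp
  then have "\<exists>l. (cs v, ct v) = (l * s, l * t)" unfolding pclass_def by blast
  then obtain l where "cs v = l * s" "ct v = l * t" by blast
  then show "base_form s t v = 0" by (rule base_form_prop)
next
  assume "base_form s t v = 0"
  then obtain l where l: "l \<noteq> 0" "cs v = l * s" "ct v = l * t" using base_form_eq_0 assms by metis
  show "pclass (cs v) (ct v) = pclass s t"
  proof
    show "pclass (cs v) (ct v) \<subseteq> pclass s t"
    proof
      fix u assume "u \<in> pclass (cs v) (ct v)"
      then obtain k where "u = (k * cs v, k * ct v)" "k \<noteq> 0" unfolding pclass_def by blast
      then show "u \<in> pclass s t"
        unfolding pclass_def using l by (intro CollectI exI[of _ "k * l"]) (simp add: mult.assoc)
    qed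
    show "pclass s t \<subseteq> pclass (cs v) (ct v)"
    proof
      fix u assume "u \<in> pclass s t"
      then obtain k where "u = (k * s, k * t)" "k \<noteq> 0" unfolding pclass_def by blast
      then show "u \<in> pclass (cs v) (ct v)"
        unfolding pclass_def using l by (intro CollectI exI[of _ "k / l"]) simp
    qed
  qed
qed

lemma hproj_hrep: "q \<in> points (hirzebruch e) \<Longrightarrow> hproj q = pclass (cs (hrep q)) (ct (hrep q))"
  using hirzebruch_hrep(1)[of q e] hproj_hclass unfolding hcl_def by metis

lemma neg_section_iff:
  assumes "q \<in> points (hirzebruch e)"
  shows "q \<in> neg_section e \<longleftrightarrow> cx (hrep q) = 0"
proof
  assume "q \<in> neg_section e"
  then obtain s t y where "q = hcl e (s, t, 0, y)" unfolding neg_section_def hcl_def by auto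
  then show "cx (hrep q) = 0" using bihom_hrep_hcl[OF bihom_cx, of _ "(s, t, 0, y)"] by simp
next
  assume 0: "cx (hrep q) = 0"
  have st: "stable (hrep q)" "hcl e (hrep q) = q" using hirzebruch_hrep[OF assms] by auto
  then have "q = hclass e (cs (hrep q)) (ct (hrep q)) 0 (cy (hrep q))" unfolding hcl_def 0 by simp
  then show "q \<in> neg_section e" using st(1) 0 unfolding neg_section_def stable_def by blast
qed

text \<open>Dehomogenisation in the chart \<open>j\<close>: for a bihomogeneous \<open>G\<close>
  this is the coordinate of the corresponding section in the trivialisation given by the normalised
  representative.\<close>

definition local_value :: "nat \<Rightarrow> (c4 \<Rightarrow> complex) \<Rightarrow> bool \<times> bool \<Rightarrow> hpoint \<Rightarrow> complex" where
  "local_value e G j q = G (hlift j (hchart e j q))"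

lemma local_value_regular: "poly4 G \<Longrightarrow> regular (hirzebruch e) (hdom e j) (local_value e G j)"
  using regular_plane_poly[OF poly4D hchart_regular] unfolding local_value_def[abs_def] by simp

lemma local_value_hlift: "local_value e G j (hcl e (hlift j v)) = G (hlift j v)"
  unfolding local_value_def hchart_hlift ..

lemma hirzebruch_chart_at:
  assumes "q \<in> hdom e j"
  obtains a b where "(UNIV, \<lambda>v. hcl e (hlift j v)) \<in> hirzebruch e" "hchart e j q = (a, b)" "hcl e (hlift j (a, b)) = q"
  using hlift_hchart(2)[OF assms] that[of "fst (hchart e j q)" "snd (hchart e j q)"] by (simp add: hirzebruch_eq)

lemma neg_section_local_equation:
  assumes L: "line_bundle (hirzebruch e) L" "curve_section (hirzebruch e) (neg_section e) L s"
    and q: "q \<in> hdom e j"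
  shows "\<exists>W \<kappa>. openin (zariski (hirzebruch e)) W \<and> q \<in> W \<and> W \<subseteq> hdom e j \<inter> nbhd L q \<and> regular (hirzebruch e) W \<kappa> \<and>
    (\<forall>z\<in>W. \<kappa> z \<noteq> 0 \<and> s q z = \<kappa> z * local_value e cx j z)"
proof (rule curve_section_local_equation[OF L _ hdom_open q])
  have qp: "q \<in> points (hirzebruch e)" using q unfolding hdom_def by blast
  have cx0: "local_value e cx j z = 0 \<longleftrightarrow> cx (hrep z) = 0" if "z \<in> hdom e j" for z
    unfolding local_value_def using bihom_hchart_eq_0[OF bihom_cx that] .
  show "q \<in> points (hirzebruch e)" by fact
  show "regular (hirzebruch e) (hdom e j) (local_value e cx j)"
    by (intro local_value_regular poly4_intros)
  show "local_value e cx j z = 0" if "z \<in> hdom e j \<inter> neg_section e" for z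
    using that cx0 neg_section_iff[of z e] unfolding hdom_def by blast
  obtain a b where ab: "(UNIV, \<lambda>v. hcl e (hlift j v)) \<in> hirzebruch e" "hchart e j q = (a, b)" "hcl e (hlift j (a, b)) = q"
    using hirzebruch_chart_at[OF q] .
  show "local_value e cx j q \<noteq> 0 \<or> q \<in> neg_section e \<and> simple_zero (hirzebruch e) (hdom e j) (local_value e cx j) q"
  proof (cases "local_value e cx j q = 0")
    case True
    then have Z: "q \<in> neg_section e" using cx0[OF q] neg_section_iff[OF qp] by blast
    \<comment> \<open>On charts with \<open>snd j\<close> the coordinate \<open>x\<close> is 1. On
      the others it is the second affine coordinate, so on the vertical line through
      \<open>q\<close> it equals the parameter.\<close>
    have "\<not> snd j" "b = 0" using True unfolding local_value_def ab by (auto simp: hlift_def split: if_splits)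
    then have l: "local_value e cx j (hcl e (hlift j (a + t * 0, b + t * 1))) = 1 * t" for t
      unfolding local_value_hlift by (simp add: hlift_def)
    have "simple_zero (hirzebruch e) (hdom e j) (local_value e cx j) q"
      by (rule simple_zeroI[OF ab(1) _ ab(3), where l = 1 and c = 0 and d = 1]) (use l in auto)
    then show ?thesis using Z by blast
  qed simp
qed

lemma fiber_local_equation:
  assumes L: "line_bundle (hirzebruch e) L" "curve_section (hirzebruch e) (hfiber e (pclass c1 c2)) L s"
    and c: "(c1, c2) \<noteq> (0, 0)"
    and q: "q \<in> hdom e j"
  shows "\<exists>W \<kappa>. openin (zariski (hirzebruch e)) W \<and> q \<in> W \<and> W \<subseteq> hdom e j \<inter> nbhd L q \<and> regular (hirzebruch e) W \<kappa> \<and>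
    (\<forall>z\<in>W. \<kappa> z \<noteq> 0 \<and> s q z = \<kappa> z * local_value e (base_form c1 c2) j z)"
proof (rule curve_section_local_equation[OF L _ hdom_open q])
  let ?f = "base_form c1 c2"
  have qp: "q \<in> points (hirzebruch e)" using q unfolding hdom_def by blast
  have f0: "local_value e ?f j z = 0 \<longleftrightarrow> z \<in> hfiber e (pclass c1 c2)" if "z \<in> hdom e j" for z
  proof -
    have z: "z \<in> points (hirzebruch e)" using that unfolding hdom_def by blast
    then have "cs (hrep z) \<noteq> 0 \<or> ct (hrep z) \<noteq> 0" using hirzebruch_hrep(2) unfolding stable_def by blast
    then show ?thesis
      unfolding local_value_def bihom_hchart_eq_0[OF bihom_base_form that] hfiber_def
      using pclass_eq_iff[OF c] hproj_hrep[OF z] z by simp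
  qed
  show "q \<in> points (hirzebruch e)" by fact
  show "regular (hirzebruch e) (hdom e j) (local_value e ?f j)"
    by (intro local_value_regular poly4_base_form)
  show "local_value e ?f j z = 0" if "z \<in> hdom e j \<inter> hfiber e (pclass c1 c2)" for z
    using that f0 by blast
  obtain a b where ab: "(UNIV, \<lambda>v. hcl e (hlift j v)) \<in> hirzebruch e" "hchart e j q = (a, b)" "hcl e (hlift j (a, b)) = q"
    using hirzebruch_chart_at[OF q] .
  show "local_value e ?f j q \<noteq> 0 \<or> q \<in> hfiber e (pclass c1 c2) \<and> simple_zero (hirzebruch e) (hdom e j) (local_value e ?f j) q"
  proof (cases "local_value e ?f j q = 0")
    case True
    then have Z: "q \<in> hfiber e (pclass c1 c2)" using f0[OF q] by blast
    \<comment> \<open>The form is affine in the first coordinate with this coefficient. Were it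
      zero, vanishing at \<open>q\<close> would make both \<open>c1\<close> and \<open>c2\<close>
      zero.\<close>
    let ?l = "if fst j then - c1 else c2"
    have l: "?l \<noteq> 0 \<and> (\<forall>t. local_value e ?f j (hcl e (hlift j (a + t * 1, b + t * 0))) = ?l * t)"
      using True c unfolding local_value_hlift unfolding local_value_def ab base_form_def
      by (cases "fst j") (auto simp: hlift_def algebra_simps)
    have "simple_zero (hirzebruch e) (hdom e j) (local_value e ?f j) q"
      by (rule simple_zeroI[OF ab(1) _ ab(3), where l = ?l and c = 1 and d = 0]) (use l in auto)
    then show ?thesis using Z by blast
  qed simp
qed

context hirzebruch_blowup
begin

text \<open>Write \<open>g\<close> as \<open>(z - a) * g1 + (w - b) * g2\<close>. Pulled back, one
  difference is \<open>ccoord p d\<close> and the other is that times \<open>ratio p d\<close>, so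
  one exceptional factor comes out. On the exceptional curve the quotient \<open>\<gamma>\<close> is
  the derivative of \<open>g\<close> in the direction of the point; the last conclusion computes it
  when \<open>g\<close> is linear along the line in that direction.\<close>

lemma exc_factor:
  assumes p: "p \<in> S" and q: "q \<in> ratio_dom p d" "blowdown q = p" and g: "plane_poly g" "g (ctr p) = 0"
    and dir: "bl_pair d 1 (ratio p d q) = (c, c')"
  obtains \<gamma> where "regular X (ratio_dom p d) \<gamma>"
    "\<And>z. z \<in> ratio_dom p d \<Longrightarrow> g (hchart e (cj p) (blowdown z)) = ccoord p d z * \<gamma> z"
    "\<And>l. (\<And>t. g (fst (ctr p) + t * c, snd (ctr p) + t * c') = l * t) \<Longrightarrow> \<gamma> q = l"
proof -
  obtain a b where ab: "ctr p = (a, b)" by (cases "ctr p")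
  obtain g1 g2 where g12: "plane_poly g1" "plane_poly g2"
      "\<And>z w. g (z, w) = (z - a) * g1 (z, w) + (w - b) * g2 (z, w)"
    using plane_poly_vanishing_decomp[OF g(1), of a b] g(2) ab by auto
  let ?h = "\<lambda>z. hchart e (cj p) (blowdown z)"
  define G1 where "G1 = (if d then g1 else g2)"
  define G2 where "G2 = (if d then g2 else g1)"
  have G: "plane_poly G1" "plane_poly G2" unfolding G1_def G2_def using g12 by auto
  define \<gamma> where "\<gamma> z = G1 (?h z) + G2 (?h z) * ratio p d z" for z
  have sub: "ratio_dom p d \<subseteq> {z. blowdown z \<in> hdom e (cj p)}" unfolding ratio_dom_def by auto
  have hr: "regular X (ratio_dom p d) (\<lambda>z. f (?h z))" if "plane_poly f" for f
    using regular_plane_poly[OF that regular_subset[OF hchart_blowdown_regular(1) sub] regular_subset[OF hchart_blowdown_regular(2) sub]]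
    by simp
  show ?thesis
  proof (rule that[of \<gamma>])
    show "regular X (ratio_dom p d) \<gamma>"
      unfolding \<gamma>_def using hr[OF G(1)] hr[OF G(2)] ratio_regular(2)[OF p]
      by (intro regular_intros)
    show "g (?h z) = ccoord p d z * \<gamma> z" if z: "z \<in> ratio_dom p d" for z
    proof -
      have "g (?h z) = ccoord p d z * G1 (?h z) + ccoord p (\<not> d) z * G2 (?h z)"
        using g12(3)[of "fst (?h z)" "snd (?h z)"] unfolding G1_def G2_def ccoord_def ab exc_coord_def by auto
      then show ?thesis unfolding \<gamma>_def ratio_mult[OF z] by (simp add: algebra_simps)
    qed
    fix l assume l: "\<And>t. g (fst (ctr p) + t * c, snd (ctr p) + t * c') = l * t"
    have pp: "plane_poly (\<lambda>v. c * g1 v + c' * g2 v)" by (intro plane_poly_intros g12(1,2))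
    obtain P where P: "\<And>t. c * g1 (a + t * c, b + t * c') + c' * g2 (a + t * c, b + t * c') = poly P t"
      using plane_poly_line[OF pp, of a c b c'] by blast
    \<comment> \<open>Along the line both sides are \<open>t\<close> times a polynomial; cancelling
      \<open>t\<close> as a polynomial gives the value at \<open>t = 0\<close> as well.\<close>
    have "poly ([:0, 1:] * (P - [:l:])) t = 0" for t
      using l[of t] unfolding ab fst_conv snd_conv g12(3) by (simp add: P[symmetric] algebra_simps)
    then have "[:0, 1:] * (P - [:l:]) = 0" by (simp only: poly_all_0_iff_0[symmetric]) blast
    then have "P = [:l:]" by auto
    then have "c * g1 (a, b) + c' * g2 (a, b) = l" using P[of 0] by simp
    moreover have "?h q = (a, b)" using q(2) ab unfolding ctr_def by simp
    ultimately show "\<gamma> q = l"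
      unfolding \<gamma>_def G1_def G2_def using dir unfolding bl_pair_def by (cases d) (auto simp: algebra_simps)
  qed
qed

lemma ratio_dom_Exc: "q \<in> points X \<Longrightarrow> blowdown q = p \<Longrightarrow> p \<in> S \<Longrightarrow> \<exists>d. q \<in> ratio_dom p d"
  using blowup_points[of q] centred(3)[of p] unfolding ratio_dom_def by auto blast

lemma exceptional_local_equation:
  assumes L: "line_bundle X L" "curve_section X (exceptional (hirzebruch e) S p) L s"
    and p: "p \<in> S" and q: "q \<in> ratio_dom p d" "blowdown q = p"
  shows "\<exists>W \<kappa>. openin (zariski X) W \<and> q \<in> W \<and> W \<subseteq> ratio_dom p d \<inter> nbhd L q \<and> regular X W \<kappa> \<and>
    (\<forall>z\<in>W. \<kappa> z \<noteq> 0 \<and> s q z = \<kappa> z * ccoord p d z)"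
proof (rule curve_section_local_equation[OF L _ ratio_regular(1)[OF p] q(1)])
  show qX: "q \<in> points X" using q unfolding ratio_dom_def by blast
  show "regular X (ratio_dom p d) (ccoord p d)"
    by (rule regular_subset[OF ccoord_regular]) (auto simp: ratio_dom_def)
  show "ccoord p d z = 0" if "z \<in> ratio_dom p d \<inter> exceptional (hirzebruch e) S p" for z
    using that ccoord_centre unfolding exceptional_def by blast
  obtain \<beta> where \<beta>: "q = Exc p (direction d \<beta>)" using q unfolding ratio_dom_def by auto
  have Z: "q \<in> exceptional (hirzebruch e) S p" using qX q(2) unfolding exceptional_def by blast
  obtain a b where ab: "bl_pair d 0 \<beta> = (a, b)" by (cases "bl_pair d 0 \<beta>")
  obtain c c' where c: "bl_pair d (1::complex) 0 = (c, c')" by (cases "bl_pair d (1::complex) 0")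
  \<comment> \<open>Fixing the direction and moving the exceptional coordinate gives a line
    transversal to the exceptional curve.\<close>
  have "(a + t * c, b + t * c') = bl_pair d t \<beta>" for t
    using ab c unfolding bl_pair_def by (cases d) auto
  then have line: "\<forall>t. ccoord p d (bl_chart p d (a + t * c, b + t * c')) = 1 * t"
    using ccoord_bl_chart(1)[OF p] by simp
  have "simple_zero X (ratio_dom p d) (ccoord p d) q"
    by (rule simple_zeroI[OF bl_chart_in_blowup[OF p], where a = a and b = b and c = c and d = c' and l = 1])
      (use line bl_pair_in_dom[OF p, of d \<beta>] ab \<beta> in auto)
  then show "ccoord p d q \<noteq> 0 \<or> q \<in> exceptional (hirzebruch e) S p \<and> simple_zero X (ratio_dom p d) (ccoord p d) q"
    using Z by blast
qed

lemma avoid_open: "openin (zariski X) {z \<in> points X. blowdown z \<noteq> p}"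
proof -
  have "{z \<in> points X. blowdown z \<noteq> p} = {z \<in> points X. blowdown z \<in> points (hirzebruch e) - {p}}"
    using blowdown_in_points by auto
  then show ?thesis using openin_pullback[OF blowdown_chartwise_polynomial openin_avoid[of "{p}"]] by simp
qed

lemma exceptional_local_unit:
  assumes L: "line_bundle X L" "curve_section X (exceptional (hirzebruch e) S p) L s"
    and q: "q \<in> points X" "blowdown q \<noteq> p"
  shows "\<exists>W \<kappa>. openin (zariski X) W \<and> q \<in> W \<and> W \<subseteq> {z \<in> points X. blowdown z \<noteq> p} \<inter> nbhd L q \<and> regular X W \<kappa> \<and>
    (\<forall>z\<in>W. \<kappa> z \<noteq> 0 \<and> s q z = \<kappa> z * 1)"
  by (rule curve_section_local_equation[OF L q(1) avoid_open])
    (use q in \<open>auto simp: exceptional_def intro: regular_intros\<close>)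

lemma sparse_zero_set:
  assumes F: "poly4 F" "bihom e a b F" and nz: "\<And>j. \<exists>v. F (hlift j v) \<noteq> 0"
  shows "sparse X {z. F (hrep (blowdown z)) = 0}"
  unfolding sparse_def
proof (intro allI impI)
  fix D \<rho> assume "(D, \<rho>) \<in> X"
  then show "\<exists>d w. plane_poly d \<and> d w \<noteq> 0 \<and> (\<forall>v\<in>D. d v \<noteq> 0 \<longrightarrow> \<rho> v \<notin> {z. F (hrep (blowdown z)) = 0})"
  proof (cases rule: blowup_chart_cases)
    case (Away j)
    then show ?thesis using nz[of j] poly4D[OF F(1), of j] bihom_hrep_hcl[OF F(2)]
      by (intro exI[of _ "\<lambda>v. F (hlift j v)"]) auto
  next
    case (Exc p d)
    let ?f = "\<lambda>v. F (hlift (cj p) v)" and ?m = "bl_map d (ctr p)"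
    obtain v where "?f v \<noteq> 0" using nz by blast
    \<comment> \<open>The nonvanishing point has to be in the image of \<open>bl_map\<close>;
      keeping off both axes through the centre ensures this for either piece.\<close>
    moreover have "plane_poly (\<lambda>v. (fst v - fst (ctr p)) * (snd v - snd (ctr p)))" by (intro plane_poly_intros)
    moreover have "(fst (w::complex \<times> complex) - fst (ctr p)) * (snd w - snd (ctr p)) \<noteq> 0" if "w = (fst (ctr p) + 1, snd (ctr p) + 1)" for w
      using that by simp
    ultimately obtain w where w: "?f w \<noteq> 0" "(fst w - fst (ctr p)) * (snd w - snd (ctr p)) \<noteq> 0"
      using plane_poly_common_nonzero[OF poly4D[OF F(1), of "cj p"]] by blast
    then obtain u where u: "?m u = w" using bl_map_onto[of "fst w" "ctr p" "snd w" d] by auto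
    have "plane_poly (\<lambda>u. ?f (?m u))"
      using plane_poly_compose[OF poly4D[OF F(1), of "cj p"] plane_poly_bl_map[of d "ctr p"]] by simp
    then show ?thesis using w(1) u bihom_hrep_hcl[OF F(2)]
      unfolding Exc(3) by (intro exI[of _ "\<lambda>u. ?f (?m u)"] exI[of _ u]) (auto simp: blowdown_bl_chart[OF Exc(1)])
  qed
qed

end

section \<open>Bihomogeneous forms with prescribed multiplicities\<close>

context hirzebruch_blowup
begin

text \<open>On the neighbourhood \<open>enbhd q\<close>, which lies over the chart \<open>eind q\<close>, the function \<open>eloc q\<close> is an
  equation of the exceptional curves. At points of an exceptional curve \<open>edir q\<close> holds unless \<open>q\<close> is
  the vertical direction \<open>[0 : 1]\<close>.\<close>

definition edir :: "hpoint bpoint \<Rightarrow> bool" where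
  "edir q \<longleftrightarrow> (\<exists>\<beta>. q = Exc (blowdown q) (direction True \<beta>))"

definition eloc :: "hpoint bpoint \<Rightarrow> hpoint bpoint \<Rightarrow> complex" where
  "eloc q z = (if blowdown q \<in> S then ccoord (blowdown q) (edir q) z else 1)"

definition eind :: "hpoint bpoint \<Rightarrow> bool \<times> bool" where
  "eind q = (if blowdown q \<in> S then cj (blowdown q) else SOME j. blowdown q \<in> hdom e j)"

definition enbhd :: "hpoint bpoint \<Rightarrow> hpoint bpoint set" where
  "enbhd q = (if blowdown q \<in> S then ratio_dom (blowdown q) (edir q)
     else {z \<in> points X. blowdown z \<in> hdom e (eind q)})"

lemma in_ratio_dom_edir:
  assumes "q \<in> points X" "blowdown q \<in> S"
  shows "q \<in> ratio_dom (blowdown q) (edir q)"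
proof -
  obtain d where d: "q \<in> ratio_dom (blowdown q) d" using ratio_dom_Exc assms by blast
  then obtain \<beta> where \<beta>: "q = Exc (blowdown q) (direction d \<beta>)" unfolding ratio_dom_def by auto
  show ?thesis
  proof (cases "edir q")
    case True
    then show ?thesis using d unfolding ratio_dom_def edir_def by auto
  next
    case False
    have "\<not> d"
    proof
      assume d
      then have "direction d \<beta> = direction True \<beta>" by simp
      then show False using \<beta> False unfolding edir_def by metis
    qed
    then show ?thesis using d False by simp
  qed
qed

text \<open>The piece \<open>True\<close> contains every direction except \<open>[0 : 1]\<close>,
  which is the origin of the direction coordinate on the other piece.\<close>

lemma ratio_not_edir:
  assumes "q \<in> points X" "blowdown q \<in> S" "\<not> edir q"
  shows "ratio (blowdown q) False q = 0"
proof -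
  obtain \<beta> where \<beta>: "q = Exc (blowdown q) (direction False \<beta>)"
    using in_ratio_dom_edir[OF assms(1,2)] assms(3) unfolding ratio_dom_def by auto
  have "\<beta> = 0"
  proof (rule ccontr)
    assume "\<beta> \<noteq> 0"
    then have "direction False \<beta> = direction True (inverse \<beta>)"
      using direction_swap[of True \<beta> "inverse \<beta>"] by simp
    then show False using \<beta> assms(3) unfolding edir_def by metis
  qed
  then show ?thesis using \<beta> ratio_Exc by metis
qed

lemma blowdown_in_hdom_eind:
  assumes "q \<in> points X" shows "blowdown q \<in> hdom e (eind q)"
  using hdom_cover[OF blowdown_in_points[OF assms]] centred(3) unfolding eind_def by (auto intro: someI)

lemma enbhd:
  assumes "q \<in> points X"
  shows "openin (zariski X) (enbhd q)" "q \<in> enbhd q" "enbhd q \<subseteq> points X"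
    "z \<in> enbhd q \<Longrightarrow> blowdown z \<in> hdom e (eind q)" "regular X (enbhd q) (eloc q)"
proof -
  show "openin (zariski X) (enbhd q)"
    unfolding enbhd_def using ratio_regular(1) blowdown_vimage_hdom_open by simp
  then show "enbhd q \<subseteq> points X" by (rule openin_zariski_subset)
  show "q \<in> enbhd q"
    unfolding enbhd_def using in_ratio_dom_edir[OF assms] blowdown_in_hdom_eind[OF assms] assms by simp
  show *: "z \<in> enbhd q \<Longrightarrow> blowdown z \<in> hdom e (eind q)" for z
    unfolding enbhd_def eind_def ratio_dom_def by (simp split: if_splits)
  show "regular X (enbhd q) (eloc q)"
  proof (cases "blowdown q \<in> S")
    case True
    then have "eloc q = ccoord (blowdown q) (edir q)" "eind q = cj (blowdown q)"
      unfolding eloc_def eind_def by auto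
    then show ?thesis using * by (auto intro: regular_subset[OF ccoord_regular])
  next
    case False
    then have "eloc q = (\<lambda>_. 1)" unfolding eloc_def by auto
    then show ?thesis by (simp add: regular_const)
  qed
qed

text \<open>Forms of multiplicity at least \<open>M p\<close> at \<open>p\<close> whose associated section of
  \<open>\<O>(a H\<^sub>e + b F\<^sub>e - \<Sum> M p E\<^sub>p)\<close> does not vanish at the point \<open>x\<close> of the blow-up.\<close>

definition sec :: "nat \<Rightarrow> nat \<Rightarrow> (hpoint \<Rightarrow> nat) \<Rightarrow> hpoint bpoint \<Rightarrow> (c4 \<Rightarrow> complex) \<Rightarrow> bool" where
  "sec a b M x G \<longleftrightarrow> poly4 G \<and> bihom e a b G \<and> (\<forall>q\<in>points X. \<exists>\<gamma>. regular X (enbhd q) \<gamma> \<and>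
     (\<forall>z\<in>enbhd q. local_value e G (eind q) (blowdown z) = eloc q z ^ M (blowdown q) * \<gamma> z) \<and>
     (q = x \<longrightarrow> \<gamma> x \<noteq> 0))"

text \<open>Only multiplicities on \<open>S\<close> matter, since \<open>eloc q\<close> is
  constantly 1 when \<open>q\<close> does not lie over \<open>S\<close>.\<close>

lemma sec_cong:
  assumes "sec a b M x G" "\<And>p. p \<in> S \<Longrightarrow> M p = M' p" shows "sec a b M' x G"
proof -
  have "eloc q z ^ M (blowdown q) = eloc q z ^ M' (blowdown q)" for q z
    using assms(2) unfolding eloc_def by simp
  then show ?thesis using assms(1) unfolding sec_def by simp
qed

lemma sec_mult:
  assumes F: "sec a b M x F" and G: "sec a' b' M' x G"
  shows "sec (a + a') (b + b') (\<lambda>p. M p + M' p) x (\<lambda>v. F v * G v)"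
  unfolding sec_def
proof (intro conjI ballI)
  have "poly4 F" "poly4 G" using F G unfolding sec_def by blast+
  then show "poly4 (\<lambda>v. F v * G v)" by (rule poly4_intros)
  have "bihom e a b F" "bihom e a' b' G" using F G unfolding sec_def by blast+
  then show "bihom e (a + a') (b + b') (\<lambda>v. F v * G v)" by (rule bihom_mult)
  fix q assume q: "q \<in> points X"
  obtain \<phi> where \<phi>: "regular X (enbhd q) \<phi>" "q = x \<longrightarrow> \<phi> x \<noteq> 0"
    "\<And>z. z \<in> enbhd q \<Longrightarrow> local_value e F (eind q) (blowdown z) = eloc q z ^ M (blowdown q) * \<phi> z"
    using F q unfolding sec_def by blast
  obtain \<gamma> where \<gamma>: "regular X (enbhd q) \<gamma>" "q = x \<longrightarrow> \<gamma> x \<noteq> 0"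
    "\<And>z. z \<in> enbhd q \<Longrightarrow> local_value e G (eind q) (blowdown z) = eloc q z ^ M' (blowdown q) * \<gamma> z"
    using G q unfolding sec_def by blast
  have "local_value e (\<lambda>v. F v * G v) (eind q) (blowdown z) = eloc q z ^ (M (blowdown q) + M' (blowdown q)) * (\<phi> z * \<gamma> z)"
    if "z \<in> enbhd q" for z
    using \<phi>(3)[OF that] \<gamma>(3)[OF that] unfolding local_value_def by (simp add: power_add)
  then show "\<exists>\<gamma>. regular X (enbhd q) \<gamma> \<and>
     (\<forall>z\<in>enbhd q. local_value e (\<lambda>v. F v * G v) (eind q) (blowdown z) = eloc q z ^ (M (blowdown q) + M' (blowdown q)) * \<gamma> z) \<and>
     (q = x \<longrightarrow> \<gamma> x \<noteq> 0)"
    using \<phi>(1,2) \<gamma>(1,2) by (intro exI[of _ "\<lambda>z. \<phi> z * \<gamma> z"]) (auto intro: regular_mult)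
qed

text \<open>Over a point of \<open>T\<close> the factor left after removing the exceptional equation
  is, by \<open>exc_factor\<close>, the slope of \<open>G\<close> in the direction of
  \<open>x\<close>. The hypothesis \<open>line\<close> makes it nonzero, so the strict transform of
  the curve \<open>G = 0\<close> avoids \<open>x\<close>.\<close>

lemma sec_vanishing:
  assumes G: "poly4 G" "bihom e a b G" and T: "T \<subseteq> S" "\<And>p. p \<in> T \<Longrightarrow> G (hrep p) = 0"
    and x: "x \<in> points X" "blowdown x \<notin> T \<Longrightarrow> G (hrep (blowdown x)) \<noteq> 0"
    and line: "\<And>p d c c'. p = blowdown x \<Longrightarrow> p \<in> T \<Longrightarrow> d = edir x \<Longrightarrow> (c, c') = bl_pair d 1 (ratio p d x) \<Longrightarrow>
      \<exists>l. l \<noteq> 0 \<and> (\<forall>t. G (hlift (cj p) (fst (ctr p) + t * c, snd (ctr p) + t * c')) = l * t)"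
  shows "sec a b (\<lambda>p. if p \<in> T then 1 else 0) x G"
  unfolding sec_def
proof (intro conjI ballI)
  fix q assume q: "q \<in> points X"
  show "\<exists>\<gamma>. regular X (enbhd q) \<gamma> \<and>
     (\<forall>z\<in>enbhd q. local_value e G (eind q) (blowdown z) = eloc q z ^ (if blowdown q \<in> T then 1 else 0) * \<gamma> z) \<and>
     (q = x \<longrightarrow> \<gamma> x \<noteq> 0)"
  proof (cases "blowdown q \<in> T")
    case True
    let ?p = "blowdown q" and ?d = "edir q"
    have p: "?p \<in> S" using True T(1) by blast
    then have e: "enbhd q = ratio_dom ?p ?d" "eloc q = ccoord ?p ?d" "eind q = cj ?p"
      unfolding enbhd_def eloc_def eind_def by auto
    obtain c c' where c: "bl_pair ?d 1 (ratio ?p ?d q) = (c, c')" by (cases "bl_pair ?d 1 (ratio ?p ?d q)")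
    have "G (hlift (cj ?p) (ctr ?p)) = 0"
      using bihom_hchart_eq_0[OF G(2) centred(3)[OF p]] T(2)[OF True] unfolding ctr_def by simp
    then obtain \<gamma> where \<gamma>: "regular X (ratio_dom ?p ?d) \<gamma>"
      "\<And>z. z \<in> ratio_dom ?p ?d \<Longrightarrow> G (hlift (cj ?p) (hchart e (cj ?p) (blowdown z))) = ccoord ?p ?d z * \<gamma> z"
      "\<And>l. (\<And>t. G (hlift (cj ?p) (fst (ctr ?p) + t * c, snd (ctr ?p) + t * c')) = l * t) \<Longrightarrow> \<gamma> q = l"
      using exc_factor[OF p in_ratio_dom_edir[OF q p] refl poly4D[OF G(1), of "cj ?p"] _ c] by blast
    have "q = x \<longrightarrow> \<gamma> x \<noteq> 0"
      using \<gamma>(3) line[OF _ _ refl, of ?p c c'] True c by metis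
    then show ?thesis using True \<gamma>(1,2) unfolding e local_value_def by auto
  next
    case False
    have "regular X (enbhd q) (\<lambda>z. local_value e G (eind q) (blowdown z))"
      using enbhd(4)[OF q]
      by (intro regular_subset[OF regular_pullback[OF blowdown_chartwise_polynomial local_value_regular[OF G(1)]]]) auto
    moreover have "q = x \<longrightarrow> local_value e G (eind q) (blowdown x) \<noteq> 0"
      using bihom_hchart_eq_0[OF G(2) blowdown_in_hdom_eind[OF q]] x(2) False unfolding local_value_def by blast
    ultimately show ?thesis using False by (intro exI[of _ "\<lambda>z. local_value e G (eind q) (blowdown z)"]) auto
  qed
qed (use G in auto)

lemma sec_nonvanishing:
  assumes "poly4 G" "bihom e a b G" "x \<in> points X" "G (hrep (blowdown x)) \<noteq> 0"
  shows "sec a b (\<lambda>_. 0) x G"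
  using sec_vanishing[OF assms(1,2), of "{}" x] assms(3,4) by simp

lemma sec_power_base:
  assumes "x \<in> points X"
  shows "sec 0 n (\<lambda>_. 0) x (\<lambda>v. hbase (eind x) v ^ n)"
proof (rule sec_nonvanishing[OF _ _ assms])
  show "poly4 (\<lambda>v. hbase (eind x) v ^ n)" by (intro poly4_intros)
  show "bihom e 0 n (\<lambda>v. hbase (eind x) v ^ n)"
    unfolding bihom_def torus_act_def hbase_def by (simp add: power_mult_distrib)
  show "hbase (eind x) (hrep (blowdown x)) ^ n \<noteq> 0"
    using blowdown_in_hdom_eind[OF assms] unfolding hdom_def by simp
qed

end

section \<open>Forms in the base coordinates, fibres and interpolation\<close>

definition base_only :: "(c4 \<Rightarrow> complex) \<Rightarrow> bool" where
  "base_only h \<longleftrightarrow> (\<forall>v v'. cs v = cs v' \<longrightarrow> ct v = ct v' \<longrightarrow> h v = h v')"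

lemma base_only_intros:
  "base_only (base_form s t)" "base_only (\<lambda>v. hbase i v)" "base_only (\<lambda>_. k)"
  "base_only f \<Longrightarrow> base_only g \<Longrightarrow> base_only (\<lambda>v. f v + g v)"
  "base_only f \<Longrightarrow> base_only g \<Longrightarrow> base_only (\<lambda>v. f v * g v)"
  "base_only f \<Longrightarrow> base_only (\<lambda>v. f v ^ n)"
  "(\<And>i. i \<in> I \<Longrightarrow> base_only (K i)) \<Longrightarrow> base_only (\<lambda>v. \<Prod>i\<in>I. K i v)"
  unfolding base_only_def base_form_def hbase_def by (auto intro: prod.cong) metis+

locale hirzebruch_general_blowup = hirzebruch_blowup +
  assumes distinct_fibres: "\<And>p p'. p \<in> S \<Longrightarrow> p' \<in> S \<Longrightarrow> p \<noteq> p' \<Longrightarrow> hproj p \<noteq> hproj p'"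
    and off_neg_section: "S \<inter> neg_section e = {}"
begin

definition lam :: "hpoint \<Rightarrow> c4 \<Rightarrow> complex" where
  "lam p = base_form (cs (hrep p)) (ct (hrep p))"

lemma lam_eq_0:
  assumes "p \<in> points (hirzebruch e)" "q \<in> points (hirzebruch e)"
  shows "lam p (hrep q) = 0 \<longleftrightarrow> hproj q = hproj p"
proof -
  have "(cs (hrep p), ct (hrep p)) \<noteq> (0, 0)" "cs (hrep q) \<noteq> 0 \<or> ct (hrep q) \<noteq> 0"
    using hirzebruch_hrep(2)[OF assms(1)] hirzebruch_hrep(2)[OF assms(2)] unfolding stable_def by auto
  then show ?thesis
    unfolding lam_def using pclass_eq_iff hproj_hrep[OF assms(1)] hproj_hrep[OF assms(2)] by metis
qed

lemma lam_S: "p \<in> S \<Longrightarrow> p' \<in> S \<Longrightarrow> lam p (hrep p') = 0 \<longleftrightarrow> p = p'"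
  using lam_eq_0[of p p'] distinct_fibres[of p p'] S_points by auto

lemma cx_S: "p \<in> S \<Longrightarrow> cx (hrep p) \<noteq> 0"
  using neg_section_iff[of p e] off_neg_section S_points by blast

lemma bihom_prod_lam: "finite T \<Longrightarrow> bihom e 0 (card T) (\<lambda>v. \<Prod>p\<in>T. lam p v)"
proof (induction T rule: finite_induct)
  case empty
  then show ?case by (simp add: bihom_def)
next
  case (insert p T)
  then show ?case using bihom_mult[OF bihom_base_form insert.IH] by (simp add: lam_def)
qed

text \<open>Newton interpolation on the projective line: the correction at a new point
  \<open>p\<close> is the product of the fibres through the old points, nonzero at \<open>p\<close>
  because the fibres are distinct, padded to degree \<open>k\<close>. That \<open>h\<close> depends
  on \<open>s\<close> and \<open>t\<close> alone is recorded so that its values can be carried along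
  a fibre.\<close>

lemma interpolation:
  assumes "T \<subseteq> S" "card T \<le> k"
  shows "\<exists>h. poly4 h \<and> bihom e 0 k h \<and> base_only h \<and> (\<forall>p\<in>T. h (hrep p) = f p)"
proof -
  have "finite T" using assms(1) fin by (rule finite_subset)
  then show ?thesis using assms
  proof (induction T rule: finite_induct)
    case empty
    have "poly4 (\<lambda>_. 0)" "bihom e 0 k (\<lambda>_. 0)" "base_only (\<lambda>_. 0)"
      by (auto intro: poly4_intros base_only_intros simp: bihom_def)
    then show ?case by blast
  next
    case (insert p T)
    then obtain h where h: "poly4 h" "bihom e 0 k h" "base_only h" "\<And>p. p \<in> T \<Longrightarrow> h (hrep p) = f p"
      by auto
    have p: "p \<in> S" using insert.prems by blast
    define g where "g v = (\<Prod>p\<in>T. lam p v) * hbase (cj p) v ^ (k - card T)" for v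
    have g: "poly4 g" "base_only g"
      unfolding g_def lam_def by (intro poly4_intros poly4_base_form base_only_intros)+
    have "bihom e 0 (k - card T) (\<lambda>v. hbase (cj p) v ^ (k - card T))"
      unfolding bihom_def torus_act_def hbase_def by (simp add: power_mult_distrib)
    from bihom_mult[OF bihom_prod_lam[OF insert.hyps(1)] this]
    have gb: "bihom e 0 k g"
      using insert.prems(2) insert.hyps unfolding g_def[abs_def] by simp
    have "g (hrep p) \<noteq> 0"
    proof -
      have "lam p' (hrep p) \<noteq> 0" if "p' \<in> T" for p'
        using lam_S[of p' p] that insert.prems(1) insert.hyps(2) by auto
      moreover have "hbase (cj p) (hrep p) \<noteq> 0" using centred(3)[OF p] unfolding hdom_def by blast
      ultimately show ?thesis unfolding g_def using insert.hyps(1) by simp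
    qed
    have g0: "g (hrep p') = 0" if "p' \<in> T" for p'
      unfolding g_def using that insert.hyps(1) lam_S[of p' p'] insert.prems(1) by (auto intro: prod_zero)
    let ?h = "\<lambda>v. h v + (f p - h (hrep p)) / g (hrep p) * g v"
    have "poly4 ?h" "base_only ?h" by (intro poly4_intros base_only_intros h g)+
    moreover have "bihom e 0 k ?h" using h(2) gb unfolding bihom_def by (simp add: algebra_simps)
    moreover have "\<forall>p'\<in>insert p T. ?h (hrep p') = f p'" using h(4) g0 \<open>g (hrep p) \<noteq> 0\<close> by auto
    ultimately show ?case by blast
  qed
qed

text \<open>In the chart at \<open>p\<close> the fibre is a line of constant first coordinate. Its
  tangent is the vertical direction, so its strict transform meets the exceptional curve only where
  \<open>edir\<close> fails.\<close>

lemma sec_lam: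
  assumes p: "p \<in> S" and x: "x \<in> points X" "lam p (hrep (blowdown x)) \<noteq> 0 \<or> (blowdown x = p \<and> edir x)"
  shows "sec 0 1 (\<lambda>p'. if p' \<in> {p} then 1 else 0) x (lam p)"
proof (rule sec_vanishing)
  show "poly4 (lam p)" "bihom e 0 1 (lam p)" unfolding lam_def by (rule poly4_base_form bihom_base_form)+
  have 0: "lam p (hrep p) = 0" using lam_S[OF p p] by simp
  show "{p} \<subseteq> S" "x \<in> points X" "\<And>p'. p' \<in> {p} \<Longrightarrow> lam p (hrep p') = 0" using p x 0 by auto
  show "blowdown x \<notin> {p} \<Longrightarrow> lam p (hrep (blowdown x)) \<noteq> 0" using x(2) by auto
  fix p' d c c' assume *: "p' = blowdown x" "p' \<in> {p}" "d = edir x" "(c, c') = bl_pair d 1 (ratio p' d x)"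
  then have "edir x" "p' = p" using x(2) 0 by auto
  then have "c = 1" using *(3,4) unfolding bl_pair_def by simp
  \<comment> \<open>The coefficient of the first coordinate in \<open>lam p\<close>; up to sign it
    is the base coordinate that \<open>cj p\<close> normalises, hence nonzero.\<close>
  define l where "l = (if fst (cj p) then - cs (hrep p) else ct (hrep p))"
  have "hbase (cj p) (hrep p) \<noteq> 0" using centred(3)[OF p] unfolding hdom_def by blast
  then have "l \<noteq> 0" unfolding l_def hbase_def by (simp split: if_splits)
  have "lam p (hlift (cj p) (ctr p)) = 0"
    using bihom_hchart_eq_0[OF bihom_base_form centred(3)[OF p]] 0 unfolding lam_def ctr_def by blast
  then have "lam p (hlift (cj p) (fst (ctr p) + t * c, snd (ctr p) + t * c')) = l * t" for t
    unfolding lam_def base_form_def l_def \<open>c = 1\<close> hlift_def by (auto simp: algebra_simps split: if_splits)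
  then show "\<exists>l. l \<noteq> 0 \<and> (\<forall>t. lam p (hlift (cj p') (fst (ctr p') + t * c, snd (ctr p') + t * c')) = l * t)"
    using \<open>l \<noteq> 0\<close> \<open>p' = p\<close> by blast
qed

lemma sec_prod_lam:
  assumes "T \<subseteq> S" "x \<in> points X"
    "\<And>p. p \<in> T \<Longrightarrow> lam p (hrep (blowdown x)) \<noteq> 0 \<or> (blowdown x = p \<and> edir x)"
  shows "sec 0 (card T) (\<lambda>p. if p \<in> T then 1 else 0) x (\<lambda>v. \<Prod>p\<in>T. lam p v)"
proof -
  have "finite T" using assms(1) fin by (rule finite_subset)
  then show ?thesis using assms(1,3)
  proof (induction T rule: finite_induct)
    case empty
    then show ?case using sec_power_base[OF assms(2), of 0] by simp
  next
    case (insert p T)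
    have "sec (0 + 0) (1 + card T) (\<lambda>p'. (if p' \<in> {p} then 1 else 0) + (if p' \<in> T then 1 else 0)) x
        (\<lambda>v. lam p v * (\<Prod>p\<in>T. lam p v))"
      using insert.prems assms(2) by (intro sec_mult sec_lam insert.IH) auto
    moreover have "(\<lambda>p'. (if p' \<in> {p} then 1 else 0) + (if p' \<in> T then 1 else 0)) =
        (\<lambda>p'. if p' \<in> insert p T then 1 else 0 :: nat)"
      using insert.hyps by auto
    ultimately show ?case using insert.hyps by (simp del: insert_iff)
  qed
qed

section \<open>Freeness of a single factor\<close>

lemma sec_factor_product:
  assumes "T \<subseteq> S" "x \<in> points X" "card T \<le> k" "cx (hrep (blowdown x)) \<noteq> 0"
    "\<And>p. p \<in> T \<Longrightarrow> lam p (hrep (blowdown x)) \<noteq> 0 \<or> (blowdown x = p \<and> edir x)"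
  shows "\<exists>G. sec 1 k (\<lambda>p. if p \<in> T then 1 else 0) x G"
proof -
  have "sec 1 0 (\<lambda>_. 0) x cx"
    by (rule sec_nonvanishing[OF _ bihom_cx assms(2,4)]) (intro poly4_intros)
  from sec_mult[OF sec_mult[OF this sec_prod_lam[OF assms(1,2,5)]] sec_power_base[OF assms(2), of "k - card T"]]
  show ?thesis using assms(3) by auto
qed

text \<open>On \<open>x = 0\<close> the form reduces to \<open>y\<close> times a nonzero factor; on
  the fibre of a point of \<open>T\<close> the graph passes only through that point; and a graph is
  never tangent to a fibre, which settles the vertical direction over \<open>T\<close>.\<close>

lemma sec_factor_graph:
  assumes T: "T \<subseteq> S" and x: "x \<in> points X" and k: "card T \<le> k" "e \<le> k"
    and sep: "(blowdown x \<in> T \<and> \<not> edir x) \<or>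
      (blowdown x \<notin> S \<and> (cx (hrep (blowdown x)) = 0 \<or> (\<exists>p\<in>T. lam p (hrep (blowdown x)) = 0)))"
  shows "\<exists>G. sec 1 k (\<lambda>p. if p \<in> T then 1 else 0) x G"
proof -
  \<comment> \<open>\<open>y\<close> already has base weight \<open>e\<close>; the missing
    \<open>k - e\<close> is filled by a fibre that does not pass through \<open>x\<close>.\<close>
  let ?\<mu> = "\<lambda>v. hbase (eind x) v ^ (k - e)"
  \<comment> \<open>The prescribed values solve \<open>G (hrep p) = 0\<close>; the division is
    possible because \<open>p\<close> is off the negative section.\<close>
  obtain h where h: "poly4 h" "bihom e 0 k h" "base_only h"
      "\<And>p. p \<in> T \<Longrightarrow> h (hrep p) = - (cy (hrep p) * ?\<mu> (hrep p)) / cx (hrep p)"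
    using interpolation[OF T k(1), of "\<lambda>p. - (cy (hrep p) * ?\<mu> (hrep p)) / cx (hrep p)"] by blast
  define G where "G v = cy v * ?\<mu> v + cx v * h v" for v
  have G: "poly4 G" unfolding G_def by (intro poly4_intros h)
  have Gb: "bihom e 1 k G"
    unfolding bihom_def
  proof (intro allI impI)
    fix l c :: complex and v assume nz: "l \<noteq> 0" "c \<noteq> 0"
    have "?\<mu> (torus_act e l c v) = l ^ (k - e) * ?\<mu> v"
      unfolding torus_act_def hbase_def by (simp add: power_mult_distrib)
    moreover have "l ^ k = l ^ e * l ^ (k - e)" using k(2) by (simp flip: power_add)
    ultimately show "G (torus_act e l c v) = l ^ k * c ^ 1 * G v"
      unfolding G_def bihomD[OF h(2) nz] by (simp add: torus_act_def algebra_simps)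
  qed
  have G0: "G (hrep p) = 0" if "p \<in> T" for p
    unfolding G_def h(4)[OF that] using cx_S[of p] that T by auto
  have "sec 1 k (\<lambda>p. if p \<in> T then 1 else 0) x G"
  proof (rule sec_vanishing[OF G Gb T G0 x])
    assume xT: "blowdown x \<notin> T"
    let ?q = "blowdown x"
    have q: "?q \<in> points (hirzebruch e)" by (rule blowdown_in_points[OF x])
    have xS: "?q \<notin> S" and alt: "cx (hrep ?q) = 0 \<or> (\<exists>p\<in>T. lam p (hrep ?q) = 0)" using sep xT by auto
    have \<mu>: "hbase (eind x) (hrep ?q) \<noteq> 0" using blowdown_in_hdom_eind[OF x] unfolding hdom_def by blast
    show "G (hrep ?q) \<noteq> 0"
    proof (cases "cx (hrep ?q) = 0")
      case True
      then have "cy (hrep ?q) \<noteq> 0" using hirzebruch_hrep(2)[OF q] unfolding stable_def by blast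
      then show ?thesis unfolding G_def True using \<mu> by simp
    next
      case False
      then obtain p where p: "p \<in> T" "lam p (hrep ?q) = 0" using alt by blast
      have pH: "p \<in> points (hirzebruch e)" using p(1) T S_points by blast
      have st: "stable (hrep p)" "stable (hrep ?q)" using hirzebruch_hrep(2)[OF pH] hirzebruch_hrep(2)[OF q] .
      obtain l where l: "l \<noteq> 0" "cs (hrep ?q) = l * cs (hrep p)" "ct (hrep ?q) = l * ct (hrep p)"
        using base_form_eq_0[of "cs (hrep p)" "ct (hrep p)" "hrep ?q"] p(2) st unfolding lam_def stable_def by auto
      have cxp: "cx (hrep p) \<noteq> 0" using cx_S p(1) T by blast
      \<comment> \<open>Both points lie on one fibre, so their base coordinates differ by the factor
        \<open>l\<close> and forms in \<open>s, t\<close> scale accordingly.\<close>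
      have hw: "h (hrep ?q) = l ^ k * h (hrep p)" "?\<mu> (hrep ?q) = l ^ (k - e) * ?\<mu> (hrep p)"
      proof -
        have "cs (hrep ?q) = cs (torus_act e l 1 (hrep p))" "ct (hrep ?q) = ct (torus_act e l 1 (hrep p))"
          using l unfolding torus_act_def by simp_all
        then have "h (hrep ?q) = h (torus_act e l 1 (hrep p))"
          using h(3) unfolding base_only_def by blast
        then show "h (hrep ?q) = l ^ k * h (hrep p)" using bihomD[OF h(2) l(1), of 1] by simp
        show "?\<mu> (hrep ?q) = l ^ (k - e) * ?\<mu> (hrep p)"
          using l unfolding hbase_def by (simp add: power_mult_distrib)
      qed
      show ?thesis
      proof
        assume "G (hrep ?q) = 0"
        have lk: "l ^ k = l ^ (k - e) * l ^ e" using k(2) by (simp flip: power_add)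
        have nz: "l ^ (k - e) * ?\<mu> (hrep p) \<noteq> 0" using hw(2) \<mu> by (metis power_not_zero)
        \<comment> \<open>What remains is the determinant of the two pairs of fibre coordinates; its
          vanishing would identify the two points, although only \<open>p\<close> lies in
          \<open>T\<close>.\<close>
        have "0 = cx (hrep p) * G (hrep ?q)" using \<open>G (hrep ?q) = 0\<close> by simp
        also have "\<dots> = l ^ (k - e) * ?\<mu> (hrep p) * (cx (hrep p) * cy (hrep ?q) - cx (hrep ?q) * (l ^ e * cy (hrep p)))"
          unfolding G_def hw h(4)[OF p(1)] lk using cxp by (simp add: field_simps)
        finally have "cx (hrep p) * cy (hrep ?q) - cx (hrep ?q) * (l ^ e * cy (hrep p)) = 0"
          using nz by (metis mult_eq_0_iff)
        then have "cx (hrep p) * cy (hrep ?q) = cx (hrep ?q) * (l ^ e * cy (hrep p))" by simp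
        then have "hrep ?q = torus_act e l (cx (hrep ?q) / cx (hrep p)) (hrep p)"
          unfolding torus_act_def using l cxp by (simp add: prod_eq_iff field_simps)
        moreover have "cx (hrep ?q) / cx (hrep p) \<noteq> 0" using False cxp by simp
        ultimately have "hcl e (hrep ?q) = hcl e (hrep p)" using hcl_act[OF l(1)] by metis
        then have "?q = p" using hirzebruch_hrep(1)[OF q] hirzebruch_hrep(1)[OF pH] by simp
        then show False using xT p(1) by simp
      qed
    qed
  next
    fix p d c c' assume *: "p = blowdown x" "p \<in> T" "d = edir x" "(c, c') = bl_pair d 1 (ratio p d x)"
    have p: "p \<in> S" using *(2) T by blast
    then have "\<not> edir x" using sep *(1) by blast
    then have c: "c = 0" "c' = 1" using ratio_not_edir[OF x] p * unfolding bl_pair_def by auto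
    obtain a b where ab: "ctr p = (a, b)" by (cases "ctr p")
    let ?l = "\<lambda>t. hlift (cj p) (a, t)"
    have hc: "h (?l t) = h (?l b)" for t
      using h(3) unfolding base_only_def hlift_def by simp
    have "eind x = cj p" unfolding eind_def using *(1) p by simp
    then have \<mu>: "?\<mu> (?l t) = 1" for t unfolding hbase_def hlift_def by simp
    have "G (?l b) = 0"
      using bihom_hchart_eq_0[OF Gb centred(3)[OF p]] G0[OF *(2)] ab unfolding ctr_def by simp
    then have 0: "cy (?l b) + cx (?l b) * h (?l b) = 0" unfolding G_def \<mu> by simp
    \<comment> \<open>On the vertical line \<open>G\<close> is affine in \<open>t\<close>. Its slope
      is 1 where \<open>x = 1\<close>, and the value of \<open>h\<close> where \<open>y = 1\<close>;
      in the latter case vanishing at the centre excludes \<open>h = 0\<close>.\<close>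
    have "\<exists>l. l \<noteq> 0 \<and> (\<forall>t. G (?l (b + t)) = l * t)"
    proof (cases "snd (cj p)")
      case True
      then have "G (?l (b + t)) = 1 * t" for t
        using 0 unfolding G_def \<mu> hc[of "b + t"] by (simp add: hlift_def algebra_simps)
      then show ?thesis using one_neq_zero by blast
    next
      case False
      then have "1 + b * h (?l b) = 0" using 0 by (simp add: hlift_def)
      then have "h (?l b) \<noteq> 0" by auto
      moreover have "G (?l (b + t)) = h (?l b) * t" for t
        using 0 False unfolding G_def \<mu> hc[of "b + t"] by (simp add: hlift_def algebra_simps)
      ultimately show ?thesis by blast
    qed
    then show "\<exists>l. l \<noteq> 0 \<and> (\<forall>t. G (hlift (cj p) (fst (ctr p) + t * c, snd (ctr p) + t * c')) = l * t)"
      using c ab by simp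
  qed
  then show ?thesis by blast
qed

lemma sec_factor:
  assumes "T \<subseteq> S" "x \<in> points X" "card T \<le> k" "e \<le> k"
  shows "\<exists>G. sec 1 k (\<lambda>p. if p \<in> T then 1 else 0) x G"
proof (cases "cx (hrep (blowdown x)) \<noteq> 0 \<and>
    (\<forall>p\<in>T. lam p (hrep (blowdown x)) \<noteq> 0 \<or> (blowdown x = p \<and> edir x))")
  case True
  then show ?thesis using sec_factor_product[OF assms(1-3)] by blast
next
  case False
  \<comment> \<open>Over \<open>S\<close> the product of curves fails only in the vertical direction
    at a point of \<open>T\<close>: there \<open>x\<close> is nonzero, and no other fibre through
    \<open>T\<close> passes through the point.\<close>
  have "(blowdown x \<in> T \<and> \<not> edir x) \<or>
      (blowdown x \<notin> S \<and> (cx (hrep (blowdown x)) = 0 \<or> (\<exists>p\<in>T. lam p (hrep (blowdown x)) = 0)))"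
  proof (cases "blowdown x \<in> S")
    case True
    then obtain p where p: "p \<in> T" "lam p (hrep (blowdown x)) = 0" "\<not> (blowdown x = p \<and> edir x)"
      using False cx_S by blast
    then have "p = blowdown x" using lam_S[OF _ True] assms(1) by blast
    then show ?thesis using p by blast
  qed (use False in blast)
  then show ?thesis by (rule sec_factor_graph[OF assms])
qed

text \<open>Induction on \<open>a\<close>. A factor of degree \<open>k\<close> may be split off as
  long as \<open>b - k\<close> still bounds both \<open>a * e\<close> and the remaining sum of
  multiplicities; the three cases verify this with \<open>k\<close> the larger of \<open>e\<close>
  and \<open>card T\<close>.\<close>

lemma sec_exists:
  assumes "x \<in> points X" "\<And>p. p \<in> S \<Longrightarrow> M p \<le> a" "a * e \<le> b" "sum M S \<le> b"
  shows "\<exists>G. sec a b M x G"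
  using assms(2-4)
proof (induction a arbitrary: b M)
  case 0
  then show ?case using sec_cong[OF sec_power_base[OF assms(1), of b], of M] by auto
next
  case (Suc a)
  define top where "top = {p \<in> S. M p = Suc a}"
  define pos where "pos = {p \<in> S. M p > 0}"
  have sub: "top \<subseteq> pos" "pos \<subseteq> S" unfolding top_def pos_def by auto
  have finp: "finite pos" "finite top" using sub fin by (auto intro: finite_subset)
  have reduce: ?case
    if T: "top \<subseteq> T" "T \<subseteq> pos" and k: "card T \<le> k" "e \<le> k" "k \<le> b" "a * e \<le> b - k" "sum M S - card T \<le> b - k" for T k
  proof -
    \<comment> \<open>Containing \<open>top\<close> brings the maximum down to \<open>a\<close>;
      staying inside \<open>pos\<close> makes the truncated subtraction exact.\<close>
    define M' where "M' p = M p - (if p \<in> T then 1 else 0)" for p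
    have M: "M p = M' p + (if p \<in> T then 1 else 0)" for p
      using T(2) unfolding M'_def pos_def by auto
    have "sum M S = sum M' S + (\<Sum>p\<in>S. if p \<in> T then 1 else 0)"
      unfolding M by (simp add: sum.distrib)
    also have "(\<Sum>p\<in>S. if p \<in> T then 1 else 0) = card T"
      using T(2) sub(2) fin by (simp add: sum.If_cases Int_absorb1 subset_trans)
    finally have "sum M' S \<le> b - k" using k(5) by simp
    moreover have "M' p \<le> a" if "p \<in> S" for p
      using Suc.prems(1)[OF that] T(1) that unfolding M'_def top_def by (cases "M p = Suc a") auto
    ultimately obtain G where G: "sec a (b - k) M' x G" using Suc.IH[of M' "b - k"] k(4) by blast
    obtain F where F: "sec 1 k (\<lambda>p. if p \<in> T then 1 else 0) x F"
      using sec_factor[OF _ assms(1) k(1,2)] T(2) sub(2) by blast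
    have "sec (a + 1) (b - k + k) (\<lambda>p. M' p + (if p \<in> T then 1 else 0)) x (\<lambda>v. G v * F v)"
      by (rule sec_mult[OF G F])
    then have "sec (Suc a) b M x (\<lambda>v. G v * F v)" using k(3) M[symmetric] by simp
    then show ?thesis by blast
  qed
  have b: "e + a * e \<le> b" using Suc.prems(2) by simp
  consider "e \<le> card top" | "card pos \<le> e" | "card top \<le> e" "e \<le> card pos" by linarith
  then show ?case
  proof cases
    case 1
    \<comment> \<open>Points of \<open>top\<close> have multiplicity \<open>a + 1\<close>, so
      \<open>(a + 1) * card top \<le> b\<close>. Removing \<open>card top\<close> leaves at least
      \<open>a * card top\<close>, which is at least \<open>a * e\<close>.\<close>
    have "Suc a * card top = (\<Sum>p\<in>top. Suc a)" by simp
    also have "\<dots> = (\<Sum>p\<in>top. M p)" by (rule sum.cong) (auto simp: top_def)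
    also have "\<dots> \<le> sum M S" using sub fin by (intro sum_mono2) auto
    finally have *: "card top + a * card top \<le> b" using Suc.prems(3) by simp
    have "a * e \<le> a * card top" using 1 by simp
    then have "a * e \<le> b - card top" using * by linarith
    then show ?thesis using reduce[of top "card top"] 1 sub * Suc.prems(3) by (simp add: diff_le_mono)
  next
    case 2
    \<comment> \<open>With few points the remaining multiplicities sum to at most
      \<open>a * card pos \<le> a * e\<close>, and this is at most \<open>b - e\<close>.\<close>
    have "sum M S = (\<Sum>p\<in>pos. M p)" by (rule sum.mono_neutral_right) (auto simp: fin pos_def)
    also have "\<dots> \<le> (\<Sum>p\<in>pos. Suc a)" using Suc.prems(1) sub(2) by (intro sum_mono) blast
    finally have "sum M S - card pos \<le> a * card pos" by (simp add: mult.commute)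
    also have "\<dots> \<le> a * e" using 2 by simp
    finally show ?thesis using reduce[of pos e] 2 sub b by simp
  next
    case 3
    \<comment> \<open>With exactly \<open>e\<close> points, \<open>b\<close>, the bound
      \<open>(a + 1) * e\<close> and the sum of multiplicities all drop by \<open>e\<close>.\<close>
    obtain T where "top \<subseteq> T" "T \<subseteq> pos" "card T = e"
      using exists_subset_between[OF 3 sub(1) finp(1)] by blast
    then show ?thesis using reduce[of T e] b Suc.prems(3) by simp
  qed
qed

end

section \<open>Global generation\<close>

lemma base_form_hlift_nonzero:
  assumes "(s, t) \<noteq> (0, 0)" shows "\<exists>v. base_form s t (hlift j v) \<noteq> 0"
proof (cases "fst j")
  case True
  show ?thesis
  proof (cases "s = 0")
    case True
    then show ?thesis using assms \<open>fst j\<close> by (intro exI[of _ "(0, 0)"]) (simp add: base_form_def hlift_def)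
  next
    case False
    then show ?thesis using \<open>fst j\<close> by (intro exI[of _ "((t - 1) / s, 0)"]) (simp add: base_form_def hlift_def)
  qed
next
  case False
  show ?thesis
  proof (cases "t = 0")
    case True
    then show ?thesis using assms \<open>\<not> fst j\<close> by (intro exI[of _ "(0, 0)"]) (simp add: base_form_def hlift_def)
  next
    case False
    then show ?thesis using \<open>\<not> fst j\<close> by (intro exI[of _ "((s + 1) / t, 0)"]) (simp add: base_form_def hlift_def)
  qed
qed

lemma power_int_minus_mult_power: "(x::complex) \<noteq> 0 \<Longrightarrow> x powi (- int n) * x ^ n = 1"
  by (simp add: power_int_minus)

context hirzebruch_general_blowup
begin

text \<open>Up to units, the sections of the three kinds of curves are \<open>x\<close>, the fibre
  form and \<open>eloc q\<close>. Their powers cancel against the denominator of the rational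
  function and the exceptional factor of \<open>G\<close>, which leaves units times
  \<open>\<gamma>\<close>. Regularity, and nonvanishing at \<open>x\<close>, are thus inherited from
  \<open>sec\<close>.\<close>

lemma local_section:
  assumes C: "line_bundle (hirzebruch e) OC" "curve_section (hirzebruch e) (neg_section e) OC sC"
    and f: "line_bundle (hirzebruch e) Of" "curve_section (hirzebruch e) (hfiber e (pclass c1 c2)) Of sf" "(c1, c2) \<noteq> (0, 0)"
    and I: "finite I" "inj_on p I" "S = p ` I"
    and E: "\<And>i. i \<in> I \<Longrightarrow> line_bundle X (E i)" "\<And>i. i \<in> I \<Longrightarrow> curve_section X (exceptional (hirzebruch e) S (p i)) (E i) (sE i)"
    and m: "\<And>i. i \<in> I \<Longrightarrow> m i = int (M (p i))"
    and G: "sec a b M x G" and q: "q \<in> points X"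
  shows "\<exists>W \<tau>. openin (zariski X) W \<and> q \<in> W \<and> regular X W \<tau> \<and> (q = x \<longrightarrow> \<tau> x \<noteq> 0) \<and>
    (\<forall>z\<in>W. blowdown z \<notin> S \<longrightarrow> cx (hrep (blowdown z)) \<noteq> 0 \<longrightarrow> base_form c1 c2 (hrep (blowdown z)) \<noteq> 0 \<longrightarrow>
      \<tau> z = sC (blowdown q) (blowdown z) powi int a * sf (blowdown q) (blowdown z) powi int b *
        (\<Prod>i\<in>I. sE i q z powi (- m i)) *
        (G (hrep (blowdown z)) / (cx (hrep (blowdown z)) ^ a * base_form c1 c2 (hrep (blowdown z)) ^ b)))"
proof -
  let ?\<pi> = blowdown and ?j = "eind q" and ?f = "base_form c1 c2"
  have \<pi>q: "?\<pi> q \<in> hdom e ?j" by (rule blowdown_in_hdom_eind[OF q])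
  obtain WC \<kappa>C where WC: "openin (zariski (hirzebruch e)) WC" "?\<pi> q \<in> WC" "regular (hirzebruch e) WC \<kappa>C"
      "\<And>z. z \<in> WC \<Longrightarrow> \<kappa>C z \<noteq> 0 \<and> sC (?\<pi> q) z = \<kappa>C z * local_value e cx ?j z"
    using neg_section_local_equation[OF C \<pi>q] by metis
  obtain Wf \<kappa>f where Wf: "openin (zariski (hirzebruch e)) Wf" "?\<pi> q \<in> Wf" "regular (hirzebruch e) Wf \<kappa>f"
      "\<And>z. z \<in> Wf \<Longrightarrow> \<kappa>f z \<noteq> 0 \<and> sf (?\<pi> q) z = \<kappa>f z * local_value e ?f ?j z"
    using fiber_local_equation[OF f \<pi>q] by metis
  have "\<exists>W \<kappa>. openin (zariski X) W \<and> q \<in> W \<and> regular X W \<kappa> \<and>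
      (\<forall>z\<in>W. \<kappa> z \<noteq> 0 \<and> sE i q z = \<kappa> z * (if p i = ?\<pi> q then eloc q z else 1))" if i: "i \<in> I" for i
  proof (cases "p i = ?\<pi> q")
    case True
    have pS: "p i \<in> S" using i I(3) by blast
    then have "q \<in> ratio_dom (p i) (edir q)" using in_ratio_dom_edir[OF q] True by simp
    from exceptional_local_equation[OF E[OF i] pS this True[symmetric]]
    show ?thesis using True pS unfolding eloc_def by auto
  next
    case False
    then show ?thesis using exceptional_local_unit[OF E[OF i] q False[symmetric]] by auto
  qed
  then obtain WE \<kappa>E where WE: "\<And>i. i \<in> I \<Longrightarrow> openin (zariski X) (WE i) \<and> q \<in> WE i \<and> regular X (WE i) (\<kappa>E i)"
      "\<And>i z. i \<in> I \<Longrightarrow> z \<in> WE i \<Longrightarrow> \<kappa>E i z \<noteq> 0 \<and> sE i q z = \<kappa>E i z * (if p i = ?\<pi> q then eloc q z else 1)"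
    by metis
  obtain \<gamma> where \<gamma>: "regular X (enbhd q) \<gamma>" "q = x \<longrightarrow> \<gamma> x \<noteq> 0"
    "\<And>z. z \<in> enbhd q \<Longrightarrow> local_value e G ?j (?\<pi> z) = eloc q z ^ M (?\<pi> q) * \<gamma> z"
    using G q unfolding sec_def by blast
  have Gb: "bihom e a b G" using G unfolding sec_def by blast
  define W where "W = (enbhd q \<inter> {z \<in> points X. ?\<pi> z \<in> WC} \<inter> {z \<in> points X. ?\<pi> z \<in> Wf}) \<inter> (\<Inter>i\<in>I. WE i)"
  \<comment> \<open>The product after cancellation, regular on all of \<open>W\<close>; the formula
    in the claim describes it where the denominators do not vanish.\<close>
  define \<tau> where "\<tau> z = \<kappa>C (?\<pi> z) ^ a * \<kappa>f (?\<pi> z) ^ b * (\<Prod>i\<in>I. \<kappa>E i z powi (- m i)) * \<gamma> z" for z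
  have Wo: "openin (zariski X) W"
    unfolding W_def
    using openin_pullback[OF blowdown_chartwise_polynomial WC(1)] openin_pullback[OF blowdown_chartwise_polynomial Wf(1)]
      enbhd(1)[OF q] WE(1) by (intro openin_zariski_INT[OF I(1)] openin_Int) auto
  have qW: "q \<in> W" unfolding W_def using enbhd(2)[OF q] q WC(2) Wf(2) WE(1) by blast
  have reg: "regular X W \<tau>"
    unfolding \<tau>_def
  proof (intro regular_intros regular_powi)
    show "regular X W (\<lambda>z. \<kappa>C (?\<pi> z))"
      by (rule regular_subset[OF regular_pullback[OF blowdown_chartwise_polynomial WC(3)]]) (auto simp: W_def)
    show "regular X W (\<lambda>z. \<kappa>f (?\<pi> z))"
      by (rule regular_subset[OF regular_pullback[OF blowdown_chartwise_polynomial Wf(3)]]) (auto simp: W_def)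
    show "regular X W \<gamma>" by (rule regular_subset[OF \<gamma>(1)]) (auto simp: W_def)
    fix i assume i: "i \<in> I"
    have "W \<subseteq> WE i" using i unfolding W_def by blast
    then show "regular X W (\<kappa>E i)" using WE(1)[OF i] regular_subset by blast
    show "\<kappa>E i z \<noteq> 0" if "z \<in> W" for z using WE(2)[OF i] \<open>W \<subseteq> WE i\<close> that by blast
  qed
  have nz: "q = x \<longrightarrow> \<tau> x \<noteq> 0"
  proof
    assume qx: "q = x"
    have "(\<Prod>i\<in>I. \<kappa>E i x powi (- m i)) \<noteq> 0"
      using WE qx I(1) by (auto simp: power_int_eq_0_iff)
    then show "\<tau> x \<noteq> 0" unfolding \<tau>_def using WC(2,4) Wf(2,4) qx \<gamma>(2) by simp
  qed
  have val: "\<tau> z = sC (?\<pi> q) (?\<pi> z) powi int a * sf (?\<pi> q) (?\<pi> z) powi int b * (\<Prod>i\<in>I. sE i q z powi (- m i)) *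
        (G (hrep (?\<pi> z)) / (cx (hrep (?\<pi> z)) ^ a * ?f (hrep (?\<pi> z)) ^ b))"
    if z: "z \<in> W" "?\<pi> z \<notin> S" "cx (hrep (?\<pi> z)) \<noteq> 0" "?f (hrep (?\<pi> z)) \<noteq> 0" for z
  proof -
    have ze: "z \<in> enbhd q" and zC: "?\<pi> z \<in> WC" and zf: "?\<pi> z \<in> Wf" and zE: "\<And>i. i \<in> I \<Longrightarrow> z \<in> WE i"
      using z(1) unfolding W_def by auto
    have zd: "?\<pi> z \<in> hdom e ?j" using enbhd(4)[OF q ze] .
    obtain l k where lk: "l \<noteq> 0" "k \<noteq> 0" "hlift ?j (hchart e ?j (?\<pi> z)) = torus_act e l k (hrep (?\<pi> z))"
      using hlift_hchart(1)[OF zd] by blast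
    let ?A = "local_value e cx ?j (?\<pi> z)" and ?B = "local_value e ?f ?j (?\<pi> z)"
    have AB: "?A = k * cx (hrep (?\<pi> z))" "?B = l * ?f (hrep (?\<pi> z))"
      "local_value e G ?j (?\<pi> z) = l ^ b * k ^ a * G (hrep (?\<pi> z))"
      unfolding local_value_def lk(3) bihomD[OF Gb lk(1,2)] bihomD[OF bihom_cx lk(1,2)] bihomD[OF bihom_base_form lk(1,2)]
      by simp_all
    have nz: "?A \<noteq> 0" "?B \<noteq> 0" unfolding AB using lk z by auto
    \<comment> \<open>The torus factors \<open>l\<close> and \<open>k\<close> between the two
      representatives cancel, because numerator and denominator have the same weight.\<close>
    have R: "G (hrep (?\<pi> z)) / (cx (hrep (?\<pi> z)) ^ a * ?f (hrep (?\<pi> z)) ^ b) =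
        eloc q z ^ M (?\<pi> q) * \<gamma> z / (?A ^ a * ?B ^ b)"
    proof -
      have "eloc q z ^ M (?\<pi> q) * \<gamma> z = l ^ b * k ^ a * G (hrep (?\<pi> z))"
        using \<gamma>(3)[OF ze] AB(3) by simp
      then show ?thesis unfolding AB(1,2) using lk(1,2) z(3,4) by (simp add: power_mult_distrib)
    qed
    \<comment> \<open>Near \<open>q\<close> at most one exceptional section is not a unit, namely
      the one over \<open>blowdown q\<close>; its power cancels the multiplicity of
      \<open>G\<close>, as \<open>eloc q z\<close> is nonzero for \<open>z\<close> off the
      exceptional curves.\<close>
    have eps: "(\<Prod>i\<in>I. (if p i = ?\<pi> q then eloc q z else 1) powi (- m i)) * eloc q z ^ M (?\<pi> q) = 1"
    proof (cases "?\<pi> q \<in> S")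
      case False
      then have "p i \<noteq> ?\<pi> q" if "i \<in> I" for i using that I(3) by auto
      then have "(\<Prod>i\<in>I. (if p i = ?\<pi> q then eloc q z else 1) powi (- m i)) = 1"
        by (intro prod.neutral) auto
      then show ?thesis using False unfolding eloc_def by simp
    next
      case True
      then obtain i0 where i0: "i0 \<in> I" "?\<pi> q = p i0" using I(3) by blast
      have "eloc q z \<noteq> 0"
        using ze z(2) True unfolding eloc_def enbhd_def ratio_dom_def by (auto split: if_splits)
      moreover have "(\<Prod>i\<in>I. (if p i = ?\<pi> q then eloc q z else 1) powi (- m i)) =
          (\<Prod>i\<in>I. if i = i0 then eloc q z powi (- m i0) else 1)"
        by (rule prod.cong) (use i0 inj_onD[OF I(2)] in auto)
      ultimately show ?thesis using i0 I(1) m[OF i0(1)] power_int_minus_mult_power by simp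
    qed
    have "(\<Prod>i\<in>I. sE i q z powi (- m i)) = (\<Prod>i\<in>I. (\<kappa>E i z * (if p i = ?\<pi> q then eloc q z else 1)) powi (- m i))"
      using WE(2) zE by (intro prod.cong) auto
    also have "\<dots> = (\<Prod>i\<in>I. \<kappa>E i z powi (- m i)) * (\<Prod>i\<in>I. (if p i = ?\<pi> q then eloc q z else 1) powi (- m i))"
      unfolding power_int_mult_distrib prod.distrib ..
    finally have PE: "(\<Prod>i\<in>I. sE i q z powi (- m i)) = \<dots>" .
    have "sC (?\<pi> q) (?\<pi> z) powi int a * sf (?\<pi> q) (?\<pi> z) powi int b * (\<Prod>i\<in>I. sE i q z powi (- m i)) *
        (G (hrep (?\<pi> z)) / (cx (hrep (?\<pi> z)) ^ a * ?f (hrep (?\<pi> z)) ^ b)) =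
      (\<kappa>C (?\<pi> z) * ?A) ^ a * (\<kappa>f (?\<pi> z) * ?B) ^ b *
        ((\<Prod>i\<in>I. \<kappa>E i z powi (- m i)) * (\<Prod>i\<in>I. (if p i = ?\<pi> q then eloc q z else 1) powi (- m i))) *
        (eloc q z ^ M (?\<pi> q) * \<gamma> z / (?A ^ a * ?B ^ b))"
      unfolding R PE using WC(4)[OF zC] Wf(4)[OF zf] by simp
    also have "\<dots> = \<kappa>C (?\<pi> z) ^ a * \<kappa>f (?\<pi> z) ^ b * (\<Prod>i\<in>I. \<kappa>E i z powi (- m i)) * \<gamma> z *
        ((\<Prod>i\<in>I. (if p i = ?\<pi> q then eloc q z else 1) powi (- m i)) * eloc q z ^ M (?\<pi> q))"
      using nz by (simp add: power_mult_distrib field_simps)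
    finally show ?thesis unfolding eps \<tau>_def by simp
  qed
  show ?thesis using Wo qW reg nz val by blast
qed

end

theorem theorem4p1:
  fixes e r :: nat and p :: "nat \<Rightarrow> hpoint" and c :: "(complex \<times> complex) set"
    and a b :: int and m :: "nat \<Rightarrow> int"
    and X :: "hpoint bpoint atlas"
    and OC Of :: "hpoint lbundle" and E :: "nat \<Rightarrow> hpoint bpoint lbundle"
    and H F L :: "hpoint bpoint lbundle"
  assumes "e > 0" and "r \<ge> 1"
    and "\<forall>i\<in>{1..r}. p i \<in> points (hirzebruch e)"
    and "inj_on p {1..r}"
    and "\<forall>i\<in>{1..r}. p i \<notin> neg_section e"
    and "\<forall>i\<in>{1..r}. \<forall>j\<in>{1..r}. i \<noteq> j \<longrightarrow> hproj (p i) \<noteq> hproj (p j)"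
    and "X = blowup (hirzebruch e) (p ` {1..r})"
    and "associated_to_curve (hirzebruch e) (neg_section e) OC"
    and "c \<in> P1" and "associated_to_curve (hirzebruch e) (hfiber e c) Of"
    and "H = lb_pullback X blowdown OC" and "F = lb_pullback X blowdown Of"
    and "\<forall>i\<in>{1..r}. associated_to_curve X (exceptional (hirzebruch e) (p ` {1..r}) (p i)) (E i)"
    and "line_bundle X L"
    and "lb_iso X L (lb_add (lb_add (lb_scale a H) (lb_scale b F))
                            (lb_sum X {1..r} (\<lambda>i. lb_scale (- m i) (E i))))"
    and "\<forall>i\<in>{1..r}. a + 2 > m i + 1 \<and> m i + 1 > 0"
    and "b + int e + 2 > (a + 2) * int e"
    and "b + int e + 2 > (\<Sum>i=1..r. (m i + 1))"
  shows "globally_generated X L"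
proof (rule globally_generatedI[OF assms(14)])
  fix x assume x: "x \<in> points X"
  let ?S = "p ` {1..r}" and ?I = "{1..r}" and ?\<pi> = "blowdown :: hpoint bpoint \<Rightarrow> hpoint"
  interpret hirzebruch_general_blowup e ?S
    by unfold_locales (use assms(3,5,6) in auto)
  note X = assms(7)
  have m0: "0 \<le> m i" "m i \<le> a" if "i \<in> ?I" for i using assms(16) that by force+
  have "1 \<in> ?I" using assms(2) by simp
  then have a0: "0 \<le> a" using m0[of 1] by linarith
  \<comment> \<open>Hypothesis (2) says \<open>b > a * e + e - 2\<close>; since
    \<open>e \<ge> 1\<close>, integrality gives \<open>b \<ge> a * e\<close>.\<close>
  have "(a + 2) * int e = a * int e + 2 * int e" by (simp add: algebra_simps)
  then have bae: "a * int e \<le> b" using assms(1,17) by linarith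
  then have b0: "0 \<le> b" using a0 by (meson mult_nonneg_nonneg of_nat_0_le_iff order_trans)
  \<comment> \<open>Hypothesis (3) only gives \<open>b\<close> at least the sum plus
    \<open>r - e - 1\<close>, which suffices for \<open>r > e\<close>. For \<open>r \<le> e\<close>
    the sum is at most \<open>r * a \<le> e * a\<close>, and (2) takes over.\<close>
  have bm: "(\<Sum>i\<in>?I. m i) \<le> b"
  proof (cases "r \<le> e")
    case True
    have "(\<Sum>i\<in>?I. m i) \<le> (\<Sum>i\<in>?I. a)" by (rule sum_mono) (rule m0)
    also have "\<dots> = int r * a" by simp
    also have "\<dots> \<le> int e * a" using True a0 by (intro mult_right_mono) auto
    finally show ?thesis using bae by (simp add: mult.commute)
  next
    case False
    have "(\<Sum>i\<in>?I. m i + 1) = (\<Sum>i\<in>?I. m i) + int r" by (simp add: sum.distrib)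
    then show ?thesis using assms(18) False by linarith
  qed
  define M where "M q = nat (m (inv_into ?I p q))" for q
  have Mp: "m i = int (M (p i))" if "i \<in> ?I" for i
    unfolding M_def using inv_into_f_f[OF assms(4) that] m0[OF that] by simp
  have "\<exists>G. sec (nat a) (nat b) M x G"
  proof (rule sec_exists)
    show "x \<in> points (blowup (hirzebruch e) ?S)" using x X by simp
    fix q assume "q \<in> ?S"
    then obtain i where "i \<in> ?I" "q = p i" by blast
    then show "M q \<le> nat a" using Mp[OF \<open>i \<in> ?I\<close>] m0(2)[OF \<open>i \<in> ?I\<close>] by simp
  next
    have "int (nat a * e) = a * int e" using a0 by simp
    then show "nat a * e \<le> nat b" using bae by linarith
    have "int (sum M ?S) = (\<Sum>i\<in>?I. m i)"
      unfolding sum.reindex[OF assms(4)] using Mp by simp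
    then show "sum M ?S \<le> nat b" using bm by linarith
  qed
  then obtain G where G: "sec (nat a) (nat b) M x G" by blast
  obtain c1 c2 where c: "c = pclass c1 c2" "(c1, c2) \<noteq> (0, 0)" using assms(9) unfolding P1_def by blast
  obtain sC where sC: "line_bundle (hirzebruch e) OC" "curve_section (hirzebruch e) (neg_section e) OC sC"
    using assms(8) by (rule associated_to_curveE)
  obtain sf where sf: "line_bundle (hirzebruch e) Of" "curve_section (hirzebruch e) (hfiber e (pclass c1 c2)) Of sf"
    using assms(10) unfolding c(1) by (rule associated_to_curveE)
  have "\<exists>s. line_bundle X (E i) \<and> curve_section X (exceptional (hirzebruch e) ?S (p i)) (E i) s" if "i \<in> ?I" for i
  proof -
    have "associated_to_curve X (exceptional (hirzebruch e) ?S (p i)) (E i)" using assms(13) that by blast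
    then obtain s where "line_bundle X (E i)" "curve_section X (exceptional (hirzebruch e) ?S (p i)) (E i) s"
      by (rule associated_to_curveE)
    then show ?thesis by blast
  qed
  then obtain sE where sE: "\<And>i. i \<in> ?I \<Longrightarrow> line_bundle X (E i)"
      "\<And>i. i \<in> ?I \<Longrightarrow> curve_section X (exceptional (hirzebruch e) ?S (p i)) (E i) (sE i)"
    by metis
  \<comment> \<open>The model bundle: compatibility is checked for \<open>B\<close> and transported
    to \<open>L\<close> by the isomorphism \<open>u\<close>.\<close>
  define B where "B = lb_add (lb_add (lb_scale a H) (lb_scale b F)) (lb_sum X ?I (\<lambda>i. lb_scale (- m i) (E i)))"
  have nB: "nbhd B q = {z \<in> points X. ?\<pi> z \<in> nbhd OC (?\<pi> q)} \<inter> {z \<in> points X. ?\<pi> z \<in> nbhd Of (?\<pi> q)} \<inter> (\<Inter>i\<in>?I. nbhd (E i) q)" for q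
    unfolding B_def lb_add_def lb_scale_def lb_sum_def assms(11,12) lb_pullback_def by auto
  have tB: "trans B q q' z = trans OC (?\<pi> q) (?\<pi> q') (?\<pi> z) powi a * trans Of (?\<pi> q) (?\<pi> q') (?\<pi> z) powi b *
      (\<Prod>i\<in>?I. trans (E i) q q' z powi (- m i))" for q q' z
    unfolding B_def lb_add_def lb_scale_def lb_sum_def assms(11,12) lb_pullback_def by simp
  obtain u where u12: "\<forall>x\<in>points X. regular X (nbhd L x \<inter> nbhd B x) (u x) \<and> (\<forall>z\<in>nbhd L x \<inter> nbhd B x. u x z \<noteq> 0)"
    and u3: "\<forall>x\<in>points X. \<forall>y\<in>points X. \<forall>z\<in>nbhd L x \<inter> nbhd B x \<inter> nbhd L y \<inter> nbhd B y.
        u x z * trans B x y z = trans L x y z * u y z"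
    using assms(15) unfolding B_def[symmetric] lb_iso_def by blast
  have \<pi>p: "?\<pi> q \<in> points (hirzebruch e)" if "q \<in> points X" for q using blowdown_in_points that X by blast
  have cp: "chartwise_polynomial X (hirzebruch e) ?\<pi>" unfolding X by (rule blowdown_chartwise_polynomial)
  have NB: "openin (zariski X) (nbhd B q)" "q \<in> nbhd B q" if q: "q \<in> points X" for q
  proof -
    show "openin (zariski X) (nbhd B q)"
      unfolding nB
      by (intro openin_zariski_INT openin_Int openin_pullback[OF cp]
          line_bundle_open[OF sC(1) \<pi>p[OF q]] line_bundle_open[OF sf(1) \<pi>p[OF q]] line_bundle_open[OF sE(1) q] finite_atLeastAtMost)
    show "q \<in> nbhd B q"
      unfolding nB using line_bundle_centre[OF sE(1) q] q
        line_bundle_centre[OF sC(1) \<pi>p[OF q]] line_bundle_centre[OF sf(1) \<pi>p[OF q]] by blast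
  qed
  \<comment> \<open>\<open>R\<close> is the rational function and \<open>P\<close> the rational
    section of \<open>B\<close>; \<open>\<tau> q\<close> will be the regular extension of their
    product in the trivialisation \<open>q\<close>.\<close>
  define R where "R z = G (hrep (?\<pi> z)) / (cx (hrep (?\<pi> z)) ^ nat a * base_form c1 c2 (hrep (?\<pi> z)) ^ nat b)" for z
  define P where "P q z = sC (?\<pi> q) (?\<pi> z) powi a * sf (?\<pi> q) (?\<pi> z) powi b * (\<Prod>i\<in>?I. sE i q z powi (- m i))" for q z
  have "\<exists>W \<tau>. openin (zariski X) W \<and> q \<in> W \<and> regular X W \<tau> \<and> (q = x \<longrightarrow> \<tau> x \<noteq> 0) \<and>
      (\<forall>z\<in>W. ?\<pi> z \<notin> ?S \<longrightarrow> cx (hrep (?\<pi> z)) \<noteq> 0 \<longrightarrow> base_form c1 c2 (hrep (?\<pi> z)) \<noteq> 0 \<longrightarrow> \<tau> z = P q z * R z)"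
    if "q \<in> points X" for q
  proof -
    have "\<exists>W \<tau>. openin (zariski X) W \<and> q \<in> W \<and> regular X W \<tau> \<and> (q = x \<longrightarrow> \<tau> x \<noteq> 0) \<and>
      (\<forall>z\<in>W. ?\<pi> z \<notin> ?S \<longrightarrow> cx (hrep (?\<pi> z)) \<noteq> 0 \<longrightarrow> base_form c1 c2 (hrep (?\<pi> z)) \<noteq> 0 \<longrightarrow>
        \<tau> z = sC (?\<pi> q) (?\<pi> z) powi int (nat a) * sf (?\<pi> q) (?\<pi> z) powi int (nat b) *
          (\<Prod>i\<in>?I. sE i q z powi (- m i)) * R z)"
      unfolding R_def X
      by (rule local_section[OF sC sf c(2) finite_atLeastAtMost assms(4) refl _ _ _ G, where E = E])
        (fact sE(1)[unfolded X] sE(2)[unfolded X] Mp that[unfolded X])+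
    then show ?thesis unfolding P_def using a0 b0 by simp
  qed
  then obtain W \<tau> where W: "\<And>q. q \<in> points X \<Longrightarrow> openin (zariski X) (W q) \<and> q \<in> W q \<and> regular X (W q) (\<tau> q) \<and> (q = x \<longrightarrow> \<tau> q x \<noteq> 0)"
    and \<tau>: "\<And>q z. q \<in> points X \<Longrightarrow> z \<in> W q \<Longrightarrow> ?\<pi> z \<notin> ?S \<Longrightarrow> cx (hrep (?\<pi> z)) \<noteq> 0 \<Longrightarrow> base_form c1 c2 (hrep (?\<pi> z)) \<noteq> 0 \<Longrightarrow>
      \<tau> q z = P q z * R z"
    by metis
  \<comment> \<open>The bad locus consists of \<open>C_e\<close>, the auxiliary fibre and the fibres
    through the blown-up points. Whole fibres are taken, rather than exceptional curves, so that it
    is the zero set of a bihomogeneous form.\<close>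
  define K where "K v = cx v * base_form c1 c2 v * (\<Prod>q\<in>?S. lam q v)" for v
  define N where "N = {z. K (hrep (?\<pi> z)) = 0}"
  have Kp: "poly4 K" unfolding K_def lam_def by (intro poly4_intros poly4_base_form)
  have N: "sparse X N"
    unfolding N_def X
  proof (rule sparse_zero_set[OF Kp])
    show "bihom e (1 + 0 + 0) (0 + 1 + card ?S) K"
      unfolding K_def[abs_def] by (intro bihom_mult bihom_cx bihom_base_form bihom_prod_lam) simp
    fix j
    have "\<exists>v. cx (hlift j v) \<noteq> 0" by (rule exI[of _ "(0, 1)"]) (simp add: hlift_def)
    then obtain v where v: "cx (hlift j v) \<noteq> 0" by blast
    obtain w where w: "base_form c1 c2 (hlift j w) \<noteq> 0" using base_form_hlift_nonzero[OF c(2)] by blast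
    obtain y where y: "cx (hlift j y) * base_form c1 c2 (hlift j y) \<noteq> 0"
      using plane_poly_common_nonzero[OF poly4D[of "\<lambda>v. cx v" j] poly4D[OF poly4_base_form] v w] poly4_intros(3) by auto
    have "\<exists>v. (\<Prod>q\<in>?S. lam q (hlift j v)) \<noteq> 0"
    proof (rule plane_poly_prod_nonzero)
      show "plane_poly (\<lambda>v. lam q (hlift j v))" for q unfolding lam_def by (rule poly4D[OF poly4_base_form])
      fix q assume "q \<in> ?S"
      then have "q \<in> points (hirzebruch e)" using S_points by blast
      then have "(cs (hrep q), ct (hrep q)) \<noteq> (0, 0)" using hirzebruch_hrep(2) unfolding stable_def by auto
      then show "\<exists>v. lam q (hlift j v) \<noteq> 0" unfolding lam_def by (rule base_form_hlift_nonzero)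
    qed simp
    then obtain y' where y': "(\<Prod>q\<in>?S. lam q (hlift j y')) \<noteq> 0" by blast
    have "plane_poly (\<lambda>v. cx (hlift j v) * base_form c1 c2 (hlift j v))" "plane_poly (\<lambda>v. \<Prod>q\<in>?S. lam q (hlift j v))"
      unfolding lam_def by (intro plane_poly_intros poly4D[OF poly4_base_form])+
    from plane_poly_common_nonzero[OF this(1,2), of y y'] y y' obtain v'
      where "cx (hlift j v') * base_form c1 c2 (hlift j v') \<noteq> 0 \<and> (\<Prod>q\<in>?S. lam q (hlift j v')) \<noteq> 0"
      by blast
    then show "\<exists>v. K (hlift j v) \<noteq> 0" unfolding K_def by (intro exI[of _ v']) simp
  qed
  have offN: "?\<pi> z \<notin> ?S \<and> cx (hrep (?\<pi> z)) \<noteq> 0 \<and> base_form c1 c2 (hrep (?\<pi> z)) \<noteq> 0" if "z \<notin> N" for z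
  proof -
    have "(\<Prod>q\<in>?S. lam q (hrep (?\<pi> z))) \<noteq> 0" using that unfolding N_def K_def by auto
    then have "?\<pi> z \<notin> ?S" using lam_S[of "?\<pi> z" "?\<pi> z"] by (auto simp: prod_zero_iff)
    then show ?thesis using that unfolding N_def K_def by auto
  qed
  \<comment> \<open>Holds at zeros of the sections as well, since integer powers are multiplicative
    without exception.\<close>
  have Ptrans: "P q z = trans B q q' z * P q' z"
    if q: "q \<in> points X" "q' \<in> points X" and z: "z \<in> nbhd B q" "z \<in> nbhd B q'" for q q' z
  proof -
    have 1: "sC (?\<pi> q) (?\<pi> z) = trans OC (?\<pi> q) (?\<pi> q') (?\<pi> z) * sC (?\<pi> q') (?\<pi> z)"
      using z unfolding nB by (intro curve_section_trans[OF sC(2) \<pi>p[OF q(1)] \<pi>p[OF q(2)]]) blast+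
    have 2: "sf (?\<pi> q) (?\<pi> z) = trans Of (?\<pi> q) (?\<pi> q') (?\<pi> z) * sf (?\<pi> q') (?\<pi> z)"
      using z unfolding nB by (intro curve_section_trans[OF sf(2) \<pi>p[OF q(1)] \<pi>p[OF q(2)]]) blast+
    have "sE i q z = trans (E i) q q' z * sE i q' z" if "i \<in> ?I" for i
      using z that unfolding nB by (intro curve_section_trans[OF sE(2)[OF that] q]) blast+
    then have 3: "(\<Prod>i\<in>?I. sE i q z powi (- m i)) = (\<Prod>i\<in>?I. trans (E i) q q' z powi (- m i)) * (\<Prod>i\<in>?I. sE i q' z powi (- m i))"
      by (simp add: power_int_mult_distrib prod.distrib)
    show ?thesis unfolding P_def tB 1 2 3 power_int_mult_distrib by (simp add: mult_ac)
  qed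
  have "\<exists>\<sigma>. global_section X L \<sigma> \<and> (\<forall>q\<in>points X. \<sigma> q q = u q q * \<tau> q q)"
  proof (rule global_section_glue[OF assms(14) N, where W = "\<lambda>q. W q \<inter> (nbhd L q \<inter> nbhd B q)" and \<tau> = "\<lambda>q z. u q z * \<tau> q z"])
    fix q assume q: "q \<in> points X"
    show "openin (zariski X) (W q \<inter> (nbhd L q \<inter> nbhd B q)) \<and> q \<in> W q \<inter> (nbhd L q \<inter> nbhd B q) \<and>
        W q \<inter> (nbhd L q \<inter> nbhd B q) \<subseteq> nbhd L q \<and> regular X (W q \<inter> (nbhd L q \<inter> nbhd B q)) (\<lambda>z. u q z * \<tau> q z)"
      using W[OF q] NB[OF q] line_bundle_open[OF assms(14) q] line_bundle_centre[OF assms(14) q]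
      by (auto intro!: openin_Int regular_mult intro: regular_subset[OF u12[rule_format, OF q, THEN conjunct1]] regular_subset)
    fix q' z assume q': "q' \<in> points X"
      and z: "z \<in> W q \<inter> (nbhd L q \<inter> nbhd B q) \<inter> (W q' \<inter> (nbhd L q' \<inter> nbhd B q')) - N"
    have "u q z * \<tau> q z = u q z * trans B q q' z * (P q' z * R z)"
      using \<tau>[OF q, of z] offN[of z] z Ptrans[OF q q', of z] by (simp add: mult.assoc)
    \<comment> \<open>Multiplication by \<open>u\<close> turns the transition functions of
      \<open>B\<close> into those of \<open>L\<close>.\<close>
    also have "u q z * trans B q q' z = trans L q q' z * u q' z" using u3 q q' z by blast
    finally show "u q z * \<tau> q z = trans L q q' z * (u q' z * \<tau> q' z)"
      using \<tau>[OF q', of z] offN[of z] z by (simp add: mult.assoc)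
  qed
  then obtain \<sigma> where "global_section X L \<sigma>" "\<sigma> x x = u x x * \<tau> x x" using x by blast
  moreover have "u x x * \<tau> x x \<noteq> 0"
    using u12 x W[OF x] NB[OF x] line_bundle_centre[OF assms(14) x] by auto
  ultimately show "\<exists>\<sigma>. global_section X L \<sigma> \<and> \<sigma> x x \<noteq> 0" by metis
qed

end
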